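(* Let $0<\varepsilon\le 1/d$ and $\mathcal{Y}=[\varepsilon,1]^d\cap\Delta_{d-1}$, where $\Delta_{d-1}=\{p\in\mathbb{R}^d: p_i\ge 0,\ \sum_{i=1}^d p_i=1\}$. Consider an adaptive random scan adaptive Metropolis-within-Gibbs sampler (AdapRSadapMwG) for $\pi$, with selection probabilities satisfying $\alpha_n\in\mathcal{Y}$ for all $n$ and proposal parameters $\gamma_n=(\gamma_{n,1},\dots,\gamma_{n,d})\in\Gamma_1\times\dots\times\Gamma_d$. Assume that (a) for the fixed starting values $x_0\in\mathcal{X}$ and $\alpha_0\in\mathcal{Y}$, $|\alpha_n-\alpha_{n-1}|\to0$ in probability as $n\to\infty$; (b) there exists $\beta\in\mathcal{Y}$ such that the random scan Gibbs sampler RSG($\beta$) is uniformly ergodic; (c) for every $i\in\{1,\dots,d\}$, $x_{-i}\in\mathcal{X}_{-i}$ and $\gamma_i\in\Gamma_i$, the Metropolis kernel $P_{x_{-i},\gamma_i}$ on $\mathcal{X}_i$ is uniformly ergodic, and moreover there exist $s_i>0$ and an integer $m_i$ such that for every $x_{-i}\in\mathcal{X}_{-i}$ and $\gamma_i\in\Gamma_i$ there is a probability measure $\nu_{x_{-i},\gamma_i}$ on $(\mathcal{X}_i,\mathcal{B}(\mathcal{X}_i))$ with $$P_{x_{-i},\gamma_i}^{m_i}(x_i,\cdot)\ge s_i\,\nu_{x_{-i},\gamma_i}(\cdot)\quad\text{for every }x_i\in\mathcal{X}_i;$$ (d) for every $i\in\{1,\dots,d\}$, for the fixed starting values $x_0$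 and $\alpha_0$, the ($\mathcal{G}_{n+1}$-measurable) random variable $$\sup_{x\in\mathcal{X}}\|P_{x_{-i},\gamma_{n+1,i}}(x_i,\cdot)-P_{x_{-i},\gamma_{n,i}}(x_i,\cdot)\|_{TV}\to0\quad\text{in probability as }n\to\infty.$$ Then AdapRSadapMwG is ergodic, i.e. $T(x_0,\alpha_0,n)\to0$ as $n\to\infty$. Moreover, if in addition (a') $\sup_{x_0,\alpha_0}|\alpha_n-\alpha_{n-1}|\to0$ in probability, and (d') for every $i$, $\sup_{x_0,\alpha_0}\sup_{x\in\mathcal{X}}\|P_{x_{-i},\gamma_{n+1,i}}(x_i,\cdot)-P_{x_{-i},\gamma_{n,i}}(x_i,\cdot)\|_{TV}\to0$ in probability (suprema over all starting values $x_0\in\mathcal{X}$, $\alpha_0\in\mathcal{Y}$), then the convergence is uniform: $\sup_{x_0\in\mathcal{X},\,\alpha_0\in\mathcal{Y}}T(x_0,\alpha_0,n)\to0$ as $n\to\infty$.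
   Context: Setting: $\mathcal{X}=\mathcal{X}_1\times\dots\times\mathcal{X}_d$ is a general product state space with countably generated $\sigma$-field $\mathcal{B}(\mathcal{X})$, $\pi$ is a probability measure on it. For $x\in\mathcal{X}$, $x_{-i}\in\mathcal{X}_{-i}$ denotes $x$ with the $i$-th coordinate removed, and $\pi(\cdot\,|\,x_{-i})$ is the conditional distribution of $Z_i$ given $Z_{-i}=x_{-i}$, $Z\sim\pi$ (a fixed regular version); the same symbol denotes its density with respect to a reference measure on $\mathcal{X}_i$. RSG($\alpha$): the Markov chain which from $x$ chooses a coordinate $i$ with probability $\alpha_i$, draws $Y\sim\pi(\cdot\,|\,x_{-i})$, and replaces the $i$-th coordinate of $x$ by $Y$. For each $i$, $x_{-i}\in\mathcal{X}_{-i}$ and $\gamma_i\in\Gamma_i$ (a measurable parameter space), $Q_{x_{-i},\gamma_i}(x_i,\cdot)$ is a proposal kernel on $\mathcal{X}_i$ with density $q_{x_{-i},\gamma_i}(x_i,\cdot)$ (jointly measurable). $P_{x_{-i},\gamma_i}$ is the Metropolis(-Hastings) kernel on $\mathcal{X}_i$ with target $\pi(\cdot\,|\,x_{-i})$: from $x_i$, draw $Y\sim Q_{x_{-i},\gamma_i}(x_i,\cdot)$, move to $Y$ with probability $\min\left(1,\frac{\pi(Y|x_{-i})\,q_{x_{-i},\gamma_i}(Y,x_i)}{\pi(x_i|x_{-i})\,q_{x_{-i},\gamma_i}(x_i,Y)}\right)$, otherwise stay at $x_i$. AdapRSadapMwG: given $X_0=x_0$, $\alpha_0$ and a fixed $\gamma_0$,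 for $n\ge1$ set $\alpha_n:=R_n(\alpha_{n-1},X_{n-1},\dots,X_0,\gamma_{n-1},\dots,\gamma_0)\in\mathcal{Y}$ and $\gamma_n:=R_n'(\alpha_{n-1},X_{n-1},\dots,X_0,\gamma_{n-1},\dots,\gamma_0)\in\Gamma_1\times\dots\times\Gamma_d$ for some (measurable) update rules $R_n,R_n'$ (more generally, the conditional distribution of $\gamma_n$ given $\mathcal{G}_{n-1}$ is specified by the algorithm); choose a coordinate $i$ with probabilities $\alpha_n$; replace the $i$-th coordinate $X_{n-1,i}$ by a draw from $P_{X_{n-1,-i},\gamma_{n,i}}(X_{n-1,i},\cdot)$, leaving the others unchanged, to obtain $X_n$. Here $\mathcal{G}_n=\sigma\{X_0,\dots,X_n,\alpha_0,\dots,\alpha_n,\gamma_0,\dots,\gamma_n\}$. $\pi_n(x_0,\alpha_0)$ is the distribution of $X_n$ given $X_0=x_0$ and $\alpha_0$, and $T(x_0,\alpha_0,n):=\|\pi_n(x_0,\alpha_0)-\pi\|_{TV}$. A kernel $P$ with stationary distribution $\pi$ is uniformly ergodic if there are $M<\infty$, $\rho<1$ with $\|P^n(x,\cdot)-\pi\|_{TV}\le M\rho^n$ for all $x$ and $n$. $|\cdot|$ is the Euclidean norm on $\mathbb{R}^d$. In (a') and (d'), the processes for the different starting values are regarded as constructed on a common probability space. *)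

theory Defs
  imports "HOL-Probability.Probability"
begin

text \<open>
  The coordinates are indexed by a finite type \<open>'d\<close>, so \<open>d = CARD('d)\<close>. The factor
  \<open>X_i\<close> of the state space is the measurable space underlying \<open>S i\<close>; the measure \<open>S i\<close>
  itself is the reference measure on \<open>X_i\<close> and enters only through \<^const>\<open>density\<close>. States are
  functions \<open>'d \<Rightarrow> 'a\<close>, selection probabilities are vectors in \<open>real ^ 'd\<close>.
\<close>

abbreviation (input) state_space :: "('d::finite \<Rightarrow> 'a measure) \<Rightarrow> ('d \<Rightarrow> 'a) measure" where
  "state_space S \<equiv> PiM UNIV S"

abbreviation (input) drop_space :: "('d::finite \<Rightarrow> 'a measure) \<Rightarrow> 'd \<Rightarrow> ('d \<Rightarrow> 'a) measure" where
  "drop_space S i \<equiv> PiM (- {i}) S"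

definition drop_coord :: "'d \<Rightarrow> ('d \<Rightarrow> 'a) \<Rightarrow> ('d \<Rightarrow> 'a)" where
  "drop_coord i x = restrict x (- {i})"

definition countably_generated :: "'a measure \<Rightarrow> bool" where
  "countably_generated M \<longleftrightarrow>
     (\<exists>E. countable E \<and> E \<subseteq> Pow (space M) \<and> sets M = sigma_sets (space M) E)"


section \<open>Total variation, ergodicity, convergence in probability\<close>

definition tv_dist :: "'a measure \<Rightarrow> 'a measure \<Rightarrow> real" where
  "tv_dist \<mu> \<nu> = (SUP A\<in>sets \<mu>. \<bar>measure \<mu> A - measure \<nu> A\<bar>)"

primrec kernel_pow :: "'a measure \<Rightarrow> ('a \<Rightarrow> 'a measure) \<Rightarrow> nat \<Rightarrow> 'a \<Rightarrow> 'a measure" where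
  "kernel_pow M K 0 = return M"
| "kernel_pow M K (Suc n) = (\<lambda>x. kernel_pow M K n x \<bind> K)"

text \<open>Invariance of \<open>\<mu>\<close> under \<open>K\<close> need not be required separately: it follows from the bound.\<close>

definition uniformly_ergodic :: "'a measure \<Rightarrow> ('a \<Rightarrow> 'a measure) \<Rightarrow> 'a measure \<Rightarrow> bool" where
  "uniformly_ergodic M K \<mu> \<longleftrightarrow>
     (\<exists>C \<rho>. 0 \<le> \<rho> \<and> \<rho> < 1 \<and>
        (\<forall>x\<in>space M. \<forall>n. tv_dist (kernel_pow M K n x) \<mu> \<le> C * \<rho> ^ n))"

text \<open>
  Suprema over uncountable families need not be measurable, hence the outer measure; for
  measurable \<open>f n\<close> this is ordinary convergence in probability.
\<close>

definition tends_to_0_in_prob :: "'w measure \<Rightarrow> (nat \<Rightarrow> 'w \<Rightarrow> real) \<Rightarrow> bool" where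
  "tends_to_0_in_prob \<Omega> f \<longleftrightarrow>
     (\<forall>e>0. (\<lambda>n. outer_measure_of \<Omega> {\<omega> \<in> space \<Omega>. e < \<bar>f n \<omega>\<bar>}) \<longlonglongrightarrow> 0)"

text \<open>\<open>K\<close> is a regular version of the conditional distribution of \<open>Y\<close> given the sub-\<open>\<sigma>\<close>-algebra \<open>F\<close>.\<close>

definition is_cond_distr ::
  "'w measure \<Rightarrow> 'w measure \<Rightarrow> ('w \<Rightarrow> 'b) \<Rightarrow> 'b measure \<Rightarrow> ('w \<Rightarrow> 'b measure) \<Rightarrow> bool" where
  "is_cond_distr \<Omega> F Y N K \<longleftrightarrow>
     K \<in> F \<rightarrow>\<^sub>M prob_algebra N \<and>
     (\<forall>A\<in>sets N. AE \<omega> in \<Omega>. real_cond_exp \<Omega> F (\<lambda>\<omega>'. indicator A (Y \<omega>')) \<omega> = measure (K \<omega>) A)"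


section \<open>The Markov kernels\<close>

text \<open>
  One random scan step with selection probabilities \<open>a\<close> (a probability vector), where the new
  value of coordinate \<open>i\<close> is drawn from \<open>U i x\<close>.
\<close>

definition random_scan ::
  "('d::finite \<Rightarrow> 'a measure) \<Rightarrow> ('d \<Rightarrow> ('d \<Rightarrow> 'a) \<Rightarrow> 'a measure) \<Rightarrow> real ^ 'd \<Rightarrow>
   ('d \<Rightarrow> 'a) \<Rightarrow> ('d \<Rightarrow> 'a) measure" where
  "random_scan S U a x =
     measure_pmf (embed_pmf (\<lambda>i. a $ i)) \<bind> (\<lambda>i. distr (U i x) (state_space S) (\<lambda>y. x(i := y)))"

definition rsg ::
  "('d::finite \<Rightarrow> 'a measure) \<Rightarrow> ('d \<Rightarrow> ('d \<Rightarrow> 'a) \<Rightarrow> 'a measure) \<Rightarrow> real ^ 'd \<Rightarrow>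
   ('d \<Rightarrow> 'a) \<Rightarrow> ('d \<Rightarrow> 'a) measure" where
  "rsg S \<kappa> = random_scan S (\<lambda>i x. \<kappa> i (drop_coord i x))"

text \<open>The acceptance ratio \<open>0/0\<close> is read as acceptance with probability one.\<close>

definition mh_accept :: "('a \<Rightarrow> real) \<Rightarrow> ('a \<Rightarrow> 'a \<Rightarrow> real) \<Rightarrow> 'a \<Rightarrow> 'a \<Rightarrow> real" where
  "mh_accept p q x y =
     (if p x * q x y = 0 then 1 else min 1 ((p y * q y x) / (p x * q x y)))"

definition mh_kernel ::
  "'a measure \<Rightarrow> ('a \<Rightarrow> real) \<Rightarrow> ('a \<Rightarrow> 'a measure) \<Rightarrow> ('a \<Rightarrow> 'a \<Rightarrow> real) \<Rightarrow> 'a \<Rightarrow> 'a measure" where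
  "mh_kernel M p Q q x =
     Q x \<bind> (\<lambda>y. measure_pmf (bernoulli_pmf (mh_accept p q x y)) \<bind>
       (\<lambda>accept. return M (if accept then y else x)))"

text \<open>The kernel \<open>P\<close> with index \<open>z = x_{-i}\<close>, \<open>g = \<gamma>_i\<close>.\<close>

definition metropolis ::
  "('d \<Rightarrow> 'a measure) \<Rightarrow> ('d \<Rightarrow> ('d \<Rightarrow> 'a) \<Rightarrow> 'a \<Rightarrow> real) \<Rightarrow>
   ('d \<Rightarrow> ('d \<Rightarrow> 'a) \<Rightarrow> 'g \<Rightarrow> 'a \<Rightarrow> 'a measure) \<Rightarrow>
   ('d \<Rightarrow> ('d \<Rightarrow> 'a) \<Rightarrow> 'g \<Rightarrow> 'a \<Rightarrow> 'a \<Rightarrow> real) \<Rightarrow>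
   'd \<Rightarrow> ('d \<Rightarrow> 'a) \<Rightarrow> 'g \<Rightarrow> 'a \<Rightarrow> 'a measure" where
  "metropolis S p Q q i z g = mh_kernel (S i) (p i z) (Q i z g) (q i z g)"

definition mwg ::
  "('d::finite \<Rightarrow> 'a measure) \<Rightarrow> ('d \<Rightarrow> ('d \<Rightarrow> 'a) \<Rightarrow> 'g \<Rightarrow> 'a \<Rightarrow> 'a measure) \<Rightarrow>
   real ^ 'd \<Rightarrow> ('d \<Rightarrow> 'g) \<Rightarrow> ('d \<Rightarrow> 'a) \<Rightarrow> ('d \<Rightarrow> 'a) measure" where
  "mwg S P a g = random_scan S (\<lambda>i x. P i (drop_coord i x) (g i) (x i)) a"


section \<open>Target, conditional distributions and proposals\<close>

locale mwg_setting =
  fixes S :: "'d::finite \<Rightarrow> 'a measure"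
    and \<Gamma> :: "'d \<Rightarrow> 'g measure"
    and \<pi> :: "('d \<Rightarrow> 'a) measure"
    and \<kappa> :: "'d \<Rightarrow> ('d \<Rightarrow> 'a) \<Rightarrow> 'a measure"   \<comment> \<open>\<open>\<kappa> i z\<close> is the conditional distribution given \<open>x_{-i} = z\<close>\<close>
    and p :: "'d \<Rightarrow> ('d \<Rightarrow> 'a) \<Rightarrow> 'a \<Rightarrow> real"   \<comment> \<open>its density\<close>
    and Q :: "'d \<Rightarrow> ('d \<Rightarrow> 'a) \<Rightarrow> 'g \<Rightarrow> 'a \<Rightarrow> 'a measure"
    and q :: "'d \<Rightarrow> ('d \<Rightarrow> 'a) \<Rightarrow> 'g \<Rightarrow> 'a \<Rightarrow> 'a \<Rightarrow> real"
  assumes countably_generated: "countably_generated (state_space S)"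
    and prob_target: "prob_space \<pi>"
    and sets_target: "sets \<pi> = sets (state_space S)"
    and cond_kernel: "\<And>i. \<kappa> i \<in> drop_space S i \<rightarrow>\<^sub>M prob_algebra (S i)"
    and cond_distr: "\<And>i. is_cond_distr \<pi>
           (vimage_algebra (space \<pi>) (drop_coord i) (drop_space S i))
           (\<lambda>x. x i) (S i) (\<lambda>x. \<kappa> i (drop_coord i x))"
    and cond_density_measurable:
      "\<And>i. (\<lambda>(z, y). p i z y) \<in> borel_measurable (drop_space S i \<Otimes>\<^sub>M S i)"
    and cond_density_nonneg:
      "\<And>i z y. z \<in> space (drop_space S i) \<Longrightarrow> y \<in> space (S i) \<Longrightarrow> 0 \<le> p i z y"
    and cond_density:
      "\<And>i z. z \<in> space (drop_space S i) \<Longrightarrow> \<kappa> i z = density (S i) (\<lambda>y. ennreal (p i z y))"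
    and proposal_kernel:
      "\<And>i. (\<lambda>(z, g, x). Q i z g x) \<in> drop_space S i \<Otimes>\<^sub>M \<Gamma> i \<Otimes>\<^sub>M S i \<rightarrow>\<^sub>M prob_algebra (S i)"
    and proposal_density_measurable:
      "\<And>i. (\<lambda>(z, g, x, y). q i z g x y) \<in> borel_measurable (drop_space S i \<Otimes>\<^sub>M \<Gamma> i \<Otimes>\<^sub>M S i \<Otimes>\<^sub>M S i)"
    and proposal_density_nonneg:
      "\<And>i z g x y. z \<in> space (drop_space S i) \<Longrightarrow> g \<in> space (\<Gamma> i) \<Longrightarrow> x \<in> space (S i) \<Longrightarrow>
         y \<in> space (S i) \<Longrightarrow> 0 \<le> q i z g x y"
    and proposal_density:
      "\<And>i z g x. z \<in> space (drop_space S i) \<Longrightarrow> g \<in> space (\<Gamma> i) \<Longrightarrow> x \<in> space (S i) \<Longrightarrow>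
         Q i z g x = density (S i) (\<lambda>y. ennreal (q i z g x y))"


section \<open>The adaptive sampler\<close>

definition prob_simplex :: "(real ^ 'd::finite) set" where
  "prob_simplex = {a. (\<forall>i. 0 \<le> a $ i) \<and> (\<Sum>i\<in>UNIV. a $ i) = 1}"

definition sel_probs :: "real \<Rightarrow> (real ^ 'd::finite) set" where
  "sel_probs \<epsilon> = {a. \<forall>i. a $ i \<in> {\<epsilon>..1}} \<inter> prob_simplex"

abbreviation (input) sel_space :: "real \<Rightarrow> (real ^ 'd::finite) measure" where
  "sel_space \<epsilon> \<equiv> restrict_space borel (sel_probs \<epsilon>)"

definition traj_space ::
  "('d::finite \<Rightarrow> 'a measure) \<Rightarrow> ('d \<Rightarrow> 'g measure) \<Rightarrow> real \<Rightarrow> nat \<Rightarrow>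
   (nat \<Rightarrow> ('d \<Rightarrow> 'a) \<times> (real ^ 'd) \<times> ('d \<Rightarrow> 'g)) measure" where
  "traj_space S \<Gamma> \<epsilon> n = PiM {..n} (\<lambda>_. state_space S \<Otimes>\<^sub>M sel_space \<epsilon> \<Otimes>\<^sub>M PiM UNIV \<Gamma>)"

definition traj ::
  "(nat \<Rightarrow> 'w \<Rightarrow> 'x) \<Rightarrow> (nat \<Rightarrow> 'w \<Rightarrow> 'y) \<Rightarrow> (nat \<Rightarrow> 'w \<Rightarrow> 'z) \<Rightarrow> nat \<Rightarrow> 'w \<Rightarrow> nat \<Rightarrow> 'x \<times> 'y \<times> 'z" where
  "traj X \<alpha> \<gamma> n \<omega> = (\<lambda>k\<in>{..n}. (X k \<omega>, \<alpha> k \<omega>, \<gamma> k \<omega>))"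

text \<open>
  An adaptation rule: \<open>R n\<close> is the update function of the selection probabilities, and \<open>L n\<close> gives
  the conditional distribution of \<open>\<gamma>\<^sub>n\<close> given the trajectory up to time \<open>n - 1\<close>; a deterministic
  update of \<open>\<gamma>\<^sub>n\<close> is the special case where \<open>L n\<close> is a Dirac kernel.
\<close>

definition adaptation_rule ::
  "('d::finite \<Rightarrow> 'a measure) \<Rightarrow> ('d \<Rightarrow> 'g measure) \<Rightarrow> real \<Rightarrow>
   (nat \<Rightarrow> (real ^ 'd) \<times> (nat \<Rightarrow> 'd \<Rightarrow> 'a) \<times> (nat \<Rightarrow> 'd \<Rightarrow> 'g) \<Rightarrow> real ^ 'd) \<Rightarrow>
   (nat \<Rightarrow> (nat \<Rightarrow> ('d \<Rightarrow> 'a) \<times> (real ^ 'd) \<times> ('d \<Rightarrow> 'g)) \<Rightarrow> ('d \<Rightarrow> 'g) measure) \<Rightarrow> bool" where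
  "adaptation_rule S \<Gamma> \<epsilon> R L \<longleftrightarrow>
     (\<forall>n. R (Suc n) \<in> sel_space \<epsilon> \<Otimes>\<^sub>M PiM {..n} (\<lambda>_. state_space S) \<Otimes>\<^sub>M PiM {..n} (\<lambda>_. PiM UNIV \<Gamma>)
            \<rightarrow>\<^sub>M sel_space \<epsilon>) \<and>
     (\<forall>n. L (Suc n) \<in> traj_space S \<Gamma> \<epsilon> n \<rightarrow>\<^sub>M prob_algebra (PiM UNIV \<Gamma>))"

text \<open>
  \<open>(X, \<alpha>, \<gamma>)\<close> is, on the probability space \<open>\<Omega>\<close>, the adaptive random scan adaptive
  Metropolis-within-Gibbs sampler with Metropolis kernels \<open>P\<close>, adaptation rule \<open>(R, L)\<close> and starting
  values \<open>x0, \<alpha>0, \<gamma>0\<close>. The \<open>\<sigma>\<close>-algebra generated by \<open>traj X \<alpha> \<gamma> n\<close> is the paper's \<open>G_n\<close>; given \<open>G_n\<close>,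
  \<open>\<alpha>\<^sub>n\<^sub>+\<^sub>1\<close> and \<open>\<gamma>\<^sub>n\<^sub>+\<^sub>1\<close>, the next state is a draw from the Metropolis-within-Gibbs kernel (the
  auxiliary choice of the coordinate is integrated out).
\<close>

definition adap_rs_adap_mwg ::
  "('d::finite \<Rightarrow> 'a measure) \<Rightarrow> ('d \<Rightarrow> 'g measure) \<Rightarrow> ('d \<Rightarrow> ('d \<Rightarrow> 'a) \<Rightarrow> 'g \<Rightarrow> 'a \<Rightarrow> 'a measure) \<Rightarrow>
   real \<Rightarrow>
   (nat \<Rightarrow> (real ^ 'd) \<times> (nat \<Rightarrow> 'd \<Rightarrow> 'a) \<times> (nat \<Rightarrow> 'd \<Rightarrow> 'g) \<Rightarrow> real ^ 'd) \<Rightarrow>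
   (nat \<Rightarrow> (nat \<Rightarrow> ('d \<Rightarrow> 'a) \<times> (real ^ 'd) \<times> ('d \<Rightarrow> 'g)) \<Rightarrow> ('d \<Rightarrow> 'g) measure) \<Rightarrow>
   ('d \<Rightarrow> 'g) \<Rightarrow> ('d \<Rightarrow> 'a) \<Rightarrow> real ^ 'd \<Rightarrow> 'w measure \<Rightarrow>
   (nat \<Rightarrow> 'w \<Rightarrow> 'd \<Rightarrow> 'a) \<Rightarrow> (nat \<Rightarrow> 'w \<Rightarrow> real ^ 'd) \<Rightarrow> (nat \<Rightarrow> 'w \<Rightarrow> 'd \<Rightarrow> 'g) \<Rightarrow> bool" where
  "adap_rs_adap_mwg S \<Gamma> P \<epsilon> R L \<gamma>0 x0 \<alpha>0 \<Omega> X \<alpha> \<gamma> \<longleftrightarrow>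
     prob_space \<Omega> \<and>
     (\<forall>n. X n \<in> \<Omega> \<rightarrow>\<^sub>M state_space S) \<and>
     (\<forall>n. \<alpha> n \<in> \<Omega> \<rightarrow>\<^sub>M sel_space \<epsilon>) \<and>
     (\<forall>n. \<gamma> n \<in> \<Omega> \<rightarrow>\<^sub>M PiM UNIV \<Gamma>) \<and>
     (\<forall>\<omega>\<in>space \<Omega>. X 0 \<omega> = x0 \<and> \<alpha> 0 \<omega> = \<alpha>0 \<and> \<gamma> 0 \<omega> = \<gamma>0) \<and>
     (\<forall>n. \<forall>\<omega>\<in>space \<Omega>.
        \<alpha> (Suc n) \<omega> = R (Suc n) (\<alpha> n \<omega>, (\<lambda>k\<in>{..n}. X k \<omega>), (\<lambda>k\<in>{..n}. \<gamma> k \<omega>))) \<and>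
     (\<forall>n. is_cond_distr \<Omega>
        (vimage_algebra (space \<Omega>) (traj X \<alpha> \<gamma> n) (traj_space S \<Gamma> \<epsilon> n))
        (\<gamma> (Suc n)) (PiM UNIV \<Gamma>) (\<lambda>\<omega>. L (Suc n) (traj X \<alpha> \<gamma> n \<omega>))) \<and>
     (\<forall>n. is_cond_distr \<Omega>
        (vimage_algebra (space \<Omega>) (\<lambda>\<omega>. (traj X \<alpha> \<gamma> n \<omega>, \<alpha> (Suc n) \<omega>, \<gamma> (Suc n) \<omega>))
           (traj_space S \<Gamma> \<epsilon> n \<Otimes>\<^sub>M sel_space \<epsilon> \<Otimes>\<^sub>M PiM UNIV \<Gamma>))
        (X (Suc n)) (state_space S) (\<lambda>\<omega>. mwg S P (\<alpha> (Suc n) \<omega>) (\<gamma> (Suc n) \<omega>) (X n \<omega>)))"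

definition kernel_change ::
  "('d::finite \<Rightarrow> 'a measure) \<Rightarrow> ('d \<Rightarrow> ('d \<Rightarrow> 'a) \<Rightarrow> 'g \<Rightarrow> 'a \<Rightarrow> 'a measure) \<Rightarrow> 'd \<Rightarrow>
   ('d \<Rightarrow> 'g) \<Rightarrow> ('d \<Rightarrow> 'g) \<Rightarrow> real" where
  "kernel_change S P i g' g =
     (SUP x\<in>space (state_space S).
        tv_dist (P i (drop_coord i x) (g' i) (x i)) (P i (drop_coord i x) (g i) (x i)))"

end

theory Submission
  imports Defs
begin

text \<open>
  Markov kernels are studied through their action on \<open>[0,1]\<close>-valued functions, and ergodicity is
  measured by the contraction of the oscillation \<open>sup f - inf f\<close>; no small sets are needed.
  Minorization makes the \<open>k\<close>-fold iterates of the Metropolis kernels approach the conditional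
  distributions, uniformly in all parameters. Choosing the same coordinate \<open>k\<close> times in a row has
  probability at least \<open>\<epsilon>\<^sup>k\<close>, so \<open>k\<close> steps of the sampler with frozen parameters dominate \<open>\<epsilon>\<^sup>k\<close> times an
  operator close to RSG(\<open>\<beta>\<close>). As some iterate of RSG(\<open>\<beta>\<close>) contracts, all frozen samplers
  converge to \<open>\<pi>\<close> at a common rate. Finally, over \<open>N\<close> steps the adaptive chain is compared with the
  sampler whose parameters are frozen at time \<open>n\<close>: the error is at most \<open>N\<close> times the expected change of
  the kernel, which vanishes as \<open>n \<rightarrow> \<infinity>\<close> by diminishing adaptation.
\<close>

section \<open>Markov operators on bounded functions\<close>

text \<open>The minorizing measures may depend on the remaining coordinates and on the proposal
  parameter in a non-measurable way, so they cannot be integrated or merged into one minorizing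
  measure for the full chain. The oscillation bound \<open>1 - s\<close> that they imply contains no
  trace of the measure; it is uniform and can be passed on. The constants of uniform ergodicity of
  the single Metropolis kernels may vary with these parameters; that assumption supplies the
  invariance of the conditional distributions, and minorization supplies the common rate.

  The coefficient of RSG(\<beta>) is first brought down to 1/4. Replacing Gibbs steps by iterated
  Metropolis steps adds at most 1/4, and the resulting 1/2 becomes 1 - \<epsilon>^(nk) / 2 after
  minorization.

  The parameters frozen at time n are random. Conditioning on the past therefore meets test
  functions that depend on them, which is why measurability is proved jointly in parameter and
  state. Bounds on the adaptation may be non-measurable suprema, so only their outer measure is
  estimated.\<close>

definition bfun :: "'a measure \<Rightarrow> ('a \<Rightarrow> real) set" where
  "bfun M = {f \<in> borel_measurable M. \<exists>B. \<forall>x\<in>space M. \<bar>f x\<bar> \<le> B}"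

text \<open>The range [0,1] is the normalization that matches total variation: indicators of
  measurable sets belong to the class, and every member has oscillation at most one.\<close>

definition ufun :: "'a measure \<Rightarrow> ('a \<Rightarrow> real) set" where
  "ufun M = {f \<in> borel_measurable M. \<forall>x\<in>space M. 0 \<le> f x \<and> f x \<le> 1}"

text \<open>Axioms for the action of a kernel on functions, so that powers and mixtures can be
  handled without building kernels for them. Values count only at points of \<open>space M\<close>,
  since functions are total on the type.\<close>

definition markov_op :: "'a measure \<Rightarrow> (('a \<Rightarrow> real) \<Rightarrow> 'a \<Rightarrow> real) \<Rightarrow> bool" where
  "markov_op M T \<longleftrightarrow>
     (\<forall>f\<in>bfun M. T f \<in> bfun M) \<and>
     (\<forall>f\<in>bfun M. \<forall>g\<in>bfun M. \<forall>a b. \<forall>x\<in>space M.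
        T (\<lambda>y. a * f y + b * g y) x = a * T f x + b * T g x) \<and>
     (\<forall>f\<in>bfun M. (\<forall>x\<in>space M. 0 \<le> f x) \<longrightarrow> (\<forall>x\<in>space M. 0 \<le> T f x)) \<and>
     (\<forall>x\<in>space M. T (\<lambda>_. 1) x = 1)"

text \<open>This is the statement that Dobrushin's ergodicity coefficient is at most \<delta>: for a
  kernel it bounds the total variation distance between the laws started at any two points.\<close>

definition osc_contraction :: "'a measure \<Rightarrow> (('a \<Rightarrow> real) \<Rightarrow> 'a \<Rightarrow> real) \<Rightarrow> real \<Rightarrow> bool" where
  "osc_contraction M T \<delta> \<longleftrightarrow>
     (\<forall>f\<in>ufun M. \<forall>x\<in>space M. \<forall>y\<in>space M. T f x - T f y \<le> \<delta>)"

text \<open>Source and target types differ so that regular conditional distributions, indexed by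
  sample points, are covered as well as transition kernels.\<close>

definition kernel_op :: "('a \<Rightarrow> 'b measure) \<Rightarrow> ('b \<Rightarrow> real) \<Rightarrow> 'a \<Rightarrow> real" where
  "kernel_op K f x = (\<integral>y. f y \<partial>K x)"

lemma bfunI: "f \<in> borel_measurable M \<Longrightarrow> (\<And>x. x \<in> space M \<Longrightarrow> \<bar>f x\<bar> \<le> B) \<Longrightarrow> f \<in> bfun M"
  by (auto simp: bfun_def)

lemma bfunE:
  assumes "f \<in> bfun M"
  obtains B where "B \<ge> 0" "f \<in> borel_measurable M" "\<And>x. x \<in> space M \<Longrightarrow> \<bar>f x\<bar> \<le> B"
proof -
  obtain B where "f \<in> borel_measurable M" "\<And>x. x \<in> space M \<Longrightarrow> \<bar>f x\<bar> \<le> B"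
    using assms by (auto simp: bfun_def)
  then show ?thesis by (intro that[of "max 0 B"]) force+
qed

lemma ufun_imp_bfun: "f \<in> ufun M \<Longrightarrow> f \<in> bfun M"
  by (auto simp: ufun_def intro!: bfunI[where B=1])

lemma ufun_indicator: "A \<in> sets M \<Longrightarrow> indicator A \<in> ufun M"
  by (auto simp: ufun_def indicator_def)

lemma ufun_one_minus: "f \<in> ufun M \<Longrightarrow> (\<lambda>x. 1 - f x) \<in> ufun M"
  by (auto simp: ufun_def)

lemma bfun_const: "(\<lambda>_. c) \<in> bfun M"
  by (auto intro!: bfunI)

lemma bfun_lincomb:
  assumes "f \<in> bfun M" "g \<in> bfun M"
  shows "(\<lambda>x. a * f x + b * g x) \<in> bfun M"
proof -
  from assms obtain B C where B: "f \<in> borel_measurable M" "\<And>x. x \<in> space M \<Longrightarrow> \<bar>f x\<bar> \<le> B"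
    and C: "g \<in> borel_measurable M" "\<And>x. x \<in> space M \<Longrightarrow> \<bar>g x\<bar> \<le> C"
    by (auto elim!: bfunE)
  have "\<bar>a * f x + b * g x\<bar> \<le> \<bar>a\<bar> * B + \<bar>b\<bar> * C" if "x \<in> space M" for x
  proof -
    have "\<bar>a * f x\<bar> \<le> \<bar>a\<bar> * B" "\<bar>b * g x\<bar> \<le> \<bar>b\<bar> * C"
      using B C that by (auto simp: abs_mult intro!: mult_left_mono)
    then show ?thesis by linarith
  qed
  then show ?thesis using B C by (auto intro!: bfunI)
qed

lemma bfun_add: "f \<in> bfun M \<Longrightarrow> g \<in> bfun M \<Longrightarrow> (\<lambda>x. f x + g x) \<in> bfun M"
  using bfun_lincomb[of f M g 1 1] by simp

lemma bfun_diff: "f \<in> bfun M \<Longrightarrow> g \<in> bfun M \<Longrightarrow> (\<lambda>x. f x - g x) \<in> bfun M"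
  using bfun_lincomb[of f M g 1 "-1"] by simp

lemma bfun_cmult: "f \<in> bfun M \<Longrightarrow> (\<lambda>x. c * f x) \<in> bfun M"
  using bfun_lincomb[of f M f c 0] by simp

lemma bfun_sum: "(\<And>i. i \<in> I \<Longrightarrow> f i \<in> bfun M) \<Longrightarrow> (\<lambda>x. \<Sum>i\<in>I. f i x) \<in> bfun M"
  by (induction I rule: infinite_finite_induct) (auto simp: bfun_const intro!: bfun_add)

lemma bfun_cong:
  assumes f: "f \<in> bfun M" and eq: "\<And>x. x \<in> space M \<Longrightarrow> g x = f x"
  shows "g \<in> bfun M"
proof -
  have "g \<in> borel_measurable M \<longleftrightarrow> f \<in> borel_measurable M" by (rule measurable_cong[OF eq])
  then show ?thesis using f eq by (simp add: bfun_def)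
qed

lemma bfun_mult:
  assumes "f \<in> bfun M" "g \<in> bfun M"
  shows "(\<lambda>x. f x * g x) \<in> bfun M"
proof -
  obtain B where B: "B \<ge> 0" "f \<in> borel_measurable M" "\<And>x. x \<in> space M \<Longrightarrow> \<bar>f x\<bar> \<le> B"
    using assms(1) by (rule bfunE) blast
  obtain C where C: "C \<ge> 0" "g \<in> borel_measurable M" "\<And>x. x \<in> space M \<Longrightarrow> \<bar>g x\<bar> \<le> C"
    using assms(2) by (rule bfunE) blast
  show ?thesis
    using B C by (intro bfunI[where B="B * C"]) (auto simp: abs_mult intro!: mult_mono)
qed

lemma integrable_bfun:
  assumes "f \<in> bfun M" "finite_measure N" "sets N = sets M"
  shows "integrable N f"
proof -
  interpret finite_measure N by fact
  from assms show ?thesis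
    by (auto elim!: bfunE intro!: integrable_const_bound AE_I2
        simp: measurable_cong_sets[OF assms(3) refl] sets_eq_imp_space_eq[OF assms(3)])
qed

section \<open>Abstract Markov operators\<close>

lemma
  assumes "markov_op M T"
  shows markov_op_bfun: "f \<in> bfun M \<Longrightarrow> T f \<in> bfun M"
    and markov_op_lincomb: "f \<in> bfun M \<Longrightarrow> g \<in> bfun M \<Longrightarrow> x \<in> space M \<Longrightarrow>
        T (\<lambda>y. a * f y + b * g y) x = a * T f x + b * T g x"
    and markov_op_nonneg: "f \<in> bfun M \<Longrightarrow> (\<And>x. x \<in> space M \<Longrightarrow> 0 \<le> f x) \<Longrightarrow> x \<in> space M \<Longrightarrow> 0 \<le> T f x"
    and markov_op_one: "x \<in> space M \<Longrightarrow> T (\<lambda>_. 1) x = 1"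
  using assms unfolding markov_op_def by blast+

lemma markov_op_diff:
  assumes "markov_op M T" "f \<in> bfun M" "g \<in> bfun M" "x \<in> space M"
  shows "T (\<lambda>y. f y - g y) x = T f x - T g x"
  using markov_op_lincomb[OF assms, of 1 "-1"] by simp

lemma markov_op_mono:
  assumes "markov_op M T" "f \<in> bfun M" "g \<in> bfun M" "x \<in> space M"
    and "\<And>y. y \<in> space M \<Longrightarrow> f y \<le> g y"
  shows "T f x \<le> T g x"
  using markov_op_nonneg[OF assms(1) bfun_diff[OF assms(3,2)] _ assms(4)] assms(5)
    markov_op_diff[OF assms(1,3,2,4)] by simp

lemma markov_op_cong:
  assumes "markov_op M T" "f \<in> bfun M" "g \<in> bfun M" "x \<in> space M"
    and "\<And>y. y \<in> space M \<Longrightarrow> f y = g y"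
  shows "T f x = T g x"
  using markov_op_mono[OF assms(1-4)] markov_op_mono[OF assms(1,3,2,4)] assms(5) by force

lemma markov_op_affine:
  assumes "markov_op M T" "f \<in> bfun M" "x \<in> space M"
  shows "T (\<lambda>y. a * f y + b) x = a * T f x + b"
  using markov_op_lincomb[OF assms(1,2) bfun_const[of 1] assms(3), of a b] markov_op_one[OF assms(1,3)]
  by simp

lemma markov_op_const:
  assumes "markov_op M T" "x \<in> space M"
  shows "T (\<lambda>y. c) x = c"
  using markov_op_affine[OF assms(1) bfun_const assms(2), of 0 0 c] by simp

lemma markov_op_ufun:
  assumes "markov_op M T" "f \<in> ufun M"
  shows "T f \<in> ufun M"
proof -
  have f: "f \<in> bfun M" using assms(2) by (rule ufun_imp_bfun)
  have "0 \<le> T f x \<and> T f x \<le> 1" if x: "x \<in> space M" for x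
    using markov_op_mono[OF assms(1) bfun_const[of 0] f x] markov_op_mono[OF assms(1) f bfun_const[of 1] x]
      assms markov_op_const[OF assms(1) x] by (auto simp: ufun_def)
  moreover have "T f \<in> borel_measurable M"
    using markov_op_bfun[OF assms(1) f] by (auto simp: bfun_def)
  ultimately show ?thesis by (auto simp: ufun_def)
qed

text \<open>Positivity is applied to f <= g + c and to g <= f + c. This nonexpansiveness in the
  supremum norm is what lets errors add up linearly over many steps.\<close>

lemma markov_op_abs_le:
  assumes "markov_op M T" "f \<in> bfun M" "g \<in> bfun M" "x \<in> space M"
    and "\<And>y. y \<in> space M \<Longrightarrow> \<bar>f y - g y\<bar> \<le> c"
  shows "\<bar>T f x - T g x\<bar> \<le> c"
proof -
  have "T f x \<le> T (\<lambda>y. 1 * g y + c) x" "T g x \<le> T (\<lambda>y. 1 * f y + c) x"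
    using assms(5) bfun_lincomb[OF assms(3) bfun_const, of 1 1 c] bfun_lincomb[OF assms(2) bfun_const, of 1 1 c]
    by (intro markov_op_mono[OF assms(1)]; use assms in \<open>fastforce simp: abs_le_iff\<close>)+
  then show ?thesis
    unfolding markov_op_affine[OF assms(1,2,4)] markov_op_affine[OF assms(1,3,4)] by linarith
qed

lemma markov_op_id: "markov_op M (\<lambda>f. f)"
  by (auto simp: markov_op_def)

lemma markov_op_comp:
  assumes T: "markov_op M T" and U: "markov_op M U"
  shows "markov_op M (\<lambda>f. T (U f))"
  unfolding markov_op_def[of M "\<lambda>f. T (U f)"]
proof (intro conjI ballI allI impI)
  fix f assume f: "f \<in> bfun M"
  show "T (U f) \<in> bfun M" by (intro markov_op_bfun[OF T] markov_op_bfun[OF U] f)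
next
  fix f g a b x assume fg: "f \<in> bfun M" "g \<in> bfun M" and x: "x \<in> space M"
  have "T (U (\<lambda>y. a * f y + b * g y)) x = T (\<lambda>z. a * U f z + b * U g z) x"
    using fg x by (intro markov_op_cong[OF T] markov_op_bfun[OF U] bfun_lincomb markov_op_lincomb[OF U])
  also have "\<dots> = a * T (U f) x + b * T (U g) x"
    using fg x by (intro markov_op_lincomb[OF T] markov_op_bfun[OF U])
  finally show "T (U (\<lambda>y. a * f y + b * g y)) x = a * T (U f) x + b * T (U g) x" .
next
  fix f x assume "f \<in> bfun M" "\<forall>x\<in>space M. 0 \<le> f x" "x \<in> space M"
  then show "0 \<le> T (U f) x"
    by (intro markov_op_nonneg[OF T markov_op_bfun[OF U]] markov_op_nonneg[OF U, of f]) blast+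
next
  fix x assume x: "x \<in> space M"
  show "T (U (\<lambda>_. 1)) x = 1"
    using markov_op_cong[OF T markov_op_bfun[OF U bfun_const] bfun_const x, of 1 1]
      markov_op_one[OF U] markov_op_one[OF T x] by simp
qed

lemma markov_op_funpow:
  assumes "markov_op M T"
  shows "markov_op M (T ^^ n)"
proof (induction n)
  case 0
  show ?case using markov_op_id[of M] by (simp add: id_def)
next
  case (Suc n)
  show ?case using markov_op_comp[OF assms Suc] by (simp add: comp_def)
qed

lemma markov_op_convex:
  assumes T: "\<And>i. i \<in> I \<Longrightarrow> markov_op M (T i)"
    and "\<And>i. i \<in> I \<Longrightarrow> 0 \<le> c i" and "(\<Sum>i\<in>I. c i) = (1::real)"
  shows "markov_op M (\<lambda>f x. \<Sum>i\<in>I. c i * T i f x)"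
  unfolding markov_op_def
proof (intro conjI ballI allI impI)
  fix f assume "f \<in> bfun M"
  then show "(\<lambda>x. \<Sum>i\<in>I. c i * T i f x) \<in> bfun M"
    using markov_op_bfun[OF T] by (auto intro!: bfun_sum[of I "\<lambda>i x. c i * T i f x" M] bfun_cmult)
next
  fix f g a b x assume fg: "f \<in> bfun M" "g \<in> bfun M" "x \<in> space M"
  have "(\<Sum>i\<in>I. c i * T i (\<lambda>y. a * f y + b * g y) x) = (\<Sum>i\<in>I. a * (c i * T i f x) + b * (c i * T i g x))"
    by (intro sum.cong refl) (simp only: markov_op_lincomb[OF T fg], simp add: algebra_simps)
  then show "(\<Sum>i\<in>I. c i * T i (\<lambda>y. a * f y + b * g y) x) =
      a * (\<Sum>i\<in>I. c i * T i f x) + b * (\<Sum>i\<in>I. c i * T i g x)"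
    by (simp add: sum.distrib sum_distrib_left)
next
  fix f x assume "f \<in> bfun M" "\<forall>x\<in>space M. 0 \<le> f x" "x \<in> space M"
  then show "0 \<le> (\<Sum>i\<in>I. c i * T i f x)"
    using assms(2) markov_op_nonneg[OF T] by (auto intro!: sum_nonneg mult_nonneg_nonneg)
next
  fix x assume "x \<in> space M"
  then show "(\<Sum>i\<in>I. c i * T i (\<lambda>_. 1) x) = 1"
    using assms(3) by (simp add: markov_op_one[OF T] cong: sum.cong)
qed

text \<open>The integral formulas for the samplers agree with operators of genuine kernels only on
  \<open>bfun M\<close> and \<open>space M\<close>; this agreement is enough to inherit all four
  axioms.\<close>

lemma markov_op_eqI:
  assumes "markov_op M T" and eq: "\<And>f x. f \<in> bfun M \<Longrightarrow> x \<in> space M \<Longrightarrow> U f x = T f x"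
  shows "markov_op M U"
  unfolding markov_op_def
proof (intro conjI ballI allI impI)
  fix f assume f: "f \<in> bfun M"
  show "U f \<in> bfun M"
    by (rule bfun_cong[OF markov_op_bfun[OF assms(1) f] eq[OF f]])
next
  fix f g a b x assume fg: "f \<in> bfun M" "g \<in> bfun M" and x: "x \<in> space M"
  show "U (\<lambda>y. a * f y + b * g y) x = a * U f x + b * U g x"
    by (simp only: eq[OF _ x] fg bfun_lincomb markov_op_lincomb[OF assms(1) fg x])
next
  fix f x assume f: "f \<in> bfun M" "\<forall>x\<in>space M. 0 \<le> f x" and x: "x \<in> space M"
  show "0 \<le> U f x" using markov_op_nonneg[OF assms(1) f(1) _ x] f(2) eq[OF f(1) x] by simp
next
  fix x assume x: "x \<in> space M"
  show "U (\<lambda>_. 1) x = 1" by (simp only: eq[OF bfun_const x] markov_op_one[OF assms(1) x])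
qed

text \<open>The dependence of the integrand on x is moved into the measure: \<open>K x\<close> is
  pushed forward to the slice over x in the product space, where one fixed integrand serves for all
  x.\<close>

lemma integral_measurable_kernel:
  fixes h :: "'a \<Rightarrow> 'b \<Rightarrow> real"
  assumes h[measurable]: "(\<lambda>(x, y). h x y) \<in> borel_measurable (N \<Otimes>\<^sub>M M)"
    and K[measurable]: "K \<in> N \<rightarrow>\<^sub>M subprob_algebra M"
  shows "(\<lambda>x. \<integral>y. h x y \<partial>K x) \<in> borel_measurable N"
proof -
  note measurable_distr2[measurable]
  have "(\<lambda>x. integral\<^sup>L (distr (K x) (N \<Otimes>\<^sub>M M) (\<lambda>y. (x, y))) (\<lambda>(x, y). h x y)) \<in> borel_measurable N"
    by measurable
  then show ?thesis
    by (rule measurable_cong[THEN iffD1, rotated]) (simp add: integral_distr)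
qed

lemma kernel_op_bfun_param:
  assumes K: "K \<in> N \<rightarrow>\<^sub>M prob_algebra M" and h: "(\<lambda>(x, y). h x y) \<in> bfun (N \<Otimes>\<^sub>M M)"
  shows "(\<lambda>x. kernel_op K (h x) x) \<in> bfun N"
proof -
  from h obtain B where B: "(\<lambda>(x, y). h x y) \<in> borel_measurable (N \<Otimes>\<^sub>M M)"
    "\<And>x. x \<in> space (N \<Otimes>\<^sub>M M) \<Longrightarrow> \<bar>(\<lambda>(x, y). h x y) x\<bar> \<le> B"
    by (rule bfunE) blast
  have m: "(\<lambda>x. kernel_op K (h x) x) \<in> borel_measurable N"
    unfolding kernel_op_def
    by (rule integral_measurable_kernel[OF B(1) measurable_prob_algebraD[OF K]])
  have "\<bar>kernel_op K (h x) x\<bar> \<le> B" if x: "x \<in> space N" for x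
  proof -
    have sK: "sets (K x) = sets M" and "prob_space (K x)"
      using measurable_space[OF K x] by (auto simp: space_prob_algebra)
    interpret prob_space "K x" by fact
    have hm: "h x \<in> borel_measurable M" using measurable_Pair2[OF B(1) x] by simp
    have b: "\<bar>h x y\<bar> \<le> B" if "y \<in> space M" for y
      using B(2)[of "(x, y)"] x that by (simp add: space_pair_measure)
    have "\<bar>\<integral>y. h x y \<partial>K x\<bar> \<le> (\<integral>y. \<bar>h x y\<bar> \<partial>K x)" by (rule integral_abs_bound)
    also have "\<dots> \<le> B"
      using b hm sets_eq_imp_space_eq[OF sK] sK
      by (intro integral_le_const integrable_abs integrable_bfun[of "h x" M] AE_I2 finite_measure_axioms bfunI)
        auto
    finally show ?thesis by (simp add: kernel_op_def)
  qed
  with m show ?thesis by (auto intro!: bfunI)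
qed

lemma kernel_op_bfun:
  assumes K: "K \<in> N \<rightarrow>\<^sub>M prob_algebra M" and f: "f \<in> bfun M"
  shows "kernel_op K f \<in> bfun N"
proof -
  have "(\<lambda>(x::'a, y). f y) \<in> bfun (N \<Otimes>\<^sub>M M)"
    using f by (auto elim!: bfunE intro!: bfunI simp: space_pair_measure)
  from kernel_op_bfun_param[OF K this] show ?thesis by (simp add: eta_contract_eq)
qed

lemma markov_op_kernel_op:
  assumes K: "K \<in> M \<rightarrow>\<^sub>M prob_algebra M"
  shows "markov_op M (kernel_op K)"
  unfolding markov_op_def
proof (intro conjI ballI allI impI)
  fix f assume "f \<in> bfun M"
  then show "kernel_op K f \<in> bfun M" by (rule kernel_op_bfun[OF K])
next
  fix f g a b x assume fg: "f \<in> bfun M" "g \<in> bfun M" "x \<in> space M"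
  have sK: "sets (K x) = sets M" and "prob_space (K x)"
    using measurable_space[OF K fg(3)] by (auto simp: space_prob_algebra)
  interpret prob_space "K x" by fact
  show "kernel_op K (\<lambda>y. a * f y + b * g y) x = a * kernel_op K f x + b * kernel_op K g x"
    using integrable_bfun[OF fg(1) finite_measure_axioms sK] integrable_bfun[OF fg(2) finite_measure_axioms sK]
    by (simp add: kernel_op_def)
next
  fix f x assume "f \<in> bfun M" "\<forall>x\<in>space M. 0 \<le> f x" "x \<in> space M"
  moreover from this have "space (K x) = space M"
    using measurable_space[OF K] by (auto simp: space_prob_algebra dest!: sets_eq_imp_space_eq)
  ultimately show "0 \<le> kernel_op K f x" by (auto simp: kernel_op_def intro!: integral_nonneg_AE AE_I2)
next
  fix x assume "x \<in> space M"
  then have "prob_space (K x)" using measurable_space[OF K] by (auto simp: space_prob_algebra)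
  then show "kernel_op K (\<lambda>_. 1) x = 1" by (simp add: kernel_op_def prob_space.prob_space)
qed

lemma integral_bind_kernel:
  assumes N: "N \<in> space (prob_algebra M)" and K: "K \<in> M \<rightarrow>\<^sub>M prob_algebra L" and f: "f \<in> bfun L"
  shows "(\<integral>y. f y \<partial>(N \<bind> K)) = (\<integral>x. kernel_op K f x \<partial>N)"
proof -
  have sN: "sets N = sets M" and pN: "prob_space N" using N by (auto simp: space_prob_algebra)
  interpret prob_space N by fact
  obtain B where B: "f \<in> borel_measurable L" "\<And>x. x \<in> space L \<Longrightarrow> \<bar>f x\<bar> \<le> B"
    using f by (auto elim!: bfunE)
  show ?thesis unfolding kernel_op_def
  proof (rule integral_bind[where K=L and B'=1 and B=B])
    show "K \<in> measurable N (subprob_algebra L)"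
      using measurable_prob_algebraD[OF K] by (simp add: measurable_cong_sets[OF sN refl])
    show "AE x in N. emeasure (K x) (space (K x)) \<le> ennreal 1"
      using measurable_space[OF K] sets_eq_imp_space_eq[OF sN]
      by (auto intro!: AE_I2 simp: space_prob_algebra prob_space.emeasure_space_1)
  qed (use B finite_measure_axioms not_empty in auto)
qed

lemma measurable_kernel_pow:
  assumes "K \<in> M \<rightarrow>\<^sub>M prob_algebra M"
  shows "kernel_pow M K n \<in> M \<rightarrow>\<^sub>M prob_algebra M"
proof (induction n)
  case (Suc n)
  then show ?case using measurable_bind_prob_space[OF Suc assms] by simp
qed simp

text \<open>\<open>kernel_pow\<close> appends its last step, so the induction peels that step off as
  the innermost application to f and has to be general in f.\<close>

lemma integral_kernel_pow:
  assumes K: "K \<in> M \<rightarrow>\<^sub>M prob_algebra M" and f: "f \<in> bfun M" and x: "x \<in> space M"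
  shows "(\<integral>y. f y \<partial>kernel_pow M K n x) = (kernel_op K ^^ n) f x"
  using f
proof (induction n arbitrary: f)
  case 0
  then show ?case using x by (auto intro!: integral_return elim!: bfunE)
next
  case (Suc n)
  have "(\<integral>y. f y \<partial>kernel_pow M K (Suc n) x) = (\<integral>y. kernel_op K f y \<partial>kernel_pow M K n x)"
    using integral_bind_kernel[OF measurable_space[OF measurable_kernel_pow[OF K] x] K Suc.prems] by simp
  also have "\<dots> = (kernel_op K ^^ n) (kernel_op K f) x"
    by (rule Suc.IH[OF kernel_op_bfun[OF K Suc.prems]])
  finally show ?case by (simp only: funpow_Suc_right comp_def)
qed

section \<open>Total variation\<close>

lemma bdd_above_tv_dist:
  assumes "prob_space \<mu>" "prob_space \<nu>"
  shows "bdd_above ((\<lambda>A. \<bar>measure \<mu> A - measure \<nu> A\<bar>) ` sets \<mu>)"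
proof (rule bdd_aboveI2[where M=1])
  fix A
  show "\<bar>measure \<mu> A - measure \<nu> A\<bar> \<le> 1"
    using prob_space.prob_le_1[OF assms(1), of A] prob_space.prob_le_1[OF assms(2), of A]
      measure_nonneg[of \<mu> A] measure_nonneg[of \<nu> A]
    by linarith
qed

lemma measure_diff_le_tv_dist:
  assumes "prob_space \<mu>" "prob_space \<nu>" "A \<in> sets \<mu>"
  shows "\<bar>measure \<mu> A - measure \<nu> A\<bar> \<le> tv_dist \<mu> \<nu>"
  unfolding tv_dist_def by (rule cSUP_upper[OF assms(3) bdd_above_tv_dist[OF assms(1,2)]])

lemma tv_dist_le:
  assumes "\<And>A. A \<in> sets \<mu> \<Longrightarrow> \<bar>measure \<mu> A - measure \<nu> A\<bar> \<le> t"
  shows "tv_dist \<mu> \<nu> \<le> t"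
  unfolding tv_dist_def using assms by (intro cSUP_least) auto

lemma tv_dist_le_1: "prob_space \<mu> \<Longrightarrow> prob_space \<nu> \<Longrightarrow> tv_dist \<mu> \<nu> \<le> 1"
proof (rule tv_dist_le)
  fix A assume p: "prob_space \<mu>" "prob_space \<nu>"
  show "\<bar>measure \<mu> A - measure \<nu> A\<bar> \<le> 1"
    using prob_space.prob_le_1[OF p(1), of A] prob_space.prob_le_1[OF p(2), of A]
      measure_nonneg[of \<mu> A] measure_nonneg[of \<nu> A]
    by linarith
qed

lemma tv_dist_nonneg: "prob_space \<mu> \<Longrightarrow> prob_space \<nu> \<Longrightarrow> 0 \<le> tv_dist \<mu> \<nu>"
  using measure_diff_le_tv_dist[of \<mu> \<nu> "{}"] by simp

text \<open>The number of levels k in 1..n with k <= n t is the floor of n t; the bound t <= 1 keeps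
  that floor from exceeding n.\<close>

lemma floor_step_approx:
  fixes t :: real
  assumes "0 \<le> t" "t \<le> 1" "n > 0"
  shows "\<bar>t - (\<Sum>k=1..n. of_bool (real k \<le> real n * t)) / real n\<bar> \<le> 1 / real n"
proof -
  define m where "m = nat \<lfloor>real n * t\<rfloor>"
  have m: "real m \<le> real n * t" "real n * t < real m + 1"
    using assms by (auto simp: m_def of_nat_nat)
  have "real n * t \<le> real n" using assms by (simp add: mult_left_le)
  then have "m \<le> n" using m by linarith
  have "{1..n} \<inter> {k. real k \<le> real n * t} = {1..m}"
    using m \<open>m \<le> n\<close> by (auto simp: m_def le_nat_floor)
  then have "(\<Sum>k=1..n. of_bool (real k \<le> real n * t)) = real m"
    by (simp add: of_bool_def sum.If_cases)
  moreover have "\<bar>t - real m / real n\<bar> \<le> 1 / real n"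
  proof -
    have "t - real m / real n = (real n * t - real m) / real n" using assms by (simp add: field_simps)
    then show ?thesis using m assms by (simp add: divide_simps mult.commute[of t] abs_le_iff)
  qed
  ultimately show ?thesis by simp
qed

text \<open>The staircase \<open>n\<inverse> \<Sum>k\<le>n. 1{f \<ge> k/n}\<close> approximates \<open>f\<close> within \<open>1/n\<close>.\<close>

lemma integral_diff_le:
  assumes \<mu>: "prob_space \<mu>" and \<nu>: "prob_space \<nu>" and s: "sets \<mu> = sets M" "sets \<nu> = sets M"
    and f: "f \<in> ufun M"
    and le: "\<And>A. A \<in> sets M \<Longrightarrow> measure \<mu> A - measure \<nu> A \<le> t"
  shows "(\<integral>x. f x \<partial>\<mu>) - (\<integral>x. f x \<partial>\<nu>) \<le> t"
proof -
  have fm: "f \<in> borel_measurable M" and f01: "\<And>x. x \<in> space M \<Longrightarrow> 0 \<le> f x \<and> f x \<le> 1"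
    using f by (auto simp: ufun_def)
  have bound: "(\<integral>x. f x \<partial>\<mu>) - (\<integral>x. f x \<partial>\<nu>) \<le> t + 2 * inverse (real (Suc m))" for m
  proof -
    define n where "n = Suc m"
    define A where "A k = {x \<in> space M. real k \<le> real n * f x}" for k
    have A: "A k \<in> sets M" for k unfolding A_def using fm by measurable
    define g where "g x = (\<Sum>k=1..n. indicator (A k) x) / real n" for x
    have gb: "g \<in> bfun M"
      unfolding g_def divide_inverse
      using bfun_cmult[OF bfun_sum[of "{1..n}" "\<lambda>k. indicator (A k)" M], of "inverse (real n)"]
        ufun_indicator[OF A] by (auto simp: mult.commute intro: ufun_imp_bfun)
    have g: "\<bar>f x - g x\<bar> \<le> 1 / real n" if "x \<in> space M" for x
      using floor_step_approx[of "f x" n] f01[OF that] that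
      by (simp add: g_def A_def n_def indicator_def of_bool_def)
    have int: "\<bar>(\<integral>x. f x \<partial>N) - (\<Sum>k=1..n. measure N (A k)) / real n\<bar> \<le> 1 / real n"
      if "prob_space N" "sets N = sets M" for N
    proof -
      interpret prob_space N by fact
      have sp: "space N = space M" using that(2) by (rule sets_eq_imp_space_eq)
      have ig: "integrable N g" "integrable N f"
        using f by (intro integrable_bfun[of _ M] gb finite_measure_axioms that ufun_imp_bfun; simp)+
      have "(\<integral>x. g x \<partial>N) = (\<Sum>k=1..n. measure N (A k)) / real n"
        unfolding g_def using A that(2)
        by (subst integral_divide_zero, subst Bochner_Integration.integral_sum)
          (auto intro!: integrable_real_indicator simp: emeasure_eq_measure)
      moreover have "\<bar>(\<integral>x. f x - g x \<partial>N)\<bar> \<le> (\<integral>x. \<bar>f x - g x\<bar> \<partial>N)" by (rule integral_abs_bound)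
      moreover have "\<dots> \<le> 1 / real n"
        using ig g sp by (intro integral_le_const integrable_abs AE_I2) auto
      ultimately show ?thesis using ig by simp
    qed
    \<comment> \<open>Each of the n level sets contributes at most t and the staircase averages
      them, so a one-sided bound on sets passes to functions without a factor of two.\<close>
    have "(\<Sum>k=1..n. measure \<mu> (A k)) - (\<Sum>k=1..n. measure \<nu> (A k)) \<le> (\<Sum>k=1..n. t)"
      unfolding sum_subtractf[symmetric] by (intro sum_mono le A)
    then have "((\<Sum>k=1..n. measure \<mu> (A k)) - (\<Sum>k=1..n. measure \<nu> (A k))) / real n \<le> t"
      by (simp add: n_def field_simps)
    then show ?thesis
      using int[OF \<mu> s(1)] int[OF \<nu> s(2)] by (simp add: diff_divide_distrib n_def inverse_eq_divide)
  qed
  \<comment> \<open>The two approximation errors, one for each measure, vanish as the staircase is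
    refined.\<close>
  have "(\<lambda>m. t + 2 * inverse (real (Suc m))) \<longlonglongrightarrow> t + 2 * 0"
    by (intro tendsto_intros LIMSEQ_inverse_real_of_nat)
  then show ?thesis using bound by (intro LIMSEQ_le_const[where x=t]) auto
qed

lemma integral_diff_le_tv_dist:
  assumes \<mu>: "prob_space \<mu>" and \<nu>: "prob_space \<nu>" and s: "sets \<mu> = sets M" "sets \<nu> = sets M"
    and f: "f \<in> ufun M"
  shows "\<bar>(\<integral>x. f x \<partial>\<mu>) - (\<integral>x. f x \<partial>\<nu>)\<bar> \<le> tv_dist \<mu> \<nu>"
proof -
  have *: "\<bar>measure \<mu> A - measure \<nu> A\<bar> \<le> tv_dist \<mu> \<nu>" if "A \<in> sets M" for A
    using measure_diff_le_tv_dist[OF \<mu> \<nu>] that s by auto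
  have "(\<integral>x. f x \<partial>\<mu>) - (\<integral>x. f x \<partial>\<nu>) \<le> tv_dist \<mu> \<nu>" "(\<integral>x. f x \<partial>\<nu>) - (\<integral>x. f x \<partial>\<mu>) \<le> tv_dist \<mu> \<nu>"
    using * by (intro integral_diff_le[OF \<mu> \<nu> s f] integral_diff_le[OF \<nu> \<mu> s(2,1) f]; force simp: abs_le_iff)+
  then show ?thesis by linarith
qed

section \<open>Contraction of the oscillation\<close>

lemma osc_contractionD:
  "osc_contraction M T \<delta> \<Longrightarrow> f \<in> ufun M \<Longrightarrow> x \<in> space M \<Longrightarrow> y \<in> space M \<Longrightarrow> T f x - T f y \<le> \<delta>"
  by (auto simp: osc_contraction_def)

lemma osc_contraction_weaken: "osc_contraction M T \<delta> \<Longrightarrow> \<delta> \<le> \<delta>' \<Longrightarrow> osc_contraction M T \<delta>'"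
  by (force simp: osc_contraction_def)

lemma osc_contraction_comp:
  assumes "osc_contraction M T \<delta>" "markov_op M U"
  shows "osc_contraction M (\<lambda>f. T (U f)) \<delta>"
  using assms markov_op_ufun[OF assms(2)] by (auto simp: osc_contraction_def)

text \<open>The additional iterations are applied to f first and keep it in \<open>ufun M\<close>.
  This allows one common number of iterations for all coordinates.\<close>

lemma osc_contraction_funpow_mono:
  assumes "osc_contraction M (T ^^ m) \<delta>" "markov_op M T" "m \<le> n"
  shows "osc_contraction M (T ^^ n) \<delta>"
proof -
  have "T ^^ n = (\<lambda>f. (T ^^ m) ((T ^^ (n - m)) f))"
    using funpow_add[of m "n - m" T] assms(3) by (simp add: comp_def)
  then show ?thesis
    using osc_contraction_comp[OF assms(1) markov_op_funpow[OF assms(2)]] by simp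
qed

text \<open>A function of oscillation at most \<open>\<delta>\<close> is a translate of \<open>\<delta>\<close> times a function in \<^term>\<open>ufun M\<close>,
  so the contraction can be applied repeatedly.\<close>

lemma osc_contraction_funpow:
  assumes T: "markov_op M T" and c: "osc_contraction M T \<delta>" and \<delta>: "0 < \<delta>"
  shows "osc_contraction M (T ^^ n) (\<delta> ^ n)"
proof (induction n)
  case 0
  show ?case unfolding osc_contraction_def
  proof (intro ballI)
    fix f x y assume "f \<in> ufun M" "x \<in> space M" "y \<in> space M"
    then have "f x \<le> 1" "0 \<le> f y" by (auto simp: ufun_def)
    then show "(T ^^ 0) f x - (T ^^ 0) f y \<le> \<delta> ^ 0" by simp
  qed
next
  case (Suc n)
  show ?case unfolding osc_contraction_def
  proof (intro ballI)
    fix f x y assume f: "f \<in> ufun M" and x: "x \<in> space M" and y: "y \<in> space M"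
    have Tn: "markov_op M (T ^^ n)" by (rule markov_op_funpow[OF T])
    have Tf: "T f \<in> ufun M" by (rule markov_op_ufun[OF T f])
    define l where "l = (INF z\<in>space M. T f z)"
    have bdd: "bdd_below (T f ` space M)" using Tf by (auto simp: ufun_def intro!: bdd_belowI2[where m=0])
    have lo: "l \<le> T f z" if "z \<in> space M" for z
      unfolding l_def by (rule cINF_lower[OF bdd that])
    have hi: "T f z \<le> l + \<delta>" if z: "z \<in> space M" for z
    proof -
      have "T f z - \<delta> \<le> l" unfolding l_def
        using osc_contractionD[OF c f z] x by (intro cINF_greatest) (auto simp: algebra_simps)
      then show ?thesis by simp
    qed
    \<comment> \<open>The division explains the assumption that \<delta> is positive; a coefficient
      that could vanish has to be enlarged beforehand.\<close>
    define h where "h z = (T f z - l) / \<delta>" for z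
    have h: "h \<in> ufun M"
    proof -
      have "h \<in> borel_measurable M" unfolding h_def using Tf by (auto simp: ufun_def)
      moreover have "0 \<le> h z \<and> h z \<le> 1" if "z \<in> space M" for z
        using lo[OF that] hi[OF that] \<delta> by (simp add: h_def divide_simps)
      ultimately show ?thesis by (simp add: ufun_def)
    qed
    have "T f = (\<lambda>z. \<delta> * h z + l)" using \<delta> by (auto simp: h_def)
    then have eq: "(T ^^ Suc n) f z = \<delta> * (T ^^ n) h z + l" if "z \<in> space M" for z
      using markov_op_affine[OF Tn ufun_imp_bfun[OF h] that, of \<delta> l]
      by (simp only: funpow_Suc_right comp_def)
    have "(T ^^ Suc n) f x - (T ^^ Suc n) f y = \<delta> * ((T ^^ n) h x - (T ^^ n) h y)"
      by (simp only: eq[OF x] eq[OF y]) (simp add: algebra_simps)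
    also have "\<dots> \<le> \<delta> * \<delta> ^ n"
      using osc_contractionD[OF Suc.IH h x y] \<delta> by (intro mult_left_mono) auto
    finally show "(T ^^ Suc n) f x - (T ^^ Suc n) f y \<le> \<delta> ^ Suc n" by simp
  qed
qed

text \<open>The values of T f differ by at most \<delta>, and by invariance their mean is that of f;
  hence each single value is within \<delta> of that mean.\<close>

lemma osc_contraction_invariant:
  assumes \<mu>: "prob_space \<mu>" and s: "sets \<mu> = sets M" and T: "markov_op M T"
    and inv: "\<And>f. f \<in> ufun M \<Longrightarrow> (\<integral>x. T f x \<partial>\<mu>) = (\<integral>x. f x \<partial>\<mu>)"
    and c: "osc_contraction M T \<delta>" and f: "f \<in> ufun M" and x: "x \<in> space M"
  shows "\<bar>T f x - (\<integral>x. f x \<partial>\<mu>)\<bar> \<le> \<delta>"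
proof -
  interpret prob_space \<mu> by fact
  have sp: "space \<mu> = space M" by (rule sets_eq_imp_space_eq[OF s])
  have i: "integrable \<mu> (T f)"
    by (rule integrable_bfun[OF ufun_imp_bfun[OF markov_op_ufun[OF T f]] finite_measure_axioms s])
  have "T f x - \<delta> \<le> (\<integral>y. T f y \<partial>\<mu>)"
    using osc_contractionD[OF c f x] sp
    by (intro integral_ge_const i AE_I2) (auto simp: algebra_simps)
  moreover have "(\<integral>y. T f y \<partial>\<mu>) \<le> T f x + \<delta>"
    using osc_contractionD[OF c f _ x] sp
    by (intro integral_le_const i AE_I2) (auto simp: algebra_simps)
  ultimately show ?thesis using inv[OF f] by simp
qed

text \<open>The remainder T - c K is positive with total mass 1 - c, so it adds at most 1 - c to the
  oscillation. The bound for it comes from applying the hypothesis to f at one point and to 1 - f at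
  the other.\<close>

lemma osc_contraction_minorized:
  assumes T: "markov_op M T" and K: "markov_op M K" and c: "osc_contraction M K \<delta>" "0 \<le> c"
    and le: "\<And>f x. f \<in> ufun M \<Longrightarrow> x \<in> space M \<Longrightarrow> c * K f x \<le> T f x"
  shows "osc_contraction M T (1 - c + c * \<delta>)"
  unfolding osc_contraction_def
proof (intro ballI)
  fix f x y assume f: "f \<in> ufun M" and x: "x \<in> space M" and y: "y \<in> space M"
  have "c * K (\<lambda>z. -1 * f z + 1) x \<le> T (\<lambda>z. -1 * f z + 1) x"
    using le[OF ufun_one_minus[OF f] x] by simp
  then have "c * (1 - K f x) \<le> 1 - T f x"
    unfolding markov_op_affine[OF K ufun_imp_bfun[OF f] x] markov_op_affine[OF T ufun_imp_bfun[OF f] x]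
    by simp
  moreover have "c * K f y \<le> T f y" by (rule le[OF f y])
  moreover have "c * (K f x - K f y) \<le> c * \<delta>"
    using osc_contractionD[OF c(1) f x y] c(2) by (rule mult_left_mono)
  ultimately show "T f x - T f y \<le> 1 - c + c * \<delta>" by (simp add: algebra_simps)
qed

lemma osc_contraction_close:
  assumes c: "osc_contraction M T \<delta>"
    and le: "\<And>f x. f \<in> ufun M \<Longrightarrow> x \<in> space M \<Longrightarrow> \<bar>U f x - T f x\<bar> \<le> \<eta>"
  shows "osc_contraction M U (\<delta> + 2 * \<eta>)"
  unfolding osc_contraction_def
proof (intro ballI)
  fix f x y assume f: "f \<in> ufun M" and x: "x \<in> space M" and y: "y \<in> space M"
  show "U f x - U f y \<le> \<delta> + 2 * \<eta>"
    using osc_contractionD[OF c f x y] le[OF f x] le[OF f y] by linarith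
qed

text \<open>In the induction the inner n steps are compared first, through monotonicity of K; the
  one-step bound is then applied to \<open>(T ^^ n) f\<close>, which is again in
  \<open>ufun M\<close>.\<close>

lemma markov_op_funpow_minorized:
  assumes T: "markov_op M T" and K: "markov_op M K" and c: "0 \<le> c"
    and le: "\<And>f x. f \<in> ufun M \<Longrightarrow> x \<in> space M \<Longrightarrow> c * K f x \<le> T f x"
    and f: "f \<in> ufun M" and x: "x \<in> space M"
  shows "c ^ n * (K ^^ n) f x \<le> (T ^^ n) f x"
  using x
proof (induction n arbitrary: x)
  case (Suc n)
  have Tn: "(T ^^ n) f \<in> ufun M" and Kn: "(K ^^ n) f \<in> bfun M"
    by (intro markov_op_ufun[OF markov_op_funpow[OF T]] f
        ufun_imp_bfun markov_op_ufun[OF markov_op_funpow[OF K]])+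
  have "c ^ Suc n * (K ^^ Suc n) f x = c * (c ^ n * K ((K ^^ n) f) x)" by simp
  also have "c ^ n * K ((K ^^ n) f) x = K (\<lambda>y. c ^ n * (K ^^ n) f y) x"
    using markov_op_affine[OF K Kn Suc.prems, of "c ^ n" 0] by simp
  also have "c * \<dots> \<le> c * K ((T ^^ n) f) x"
    using Suc.IH Kn Tn c Suc.prems
    by (intro mult_left_mono markov_op_mono[OF K]) (auto intro: bfun_cmult ufun_imp_bfun)
  also have "\<dots> \<le> T ((T ^^ n) f) x" by (rule le[OF Tn Suc.prems])
  finally show ?case by simp
qed simp

text \<open>Telescoping: exchanging the outermost step costs at most \<eta>, and T does not enlarge
  the error accumulated inside it.\<close>

lemma markov_op_funpow_close:
  assumes T: "markov_op M T" and U: "markov_op M U"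
    and le: "\<And>f x. f \<in> ufun M \<Longrightarrow> x \<in> space M \<Longrightarrow> \<bar>U f x - T f x\<bar> \<le> \<eta>"
    and f: "f \<in> ufun M" and x: "x \<in> space M"
  shows "\<bar>(U ^^ n) f x - (T ^^ n) f x\<bar> \<le> real n * \<eta>"
  using x
proof (induction n arbitrary: x)
  case (Suc n)
  have Tn: "(T ^^ n) f \<in> ufun M" and Un: "(U ^^ n) f \<in> ufun M"
    by (intro markov_op_ufun[OF markov_op_funpow[OF T]] f markov_op_ufun[OF markov_op_funpow[OF U]])+
  have "\<bar>U ((U ^^ n) f) x - T ((U ^^ n) f) x\<bar> \<le> \<eta>" by (rule le[OF Un Suc.prems])
  moreover have "\<bar>T ((U ^^ n) f) x - T ((T ^^ n) f) x\<bar> \<le> real n * \<eta>"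
    by (rule markov_op_abs_le[OF T ufun_imp_bfun[OF Un] ufun_imp_bfun[OF Tn] Suc.prems Suc.IH])
  ultimately show ?case by (simp add: algebra_simps)
qed simp

text \<open>Here T is a frozen sampler, \<open>P i\<close> the Metropolis update of coordinate i,
  \<open>G i\<close> the Gibbs update, and c the weights of the ergodic Gibbs sampler. These weights
  may differ from the selection probabilities of T: the lower bound by \<epsilon> holds for every
  coordinate, so any convex combination may be formed.\<close>

lemma osc_contraction_random_scan:
  fixes T :: "('a \<Rightarrow> real) \<Rightarrow> 'a \<Rightarrow> real" and c :: "'i::finite \<Rightarrow> real"
  assumes T: "markov_op M T" and P: "\<And>i. markov_op M (P i)" and G: "\<And>i. markov_op M (G i)"
    and c: "\<And>i. 0 \<le> c i" "(\<Sum>i\<in>UNIV. c i) = 1" and \<epsilon>: "0 < \<epsilon>"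
    and le: "\<And>i f x. f \<in> ufun M \<Longrightarrow> x \<in> space M \<Longrightarrow> \<epsilon> * P i f x \<le> T f x"
    and close: "\<And>i f x. f \<in> ufun M \<Longrightarrow> x \<in> space M \<Longrightarrow> \<bar>(P i ^^ k) f x - G i f x\<bar> \<le> \<eta>"
    and osc: "osc_contraction M ((\<lambda>f x. \<Sum>i\<in>UNIV. c i * G i f x) ^^ n) (1 / 4)"
    and \<eta>: "real n * \<eta> \<le> 1 / 8"
  shows "osc_contraction M (T ^^ (n * k)) (1 - \<epsilon> ^ (n * k) / 2)"
proof -
  define K where "K = (\<lambda>f x. \<Sum>i\<in>UNIV. c i * (P i ^^ k) f x)"
  define B where "B = (\<lambda>f x. \<Sum>i\<in>UNIV. c i * G i f x)"
  have K: "markov_op M K" unfolding K_def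
    by (intro markov_op_convex c markov_op_funpow P)
  have B: "markov_op M B" unfolding B_def
    by (intro markov_op_convex c G)
  have KB: "\<bar>K f x - B f x\<bar> \<le> \<eta>" if "f \<in> ufun M" "x \<in> space M" for f x
  proof -
    have "\<bar>K f x - B f x\<bar> = \<bar>\<Sum>i\<in>UNIV. c i * ((P i ^^ k) f x - G i f x)\<bar>"
      by (simp add: K_def B_def sum_subtractf algebra_simps)
    also have "\<dots> \<le> (\<Sum>i\<in>UNIV. c i * \<eta>)"
    proof (rule order_trans[OF sum_abs sum_mono])
      fix i
      show "\<bar>c i * ((P i ^^ k) f x - G i f x)\<bar> \<le> c i * \<eta>"
        using close[OF that, of i] c(1)[of i] by (simp add: abs_mult mult_left_mono)
    qed
    also have "\<dots> = \<eta>" by (simp add: sum_distrib_right[symmetric] c(2))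
    finally show ?thesis .
  qed
  \<comment> \<open>An error of at most 1/8 at each of the two compared points raises 1/4 to at most
    1/2.\<close>
  have "osc_contraction M (K ^^ n) (1 / 4 + 2 * (real n * \<eta>))"
    using markov_op_funpow_close[OF B K KB]
    by (intro osc_contraction_close[OF osc[folded B_def]])
  then have osc_K: "osc_contraction M (K ^^ n) (1 / 2)"
    by (rule osc_contraction_weaken) (use \<eta> in linarith)
  have TK: "\<epsilon> ^ k * K f x \<le> (T ^^ k) f x" if "f \<in> ufun M" "x \<in> space M" for f x
  proof -
    have "\<epsilon> ^ k * K f x = (\<Sum>i\<in>UNIV. c i * (\<epsilon> ^ k * (P i ^^ k) f x))"
      by (simp add: K_def sum_distrib_left algebra_simps)
    \<comment> \<open>For each i the event that coordinate i is picked k times in a row already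
      gives this bound; averaging over c leaves the right-hand side unchanged because the weights
      sum to one.\<close>
    also have "\<dots> \<le> (\<Sum>i\<in>UNIV. c i * (T ^^ k) f x)"
      using \<epsilon> c(1) by (intro sum_mono mult_left_mono markov_op_funpow_minorized[OF T P _ le] that) auto
    also have "\<dots> = (T ^^ k) f x" by (simp add: sum_distrib_right[symmetric] c(2))
    finally show ?thesis .
  qed
  have Tk: "markov_op M (T ^^ k)" by (rule markov_op_funpow[OF T])
  have pw: "T ^^ (n * k) = (T ^^ k) ^^ n" "\<epsilon> ^ (n * k) = (\<epsilon> ^ k) ^ n"
    by (simp_all add: funpow_mult power_mult[symmetric] mult.commute)
  have "osc_contraction M (T ^^ (n * k)) (1 - \<epsilon> ^ (n * k) + \<epsilon> ^ (n * k) * (1 / 2))"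
    unfolding pw using \<epsilon>
    by (intro osc_contraction_minorized[OF markov_op_funpow[OF Tk] markov_op_funpow[OF K] osc_K]
        markov_op_funpow_minorized[OF Tk K _ TK]) auto
  then show ?thesis by simp
qed

text \<open>Minorization is used for A at y and for the complement of A at x. The two masses of
  \<nu> add up to one, so \<nu> disappears and the coefficient depends on s alone.\<close>

lemma osc_contraction_kernel_minorized:
  assumes K: "K \<in> M \<rightarrow>\<^sub>M prob_algebra M"
    and \<nu>: "prob_space \<nu>" "sets \<nu> = sets M"
    and le: "\<And>x A. x \<in> space M \<Longrightarrow> A \<in> sets M \<Longrightarrow> s * measure \<nu> A \<le> measure (kernel_pow M K m x) A"
  shows "osc_contraction M (kernel_op K ^^ m) (1 - s)"
  unfolding osc_contraction_def
proof (intro ballI)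
  fix f x y assume f: "f \<in> ufun M" and x: "x \<in> space M" and y: "y \<in> space M"
  let ?N = "kernel_pow M K m"
  have N: "prob_space (?N z)" "sets (?N z) = sets M" if "z \<in> space M" for z
    using measurable_space[OF measurable_kernel_pow[OF K] that] by (auto simp: space_prob_algebra)
  have "(\<integral>z. f z \<partial>?N x) - (\<integral>z. f z \<partial>?N y) \<le> 1 - s"
  proof (rule integral_diff_le[OF N(1)[OF x] N(1)[OF y] N(2)[OF x] N(2)[OF y] f])
    fix A assume A: "A \<in> sets M"
    have sp: "space (?N x) = space M" "space \<nu> = space M"
      using N(2)[OF x] \<nu> by (auto dest: sets_eq_imp_space_eq)
    have "measure (?N x) (space M - A) = 1 - measure (?N x) A"
      using prob_space.prob_compl[OF N(1)[OF x], of A] A N(2)[OF x] sp by simp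
    moreover have "measure \<nu> (space M - A) = 1 - measure \<nu> A"
      using prob_space.prob_compl[OF \<nu>(1), of A] A \<nu>(2) sp by simp
    ultimately show "measure (?N x) A - measure (?N y) A \<le> 1 - s"
      using le[OF x, of "space M - A"] le[OF y A] A by (simp add: right_diff_distrib)
  qed
  then show "(kernel_op K ^^ m) f x - (kernel_op K ^^ m) f y \<le> 1 - s"
    by (simp add: integral_kernel_pow[OF K ufun_imp_bfun[OF f]] x y)
qed

text \<open>All iterates started anywhere are within C \<rho>^n of the mean under \<mu>. Two
  starting points give twice this error, hence the target \<delta> / 2; invariance follows by
  passing to the limit.\<close>

lemma
  assumes K: "K \<in> M \<rightarrow>\<^sub>M prob_algebra M" and \<mu>: "prob_space \<mu>" "sets \<mu> = sets M"
    and erg: "uniformly_ergodic M K \<mu>"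
  shows uniformly_ergodic_osc_contraction: "0 < \<delta> \<Longrightarrow> \<exists>n. osc_contraction M (kernel_op K ^^ n) \<delta>"
    and uniformly_ergodic_invariant: "f \<in> ufun M \<Longrightarrow> (\<integral>x. kernel_op K f x \<partial>\<mu>) = (\<integral>x. f x \<partial>\<mu>)"
proof -
  obtain C \<rho> where \<rho>: "0 \<le> \<rho>" "\<rho> < 1"
    and tv: "\<And>x n. x \<in> space M \<Longrightarrow> tv_dist (kernel_pow M K n x) \<mu> \<le> C * \<rho> ^ n"
    using erg unfolding uniformly_ergodic_def by blast
  have N: "prob_space (kernel_pow M K n x)" "sets (kernel_pow M K n x) = sets M"
    if "x \<in> space M" for x n
    using measurable_space[OF measurable_kernel_pow[OF K] that] by (auto simp: space_prob_algebra)
  have close: "\<bar>(kernel_op K ^^ n) f x - (\<integral>x. f x \<partial>\<mu>)\<bar> \<le> C * \<rho> ^ n"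
    if "f \<in> ufun M" "x \<in> space M" for f x n
    using integral_diff_le_tv_dist[OF N(1)[OF that(2)] \<mu>(1) N(2)[OF that(2)] \<mu>(2) that(1)]
      tv[OF that(2)] integral_kernel_pow[OF K ufun_imp_bfun[OF that(1)] that(2)]
    by (metis order_trans)
  have lim: "(\<lambda>n. C * \<rho> ^ n) \<longlonglongrightarrow> 0"
    using \<rho> by (intro tendsto_mult_right_zero LIMSEQ_power_zero) auto
  show "\<exists>n. osc_contraction M (kernel_op K ^^ n) \<delta>" if "0 < \<delta>"
  proof -
    have "0 < \<delta> / 2" using that by simp
    from order_tendstoD(2)[OF lim this] obtain n where n: "C * \<rho> ^ n < \<delta> / 2"
      by (auto simp: eventually_sequentially)
    have "(kernel_op K ^^ n) f x - (kernel_op K ^^ n) f y \<le> \<delta>"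
      if "f \<in> ufun M" "x \<in> space M" "y \<in> space M" for f x y
      using close[OF that(1,2), of n] close[OF that(1,3), of n] n by linarith
    then show ?thesis by (auto simp: osc_contraction_def)
  qed
  show "(\<integral>x. kernel_op K f x \<partial>\<mu>) = (\<integral>x. f x \<partial>\<mu>)" if f: "f \<in> ufun M"
  proof -
    obtain x where "x \<in> space \<mu>" using prob_space.not_empty[OF \<mu>(1)] by auto
    then have x: "x \<in> space M" using sets_eq_imp_space_eq[OF \<mu>(2)] by simp
    have lim_f: "(\<lambda>n. (kernel_op K ^^ n) f x) \<longlonglongrightarrow> (\<integral>x. f x \<partial>\<mu>)" if "f \<in> ufun M" for f
      using close[OF that x] by (intro LIM_zero_cancel[OF Lim_null_comparison[OF _ lim]]) auto
    have Kf: "kernel_op K f \<in> ufun M" by (rule markov_op_ufun[OF markov_op_kernel_op[OF K] f])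
    \<comment> \<open>The same sequence is read in two ways: as iterates applied to K f, and as a
      shifted sequence of iterates applied to f. Uniqueness of limits equates the two means.\<close>
    have "(\<lambda>n. (kernel_op K ^^ Suc n) f x) \<longlonglongrightarrow> (\<integral>x. kernel_op K f x \<partial>\<mu>)"
      using lim_f[OF Kf] by (simp only: funpow_Suc_right comp_def)
    moreover have "(\<lambda>n. (kernel_op K ^^ Suc n) f x) \<longlonglongrightarrow> (\<integral>x. f x \<partial>\<mu>)"
      using lim_f[OF f] by (rule LIMSEQ_Suc)
    ultimately show ?thesis by (rule LIMSEQ_unique)
  qed
qed

section \<open>The Metropolis-within-Gibbs operators\<close>

text \<open>Serves the two discrete randomizations, the choice of a coordinate and the acceptance
  decision: over a countable second factor it suffices to check sections.\<close>

lemma measurable_pair_count_space2: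
  assumes "countable A"
    and [measurable]: "\<And>y. y \<in> A \<Longrightarrow> (\<lambda>x. f (x, y)) \<in> M \<rightarrow>\<^sub>M L"
  shows "f \<in> M \<Otimes>\<^sub>M count_space A \<rightarrow>\<^sub>M L"
  using _ _ assms(1)
  by (rule measurable_compose_countable'[where f="\<lambda>a b. f (fst b, a)" and g=snd and I=A, simplified])
    simp_all

lemma measurable_bernoulli_pmf:
  "(\<lambda>r. measure_pmf (bernoulli_pmf r)) \<in> borel \<rightarrow>\<^sub>M prob_algebra (count_space UNIV)"
proof (rule measurable_prob_algebraI)
  show "(\<lambda>r. measure_pmf (bernoulli_pmf r)) \<in> borel \<rightarrow>\<^sub>M subprob_algebra (count_space UNIV)"
  proof (rule measurable_subprob_algebra)
    fix A :: "bool set"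
    \<comment> \<open>For parameters outside [0,1] \<open>bernoulli_pmf\<close> truncates to that
      interval, so a formula on the whole real line has to contain the truncation.\<close>
    have "emeasure (measure_pmf (bernoulli_pmf r)) A =
        ennreal (\<Sum>b\<in>A. if b then min 1 (max 0 r) else 1 - min 1 (max 0 r))" for r
      by (simp add: emeasure_measure_pmf_finite bernoulli_pmf.rep_eq if_distrib[of ennreal]
          if_distrib[of "\<lambda>f. f _"] flip: sum_ennreal cong: if_cong)
    moreover have "(\<lambda>r. ennreal (\<Sum>b\<in>A. if b then min 1 (max 0 r) else 1 - min 1 (max 0 r))) \<in> borel_measurable borel"
      by (intro measurable_compose[OF _ measurable_ennreal] borel_measurable_sum) (auto split: if_splits)
    ultimately show "(\<lambda>r. emeasure (measure_pmf (bernoulli_pmf r)) A) \<in> borel_measurable borel"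
      by simp
  qed (auto simp: prob_space_imp_subprob_space measure_pmf.prob_space_axioms)
qed (auto simp: measure_pmf.prob_space_axioms)

lemma measurable_distr_fun_upd:
  fixes S :: "'d::finite \<Rightarrow> 'a measure"
  assumes V: "V \<in> N \<rightarrow>\<^sub>M prob_algebra (S i)" and X: "X \<in> N \<rightarrow>\<^sub>M state_space S"
  shows "(\<lambda>w. distr (V w) (state_space S) (\<lambda>y. (X w)(i := y))) \<in> N \<rightarrow>\<^sub>M prob_algebra (state_space S)"
proof (rule measurable_prob_algebraI)
  have upd: "(\<lambda>(x, y). x(i := y)) \<in> state_space S \<Otimes>\<^sub>M S i \<rightarrow>\<^sub>M state_space S"
    using measurable_add_dim[of i UNIV S] by simp
  have Xu: "(\<lambda>(w, y). (X w)(i := y)) \<in> N \<Otimes>\<^sub>M S i \<rightarrow>\<^sub>M state_space S"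
    using measurable_compose[OF measurable_Pair[OF measurable_compose[OF measurable_fst X] measurable_snd] upd]
    by (simp add: case_prod_beta)
  then show "(\<lambda>w. distr (V w) (state_space S) (\<lambda>y. (X w)(i := y))) \<in> N \<rightarrow>\<^sub>M subprob_algebra (state_space S)"
    by (intro measurable_distr2[OF _ measurable_prob_algebraD[OF V]])
  fix w assume w: "w \<in> space N"
  have "prob_space (V w)" "sets (V w) = sets (S i)"
    using measurable_space[OF V w] by (auto simp: space_prob_algebra)
  then show "prob_space (distr (V w) (state_space S) (\<lambda>y. (X w)(i := y)))"
    using measurable_Pair2[OF Xu w]
    by (auto intro!: prob_space.prob_space_distr simp: measurable_cong_sets[OF \<open>sets (V w) = sets (S i)\<close> refl])
qed

text \<open>The condition on J covers both uses: x a full state (J = UNIV), or x a state with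
  coordinate i removed.\<close>

lemma ufun_fun_upd:
  fixes S :: "'d::finite \<Rightarrow> 'a measure"
  assumes f: "f \<in> ufun (state_space S)" and x: "x \<in> space (PiM J S)" and J: "insert i J = UNIV"
  shows "(\<lambda>y. f (x(i := y))) \<in> ufun (S i)"
proof -
  have "(\<lambda>(x, y). x(i := y)) \<in> PiM J S \<Otimes>\<^sub>M S i \<rightarrow>\<^sub>M state_space S"
    using measurable_add_dim[of i J S] by (simp add: J)
  from measurable_Pair2[OF this x] have u: "(\<lambda>y. x(i := y)) \<in> S i \<rightarrow>\<^sub>M state_space S" by simp
  then show ?thesis
    using f measurable_space[OF u] measurable_compose[OF u, of f borel] unfolding ufun_def by blast
qed

lemma bfun_fun_upd:
  fixes S :: "'d::finite \<Rightarrow> 'a measure"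
  assumes f: "f \<in> bfun (state_space S)" and J: "insert i J = UNIV"
  shows "(\<lambda>(x, y). f (x(i := y))) \<in> bfun (PiM J S \<Otimes>\<^sub>M S i)"
proof -
  have upd: "(\<lambda>(x, y). x(i := y)) \<in> PiM J S \<Otimes>\<^sub>M S i \<rightarrow>\<^sub>M state_space S"
    using measurable_add_dim[of i J S] by (simp add: J)
  obtain B where B: "f \<in> borel_measurable (state_space S)" "\<And>x. x \<in> space (state_space S) \<Longrightarrow> \<bar>f x\<bar> \<le> B"
    using f by (rule bfunE) blast
  have "(\<lambda>w. f ((\<lambda>(x, y). x(i := y)) w)) \<in> bfun (PiM J S \<Otimes>\<^sub>M S i)"
    by (rule bfunI[OF measurable_compose[OF upd B(1)], where B=B])
      (rule B(2)[OF measurable_space[OF upd]])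
  then show ?thesis by (simp add: case_prod_unfold)
qed

lemma pmf_embed_simplex:
  fixes a :: "real ^ 'd::finite"
  assumes "a \<in> prob_simplex"
  shows "pmf (embed_pmf (\<lambda>i. a $ i)) i = a $ i"
proof (rule pmf_embed_pmf)
  show "\<And>i. 0 \<le> a $ i" using assms by (simp add: prob_simplex_def)
  then have "(\<Sum>i\<in>UNIV. ennreal (a $ i)) = ennreal (\<Sum>i\<in>UNIV. a $ i)"
    by (intro sum_ennreal) auto
  then show "(\<integral>\<^sup>+ i. ennreal (a $ i) \<partial>count_space UNIV) = 1"
    using assms by (simp add: nn_integral_count_space_finite prob_simplex_def)
qed

lemma measurable_random_scan:
  fixes S :: "'d::finite \<Rightarrow> 'a measure"
  assumes U: "\<And>i. U i \<in> state_space S \<rightarrow>\<^sub>M prob_algebra (S i)"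
  shows "random_scan S U a \<in> state_space S \<rightarrow>\<^sub>M prob_algebra (state_space S)"
proof -
  have *: "(\<lambda>(x, i). distr (U i x) (state_space S) (\<lambda>y. x(i := y)))
      \<in> state_space S \<Otimes>\<^sub>M count_space UNIV \<rightarrow>\<^sub>M prob_algebra (state_space S)"
    using measurable_distr_fun_upd[OF U measurable_ident]
    by (intro measurable_pair_count_space2) (auto simp: id_def)
  show ?thesis unfolding random_scan_def
    by (rule measurable_bind_prob_space2[OF _ *])
      (auto simp: space_prob_algebra measure_pmf.prob_space_axioms)
qed

lemma kernel_op_random_scan:
  fixes S :: "'d::finite \<Rightarrow> 'a measure"
  assumes a: "a \<in> prob_simplex" and U: "\<And>i. U i x \<in> space (prob_algebra (S i))"
    and x: "x \<in> space (state_space S)" and f: "f \<in> bfun (state_space S)"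
  shows "kernel_op (random_scan S U a) f x = (\<Sum>i\<in>UNIV. a $ i * (\<integral>y. f (x(i := y)) \<partial>U i x))"
proof -
  have c: "(\<lambda>y. x(i := y)) \<in> S i \<rightarrow>\<^sub>M state_space S" for i
    using measurable_Pair2[OF measurable_add_dim[of i UNIV S, simplified] x] by simp
  have s: "prob_space (U i x)" "sets (U i x) = sets (S i)" for i
    using U[of i] by (auto simp: space_prob_algebra)
  have K: "(\<lambda>i. distr (U i x) (state_space S) (\<lambda>y. x(i := y))) \<in> count_space UNIV \<rightarrow>\<^sub>M prob_algebra (state_space S)"
    using c s(1) by (auto simp: space_prob_algebra measurable_cong_sets[OF s(2) refl] intro!: prob_space.prob_space_distr)
  have "kernel_op (random_scan S U a) f x =
      (\<integral>i. kernel_op (\<lambda>i. distr (U i x) (state_space S) (\<lambda>y. x(i := y))) f i \<partial>measure_pmf (embed_pmf (\<lambda>i. a $ i)))"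
    unfolding kernel_op_def[of "random_scan S U a"] random_scan_def
    by (rule integral_bind_kernel[OF _ K f])
      (auto simp: space_prob_algebra measure_pmf.prob_space_axioms)
  also have "\<dots> = (\<Sum>i\<in>UNIV. kernel_op (\<lambda>i. distr (U i x) (state_space S) (\<lambda>y. x(i := y))) f i * a $ i)"
    by (subst integral_measure_pmf_real[where A=UNIV]) (simp_all add: pmf_embed_simplex[OF a])
  also have "\<dots> = (\<Sum>i\<in>UNIV. a $ i * (\<integral>y. f (x(i := y)) \<partial>U i x))"
    unfolding kernel_op_def
    using c f by (intro sum.cong refl, subst integral_distr)
      (auto simp: measurable_cong_sets[OF s(2) refl] bfun_def)
  finally show ?thesis .
qed

lemma measurable_drop_coord:
  fixes S :: "'d::finite \<Rightarrow> 'a measure"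
  shows "drop_coord i \<in> state_space S \<rightarrow>\<^sub>M drop_space S i"
  unfolding drop_coord_def by (rule measurable_restrict_subset) auto

section \<open>Coordinate updates, Gibbs steps and their mixtures as operators\<close>

context mwg_setting
begin

abbreviation (input) P where "P \<equiv> metropolis S p Q q"

abbreviation (input) param_space :: "real \<Rightarrow> ((real ^ 'd) \<times> ('d \<Rightarrow> 'g)) measure"
  where "param_space \<epsilon> \<equiv> sel_space \<epsilon> \<Otimes>\<^sub>M PiM UNIV \<Gamma>"

lemma measurable_metropolis:
  "(\<lambda>(z, g, x). P i z g x) \<in> drop_space S i \<Otimes>\<^sub>M \<Gamma> i \<Otimes>\<^sub>M S i \<rightarrow>\<^sub>M prob_algebra (S i)"
proof -
  let ?W = "drop_space S i \<Otimes>\<^sub>M \<Gamma> i \<Otimes>\<^sub>M S i"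
  \<comment> \<open>Here w = ((z, g, x), y) with y the proposed value. Below, \<open>q1\<close> is
    the density of the proposal from x to y and \<open>q2\<close> that of the reverse
    proposal.\<close>
  have p1: "(\<lambda>w. p i (fst (fst w)) (snd (snd (fst w)))) \<in> borel_measurable (?W \<Otimes>\<^sub>M S i)"
    and p2: "(\<lambda>w. p i (fst (fst w)) (snd w)) \<in> borel_measurable (?W \<Otimes>\<^sub>M S i)"
    using measurable_compose[OF measurable_Pair cond_density_measurable[of i],
        of "\<lambda>w. fst (fst w)" "?W \<Otimes>\<^sub>M S i" "\<lambda>w. snd (snd (fst w))"]
      measurable_compose[OF measurable_Pair cond_density_measurable[of i],
        of "\<lambda>w. fst (fst w)" "?W \<Otimes>\<^sub>M S i" "\<lambda>w. snd w"]
    by simp_all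
  have q1: "(\<lambda>w. q i (fst (fst w)) (fst (snd (fst w))) (snd (snd (fst w))) (snd w)) \<in> borel_measurable (?W \<Otimes>\<^sub>M S i)"
    and q2: "(\<lambda>w. q i (fst (fst w)) (fst (snd (fst w))) (snd w) (snd (snd (fst w)))) \<in> borel_measurable (?W \<Otimes>\<^sub>M S i)"
    using measurable_compose[OF _ proposal_density_measurable[of i],
        of "\<lambda>w. (fst (fst w), fst (snd (fst w)), snd (snd (fst w)), snd w)" "?W \<Otimes>\<^sub>M S i"]
      measurable_compose[OF _ proposal_density_measurable[of i],
        of "\<lambda>w. (fst (fst w), fst (snd (fst w)), snd w, snd (snd (fst w)))" "?W \<Otimes>\<^sub>M S i"]
    by simp_all
  have acc: "(\<lambda>w. mh_accept (p i (fst (fst w))) (q i (fst (fst w)) (fst (snd (fst w)))) (snd (snd (fst w))) (snd w))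
      \<in> borel_measurable (?W \<Otimes>\<^sub>M S i)"
    unfolding mh_accept_def using p1 p2 q1 q2 by measurable
  have ret: "(\<lambda>(w, a). return (S i) (if a then snd w else snd (snd (fst w))))
      \<in> (?W \<Otimes>\<^sub>M S i) \<Otimes>\<^sub>M count_space UNIV \<rightarrow>\<^sub>M prob_algebra (S i)"
    by (rule measurable_pair_count_space2) (auto intro!: measurable_compose[OF _ measurable_return_prob_space])
  have inner: "(\<lambda>(w, y). measure_pmf (bernoulli_pmf (mh_accept (p i (fst w)) (q i (fst w) (fst (snd w))) (snd (snd w)) y)) \<bind>
        (\<lambda>a. return (S i) (if a then y else snd (snd w)))) \<in> ?W \<Otimes>\<^sub>M S i \<rightarrow>\<^sub>M prob_algebra (S i)"
    using measurable_bind_prob_space2[OF measurable_compose[OF acc measurable_bernoulli_pmf] ret]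
    by (simp add: case_prod_beta)
  show ?thesis
    using measurable_bind_prob_space2[OF proposal_kernel[of i] inner]
    by (simp add: metropolis_def mh_kernel_def case_prod_beta)
qed

lemma metropolis_in_prob_algebra:
  assumes "z \<in> space (drop_space S i)" "g \<in> space (\<Gamma> i)" "x \<in> space (S i)"
  shows "P i z g x \<in> space (prob_algebra (S i))"
  using measurable_space[OF measurable_metropolis[of i], of "(z, g, x)"] assms
  by (simp add: space_pair_measure)

lemma measurable_metropolis_fixed:
  assumes "z \<in> space (drop_space S i)" "g \<in> space (\<Gamma> i)"
  shows "P i z g \<in> S i \<rightarrow>\<^sub>M prob_algebra (S i)"
  using measurable_compose[OF _ measurable_metropolis[of i], of "\<lambda>x. (z, g, x)" "S i"] assms
  by simp

definition coord_op :: "'d \<Rightarrow> 'g \<Rightarrow> (('d \<Rightarrow> 'a) \<Rightarrow> real) \<Rightarrow> ('d \<Rightarrow> 'a) \<Rightarrow> real" where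
  "coord_op i g f x = (\<integral>y. f (x(i := y)) \<partial>P i (drop_coord i x) g (x i))"

definition gibbs_op :: "'d \<Rightarrow> (('d \<Rightarrow> 'a) \<Rightarrow> real) \<Rightarrow> ('d \<Rightarrow> 'a) \<Rightarrow> real" where
  "gibbs_op i f x = (\<integral>y. f (x(i := y)) \<partial>\<kappa> i (drop_coord i x))"

text \<open>The parameters form a single argument so that a random parameter pair can be substituted
  and measurability stated jointly in parameter and state.\<close>

definition mwg_op :: "(real ^ 'd) \<times> ('d \<Rightarrow> 'g) \<Rightarrow> (('d \<Rightarrow> 'a) \<Rightarrow> real) \<Rightarrow> ('d \<Rightarrow> 'a) \<Rightarrow> real" where
  "mwg_op \<theta> f x = (\<Sum>i\<in>UNIV. fst \<theta> $ i * coord_op i (snd \<theta> i) f x)"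

lemma space_PiM_component: "g \<in> space (PiM UNIV N) \<Longrightarrow> g i \<in> space (N i)"
  by (auto simp: space_PiM)

lemma drop_coord_space: "x \<in> space (state_space S) \<Longrightarrow> drop_coord i x \<in> space (drop_space S i)"
  using measurable_space[OF measurable_drop_coord] .

lemma integral_fun_upd_distr:
  fixes f :: "('d \<Rightarrow> 'a) \<Rightarrow> real"
  assumes f: "f \<in> borel_measurable (state_space S)" and V: "V \<in> space (prob_algebra (S i))"
    and x: "x \<in> space (state_space S)"
  shows "(\<integral>y. f (x(i := y)) \<partial>V) = (\<integral>y. f y \<partial>distr V (state_space S) (\<lambda>y. x(i := y)))"
proof -
  have "(\<lambda>y. x(i := y)) \<in> S i \<rightarrow>\<^sub>M state_space S"
    using measurable_Pair2[OF measurable_add_dim[of i UNIV S, simplified] x] by simp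
  moreover have sV: "sets V = sets (S i)" using V by (simp add: space_prob_algebra)
  ultimately have "(\<lambda>y. x(i := y)) \<in> V \<rightarrow>\<^sub>M state_space S"
    by (simp add: measurable_cong_sets[OF sV refl])
  from integral_distr[OF this f] show ?thesis by simp
qed

text \<open>The test function depends on \<theta> as well as the kernel, since iterating a sampler
  with parameter \<theta> produces such functions from the second step on.\<close>

lemma coord_op_bfun_param:
  assumes Th: "\<And>i. G i \<in> \<Theta> \<rightarrow>\<^sub>M \<Gamma> i"
    and h: "(\<lambda>(\<theta>, x). h \<theta> x) \<in> bfun (\<Theta> \<Otimes>\<^sub>M state_space S)"
  shows "(\<lambda>(\<theta>, x). coord_op i (G i \<theta>) (h \<theta>) x) \<in> bfun (\<Theta> \<Otimes>\<^sub>M state_space S)"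
proof -
  let ?N = "\<Theta> \<Otimes>\<^sub>M state_space S"
  define V where "V w = P i (drop_coord i (snd w)) (G i (fst w)) (snd w i)" for w
  have "(\<lambda>w. (drop_coord i (snd w), G i (fst w), snd w i)) \<in> ?N \<rightarrow>\<^sub>M drop_space S i \<Otimes>\<^sub>M \<Gamma> i \<Otimes>\<^sub>M S i"
    by (intro measurable_Pair measurable_compose[OF measurable_fst Th]
        measurable_compose[OF measurable_snd measurable_drop_coord]
        measurable_compose[OF measurable_snd measurable_component_singleton]) simp
  from measurable_compose[OF this measurable_metropolis]
  have V: "V \<in> ?N \<rightarrow>\<^sub>M prob_algebra (S i)" by (simp add: V_def[abs_def])
  define K where "K w = distr (V w) (state_space S) (\<lambda>y. (snd w)(i := y))" for w
  have K: "K \<in> ?N \<rightarrow>\<^sub>M prob_algebra (state_space S)"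
    unfolding K_def by (rule measurable_distr_fun_upd[OF V measurable_snd])
  obtain B where B: "(\<lambda>(\<theta>, x). h \<theta> x) \<in> borel_measurable ?N"
    "\<And>w. w \<in> space ?N \<Longrightarrow> \<bar>(\<lambda>(\<theta>, x). h \<theta> x) w\<bar> \<le> B"
    using h by (rule bfunE) blast
  have "(\<lambda>(w, y). h (fst w) y) \<in> bfun (?N \<Otimes>\<^sub>M state_space S)"
  proof (rule bfunI[where B=B])
    show "(\<lambda>(w, y). h (fst w) y) \<in> borel_measurable (?N \<Otimes>\<^sub>M state_space S)"
      using measurable_compose[OF _ B(1), of "\<lambda>(w, y). (fst w, y)" "?N \<Otimes>\<^sub>M state_space S"]
      by (simp add: case_prod_beta)
    show "\<bar>(\<lambda>(w, y). h (fst w) y) w\<bar> \<le> B" if "w \<in> space (?N \<Otimes>\<^sub>M state_space S)" for w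
      using that B(2)[of "(fst (fst w), snd w)"] by (auto simp: space_pair_measure)
  qed
  from kernel_op_bfun_param[OF K this]
  have K': "(\<lambda>w. kernel_op K (h (fst w)) w) \<in> bfun ?N" .
  have eq: "kernel_op K (h (fst w)) w = coord_op i (G i (fst w)) (h (fst w)) (snd w)" if w: "w \<in> space ?N" for w
  proof -
    have "h (fst w) \<in> borel_measurable (state_space S)"
      using measurable_Pair2[OF B(1), of "fst w"] w by (auto simp: space_pair_measure)
    from integral_fun_upd_distr[OF this measurable_space[OF V w]] show ?thesis
      using w by (auto simp: kernel_op_def K_def coord_op_def V_def space_pair_measure)
  qed
  have "(\<lambda>w. coord_op i (G i (fst w)) (h (fst w)) (snd w)) \<in> bfun ?N"
    by (rule bfun_cong[OF K']) (simp add: eq)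
  then show ?thesis by (simp add: case_prod_unfold)
qed

lemma markov_op_coord_op:
  assumes g: "g \<in> space (\<Gamma> i)"
  shows "markov_op (state_space S) (coord_op i g)"
proof -
  define V where "V x = P i (drop_coord i x) g (x i)" for x
  have "(\<lambda>x. (drop_coord i x, g, x i)) \<in> state_space S \<rightarrow>\<^sub>M drop_space S i \<Otimes>\<^sub>M \<Gamma> i \<Otimes>\<^sub>M S i"
    using g by (intro measurable_Pair measurable_drop_coord measurable_const measurable_component_singleton) auto
  from measurable_compose[OF this measurable_metropolis]
  have V: "V \<in> state_space S \<rightarrow>\<^sub>M prob_algebra (S i)" by (simp add: V_def[abs_def])
  have "markov_op (state_space S) (kernel_op (\<lambda>x. distr (V x) (state_space S) (\<lambda>y. x(i := y))))"
    by (rule markov_op_kernel_op[OF measurable_distr_fun_upd[OF V measurable_ident, simplified]])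
  then show ?thesis
    by (rule markov_op_eqI) (auto simp: kernel_op_def coord_op_def bfun_def V_def[symmetric]
      integral_fun_upd_distr[OF _ measurable_space[OF V]])
qed

lemma markov_op_gibbs_op: "markov_op (state_space S) (gibbs_op i)"
proof -
  have V: "(\<lambda>x. \<kappa> i (drop_coord i x)) \<in> state_space S \<rightarrow>\<^sub>M prob_algebra (S i)"
    by (rule measurable_compose[OF measurable_drop_coord cond_kernel])
  have "markov_op (state_space S) (kernel_op (\<lambda>x. distr (\<kappa> i (drop_coord i x)) (state_space S) (\<lambda>y. x(i := y))))"
    by (rule markov_op_kernel_op[OF measurable_distr_fun_upd[OF V measurable_ident, simplified]])
  then show ?thesis
    by (rule markov_op_eqI) (auto simp: kernel_op_def gibbs_op_def bfun_def
      integral_fun_upd_distr[OF _ measurable_space[OF V]])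
qed

lemma kernel_op_mwg:
  assumes "a \<in> prob_simplex" "g \<in> space (PiM UNIV \<Gamma>)" "x \<in> space (state_space S)" "f \<in> bfun (state_space S)"
  shows "kernel_op (mwg S P a g) f x = mwg_op (a, g) f x"
  unfolding mwg_def mwg_op_def coord_op_def
  using assms metropolis_in_prob_algebra drop_coord_space
    space_PiM_component[OF assms(2)] space_PiM_component[OF assms(3)]
  by (subst kernel_op_random_scan) simp_all

lemma kernel_op_rsg:
  assumes "a \<in> prob_simplex" "x \<in> space (state_space S)" "f \<in> bfun (state_space S)"
  shows "kernel_op (rsg S \<kappa> a) f x = (\<Sum>i\<in>UNIV. a $ i * gibbs_op i f x)"
  unfolding rsg_def gibbs_op_def
  using assms measurable_space[OF cond_kernel] drop_coord_space
  by (subst kernel_op_random_scan) simp_all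

lemma measurable_rsg: "rsg S \<kappa> a \<in> state_space S \<rightarrow>\<^sub>M prob_algebra (state_space S)"
  unfolding rsg_def
  by (rule measurable_random_scan) (rule measurable_compose[OF measurable_drop_coord cond_kernel])

lemma markov_op_mwg_op:
  assumes "a \<in> prob_simplex" "g \<in> space (PiM UNIV \<Gamma>)"
  shows "markov_op (state_space S) (mwg_op (a, g))"
  unfolding mwg_op_def using assms
  by (intro markov_op_convex markov_op_coord_op)
    (auto simp: prob_simplex_def intro: space_PiM_component[OF assms(2)])

lemma mwg_op_bfun_param:
  assumes h: "(\<lambda>(\<theta>, x). h \<theta> x) \<in> bfun (param_space \<epsilon> \<Otimes>\<^sub>M state_space S)"
  shows "(\<lambda>(\<theta>, x). mwg_op \<theta> (h \<theta>) x) \<in> bfun (param_space \<epsilon> \<Otimes>\<^sub>M state_space S)"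
proof -
  let ?N = "param_space \<epsilon> \<Otimes>\<^sub>M state_space S"
  have C: "(\<lambda>(\<theta>, x). coord_op i (snd \<theta> i) (h \<theta>) x) \<in> bfun ?N" for i
    by (rule coord_op_bfun_param[OF _ h, where G="\<lambda>i \<theta>. snd \<theta> i"])
      (intro measurable_compose[OF measurable_snd measurable_component_singleton], simp)
  have a: "(\<lambda>w. fst (fst w) $ i) \<in> bfun ?N" for i
  proof (rule bfunI[where B=1])
    have "(\<lambda>a :: real ^ 'd. a $ i) \<in> borel_measurable (sel_space \<epsilon>)"
      by (intro measurable_restrict_space1 borel_measurable_continuous_onI continuous_intros)
    then show "(\<lambda>w. fst (fst w) $ i) \<in> borel_measurable ?N"
      by (rule measurable_compose[OF measurable_compose[OF measurable_fst measurable_fst]])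
    show "\<bar>fst (fst w) $ i\<bar> \<le> 1" if "w \<in> space ?N" for w
    proof -
      have "fst (fst w) \<in> sel_probs \<epsilon>"
        using that by (auto simp: space_pair_measure space_restrict_space)
      then have "fst (fst w) $ i \<le> 1" "0 \<le> fst (fst w) $ i"
        by (simp_all add: sel_probs_def prob_simplex_def)
      then show ?thesis by simp
    qed
  qed
  have "(\<lambda>w. \<Sum>i\<in>UNIV. fst (fst w) $ i * (\<lambda>(\<theta>, x). coord_op i (snd \<theta> i) (h \<theta>) x) w) \<in> bfun ?N"
    by (intro bfun_sum bfun_mult a C)
  then show ?thesis by (simp add: mwg_op_def case_prod_unfold)
qed

text \<open>Updating coordinate i leaves \<open>drop_coord i x\<close> unchanged, so the same
  one-coordinate kernel is used at every repetition. This carries the assumptions on the kernels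
  over to the product space.\<close>

lemma coord_op_funpow:
  "(coord_op i g ^^ k) f x = (kernel_op (P i (drop_coord i x) g) ^^ k) (\<lambda>y. f (x(i := y))) (x i)"
proof (induction k arbitrary: x)
  case (Suc k)
  have drop: "drop_coord i (x(i := y)) = drop_coord i x" for y
    by (auto simp: drop_coord_def restrict_def)
  have "(coord_op i g ^^ Suc k) f x = (\<integral>y. (coord_op i g ^^ k) f (x(i := y)) \<partial>P i (drop_coord i x) g (x i))"
    by (simp add: coord_op_def)
  also have "\<dots> = (\<integral>y. (kernel_op (P i (drop_coord i x) g) ^^ k) (\<lambda>y. f (x(i := y))) y
      \<partial>P i (drop_coord i x) g (x i))"
    by (simp only: Suc.IH drop fun_upd_same fun_upd_upd)
  also have "\<dots> = (kernel_op (P i (drop_coord i x) g) ^^ Suc k) (\<lambda>y. f (x(i := y))) (x i)"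
    by (simp add: kernel_op_def)
  finally show ?case .
qed simp

end

section \<open>Conditional distributions and invariance\<close>

lemma subalgebra_vimage_algebra:
  assumes "f \<in> M \<rightarrow>\<^sub>M N"
  shows "subalgebra M (vimage_algebra (space M) f N)"
  using sets_image_in_sets[OF refl assms] by (simp add: subalgebra_def)

lemma measurable_kernel_Pair:
  assumes K: "K \<in> M \<rightarrow>\<^sub>M prob_algebra N" and Z: "Z \<in> M \<rightarrow>\<^sub>M L"
  shows "(\<lambda>w. distr (K w) (L \<Otimes>\<^sub>M N) (Pair (Z w))) \<in> M \<rightarrow>\<^sub>M prob_algebra (L \<Otimes>\<^sub>M N)"
proof (rule measurable_prob_algebraI)
  have "(\<lambda>(w, y). (Z w, y)) \<in> M \<Otimes>\<^sub>M N \<rightarrow>\<^sub>M L \<Otimes>\<^sub>M N"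
    using Z by (simp add: case_prod_unfold measurable_compose[OF measurable_fst Z])
  then show "(\<lambda>w. distr (K w) (L \<Otimes>\<^sub>M N) (Pair (Z w))) \<in> M \<rightarrow>\<^sub>M subprob_algebra (L \<Otimes>\<^sub>M N)"
    by (rule measurable_distr2[OF _ measurable_prob_algebraD[OF K]])
  fix w assume w: "w \<in> space M"
  have p: "prob_space (K w)" and s: "sets (K w) = sets N"
    using measurable_space[OF K w] by (auto simp: space_prob_algebra)
  have "Pair (Z w) \<in> K w \<rightarrow>\<^sub>M L \<Otimes>\<^sub>M N"
    using measurable_Pair1'[OF measurable_space[OF Z w], of N] by (simp add: measurable_cong_sets[OF s refl])
  then show "prob_space (distr (K w) (L \<Otimes>\<^sub>M N) (Pair (Z w)))"
    by (rule prob_space.prob_space_distr[OF p])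
qed

text \<open>The defining property of a conditional distribution concerns events only; it extends to
  functions of \<open>Y\<close> and an \<open>F\<close>-measurable \<open>Z\<close> because the laws of \<open>(Z, Y)\<close> agree on rectangles.\<close>

lemma integral_cond_distr:
  fixes h :: "'z \<Rightarrow> 'y \<Rightarrow> real"
  assumes \<Omega>: "prob_space \<Omega>" and cd: "is_cond_distr \<Omega> F Y N K" and F: "subalgebra \<Omega> F"
    and Y: "Y \<in> \<Omega> \<rightarrow>\<^sub>M N" and Z: "Z \<in> F \<rightarrow>\<^sub>M L"
    and h: "(\<lambda>(z, y). h z y) \<in> bfun (L \<Otimes>\<^sub>M N)"
  shows "(\<integral>\<omega>. h (Z \<omega>) (Y \<omega>) \<partial>\<Omega>) = (\<integral>\<omega>. kernel_op K (h (Z \<omega>)) \<omega> \<partial>\<Omega>)"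
proof -
  interpret prob_space \<Omega> by fact
  interpret sigma_finite_subalgebra \<Omega> F
    by (rule finite_measure_subalgebra_is_sigma_finite)
      (simp add: finite_measure_subalgebra_def finite_measure_subalgebra_axioms_def F finite_measure_axioms)
  have KF: "K \<in> F \<rightarrow>\<^sub>M prob_algebra N"
    and cond: "\<And>A. A \<in> sets N \<Longrightarrow> AE \<omega> in \<Omega>. real_cond_exp \<Omega> F (\<lambda>\<omega>. indicator A (Y \<omega>)) \<omega> = measure (K \<omega>) A"
    using cd by (auto simp: is_cond_distr_def)
  have K: "K \<in> \<Omega> \<rightarrow>\<^sub>M prob_algebra N" by (rule measurable_from_subalg[OF F KF])
  have Z\<Omega>: "Z \<in> \<Omega> \<rightarrow>\<^sub>M L" by (rule measurable_from_subalg[OF F Z])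
  \<comment> \<open>\<open>K2\<close> is the candidate conditional law of the pair (Z, Y) given F: Z
    is known and enters as a point mass.\<close>
  define K2 where "K2 \<omega> = distr (K \<omega>) (L \<Otimes>\<^sub>M N) (Pair (Z \<omega>))" for \<omega>
  have K2: "K2 \<in> \<Omega> \<rightarrow>\<^sub>M prob_algebra (L \<Otimes>\<^sub>M N)"
    unfolding K2_def by (rule measurable_kernel_Pair[OF K Z\<Omega>])
  have \<Omega>': "\<Omega> \<in> space (prob_algebra \<Omega>)" by (simp add: space_prob_algebra \<Omega>)
  have ZY: "(\<lambda>\<omega>. (Z \<omega>, Y \<omega>)) \<in> \<Omega> \<rightarrow>\<^sub>M L \<Otimes>\<^sub>M N" by (rule measurable_Pair[OF Z\<Omega> Y])
  have K2_int: "kernel_op K2 f \<omega> = (\<integral>y. f (Z \<omega>, y) \<partial>K \<omega>)"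
    if w: "\<omega> \<in> space \<Omega>" and f: "f \<in> borel_measurable (L \<Otimes>\<^sub>M N)" for f :: "_ \<Rightarrow> real" and \<omega>
  proof -
    have s: "sets (K \<omega>) = sets N" using measurable_space[OF K w] by (auto simp: space_prob_algebra)
    have "Pair (Z \<omega>) \<in> K \<omega> \<rightarrow>\<^sub>M L \<Otimes>\<^sub>M N"
      using measurable_Pair1'[OF measurable_space[OF Z\<Omega> w], of N] by (simp add: measurable_cong_sets[OF s refl])
    from integral_distr[OF this f] show ?thesis by (simp add: kernel_op_def K2_def)
  qed
  define E where "E = {A \<times> B | A B. A \<in> sets L \<and> B \<in> sets N}"
  have sB: "sets (\<Omega> \<bind> K2) = sets (L \<Otimes>\<^sub>M N)" and pB: "prob_space (\<Omega> \<bind> K2)"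
    by (rule sets_bind'[OF \<Omega>' K2], rule prob_space_bind'[OF \<Omega>' K2])
  have law: "distr \<Omega> (L \<Otimes>\<^sub>M N) (\<lambda>\<omega>. (Z \<omega>, Y \<omega>)) = \<Omega> \<bind> K2" (is "?\<mu> = ?\<nu>")
  proof (rule measure_eqI_generator_eq[of E "space L \<times> space N" _ _ "\<lambda>_. space L \<times> space N"])
    show "Int_stable E" unfolding E_def by (rule Int_stable_pair_measure_generator)
    show "E \<subseteq> Pow (space L \<times> space N)" unfolding E_def by (rule pair_measure_closed)
    show "sets ?\<mu> = sigma_sets (space L \<times> space N) E"
      by (simp add: sets_pair_measure E_def)
    show "sets ?\<nu> = sigma_sets (space L \<times> space N) E"
      by (simp add: sB sets_pair_measure E_def)
    show "range (\<lambda>_::nat. space L \<times> space N) \<subseteq> E" by (auto simp: E_def)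
    interpret \<mu>: prob_space ?\<mu> by (rule prob_space_distr[OF ZY])
    interpret \<nu>: prob_space ?\<nu> by (rule pB)
    show "emeasure ?\<mu> (space L \<times> space N) \<noteq> \<infinity>" by simp
    fix R assume "R \<in> E"
    then obtain A B where R: "R = A \<times> B" and A: "A \<in> sets L" and B: "B \<in> sets N" by (auto simp: E_def)
    have Rs: "R \<in> sets (L \<Otimes>\<^sub>M N)" using A B R by simp
    have iA: "(\<lambda>\<omega>. indicator A (Z \<omega>) :: real) \<in> borel_measurable F"
      by (rule measurable_compose[OF Z borel_measurable_indicator[OF A]])
    have iB: "(\<lambda>\<omega>. indicator B (Y \<omega>) :: real) \<in> borel_measurable \<Omega>"
      by (rule measurable_compose[OF Y borel_measurable_indicator[OF B]])
    have iA': "(\<lambda>\<omega>. indicator A (Z \<omega>) :: real) \<in> borel_measurable \<Omega>"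
      by (rule measurable_from_subalg[OF F iA])
    have mK: "(\<lambda>\<omega>. measure (K \<omega>) B) \<in> borel_measurable \<Omega>"
      by (rule measurable_compose[OF K measurable_measure_prob_algebra[OF B]])
    have "measure ?\<mu> R = (\<integral>\<omega>. indicator R (Z \<omega>, Y \<omega>) \<partial>\<Omega>)"
    proof -
      have "(\<integral>x. indicator R x \<partial>?\<mu>) = (\<integral>\<omega>. indicator R (Z \<omega>, Y \<omega>) \<partial>\<Omega> :: real)"
        by (rule integral_distr[OF ZY borel_measurable_indicator[OF Rs]])
      then show ?thesis using sets.Int_space_eq2[OF Rs] by simp
    qed
    also have "\<dots> = (\<integral>\<omega>. indicator A (Z \<omega>) * indicator B (Y \<omega>) \<partial>\<Omega>)"
      by (simp add: R indicator_times)
    \<comment> \<open>The F-measurability of Z enters here: the first factor is F-measurable, so the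
      second may be replaced by its conditional expectation.\<close>
    also have "\<dots> = (\<integral>\<omega>. indicator A (Z \<omega>) * real_cond_exp \<Omega> F (\<lambda>\<omega>. indicator B (Y \<omega>)) \<omega> \<partial>\<Omega>)"
      using iA' iB
      by (intro real_cond_exp_intg(2)[symmetric] iA iB integrable_const_bound[where B=1] AE_I2)
        (auto simp: indicator_def)
    also have "\<dots> = (\<integral>\<omega>. indicator A (Z \<omega>) * measure (K \<omega>) B \<partial>\<Omega>)"
      using cond[OF B] iA' mK by (intro integral_cong_AE) auto
    also have "\<dots> = (\<integral>\<omega>. kernel_op K2 (indicator R) \<omega> \<partial>\<Omega>)"
    proof (rule Bochner_Integration.integral_cong[OF refl])
      fix \<omega> assume w: "\<omega> \<in> space \<Omega>"
      have s: "sets (K \<omega>) = sets N"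
        using measurable_space[OF K w] by (auto simp: space_prob_algebra)
      then have "B \<inter> space (K \<omega>) = B" using B by (simp add: sets.Int_space_eq2)
      then show "indicator A (Z \<omega>) * measure (K \<omega>) B = kernel_op K2 (indicator R) \<omega>"
        using K2_int[OF w borel_measurable_indicator[OF Rs]] by (simp add: R indicator_times)
    qed
    also have "\<dots> = (\<integral>x. indicator R x \<partial>?\<nu>)"
      by (rule integral_bind_kernel[OF \<Omega>' K2 ufun_imp_bfun[OF ufun_indicator[OF Rs]], symmetric])
    also have "\<dots> = measure ?\<nu> R" using Rs by (simp flip: sB add: sets.Int_space_eq2)
    finally show "emeasure ?\<mu> R = emeasure ?\<nu> R"
      by (simp add: \<mu>.emeasure_eq_measure \<nu>.emeasure_eq_measure)
  qed auto
  have hm: "(\<lambda>(z, y). h z y) \<in> borel_measurable (L \<Otimes>\<^sub>M N)" using h by (simp add: bfun_def)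
  have "(\<integral>\<omega>. h (Z \<omega>) (Y \<omega>) \<partial>\<Omega>) = (\<integral>w. (\<lambda>(z, y). h z y) w \<partial>?\<mu>)"
    using integral_distr[OF ZY hm] by simp
  also have "\<dots> = (\<integral>\<omega>. kernel_op K2 (\<lambda>(z, y). h z y) \<omega> \<partial>\<Omega>)"
    unfolding law by (rule integral_bind_kernel[OF \<Omega>' K2 h])
  also have "\<dots> = (\<integral>\<omega>. kernel_op K (h (Z \<omega>)) \<omega> \<partial>\<Omega>)"
    using K2_int[OF _ hm] by (intro Bochner_Integration.integral_cong refl) (simp add: kernel_op_def)
  finally show ?thesis .
qed

lemma integral_funpow_invariant:
  assumes T: "markov_op M T" and inv: "\<And>f. f \<in> ufun M \<Longrightarrow> (\<integral>x. T f x \<partial>\<mu>) = (\<integral>x. f x \<partial>\<mu>)"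
    and f: "f \<in> ufun M"
  shows "(\<integral>x. (T ^^ n) f x \<partial>\<mu>) = (\<integral>x. f x \<partial>\<mu>)"
  by (induction n) (simp_all add: inv markov_op_ufun[OF markov_op_funpow[OF T] f])

context mwg_setting
begin

lemma sets_cond_kernel:
  assumes "z \<in> space (drop_space S i)"
  shows "prob_space (\<kappa> i z)" "sets (\<kappa> i z) = sets (S i)"
  using measurable_space[OF cond_kernel assms] by (auto simp: space_prob_algebra)

text \<open>Given the other coordinates, coordinate i has law \<open>\<kappa> i z\<close>, which the
  Metropolis kernel preserves; disintegrating \<pi> along \<open>drop_coord i\<close> turns this
  into invariance of \<pi>.\<close>

lemma coord_op_invariant:
  assumes erg: "\<And>z. z \<in> space (drop_space S i) \<Longrightarrow> uniformly_ergodic (S i) (P i z g) (\<kappa> i z)"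
    and g: "g \<in> space (\<Gamma> i)" and f: "f \<in> ufun (state_space S)"
  shows "(\<integral>x. coord_op i g f x \<partial>\<pi>) = (\<integral>x. f x \<partial>\<pi>)"
proof -
  let ?D = "drop_space S i" and ?F = "vimage_algebra (space \<pi>) (drop_coord i) (drop_space S i)"
  have J: "insert i (- {i}) = UNIV" by auto
  have D: "drop_coord i \<in> \<pi> \<rightarrow>\<^sub>M ?D"
    using measurable_drop_coord by (simp add: measurable_cong_sets[OF sets_target refl])
  have Y: "(\<lambda>x. x i) \<in> \<pi> \<rightarrow>\<^sub>M S i"
    using measurable_component_singleton[of i UNIV S] by (simp add: measurable_cong_sets[OF sets_target refl])
  have Z: "drop_coord i \<in> ?F \<rightarrow>\<^sub>M ?D"
    using measurable_space[OF D] by (intro measurable_vimage_algebra1) auto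
  note cond = integral_cond_distr[OF prob_target cond_distr subalgebra_vimage_algebra[OF D] Y Z]
  have fb: "f \<in> bfun (state_space S)" using f by (rule ufun_imp_bfun)
  have h2: "(\<lambda>(z, y). f (z(i := y))) \<in> bfun (?D \<Otimes>\<^sub>M S i)" by (rule bfun_fun_upd[OF fb J])
  \<comment> \<open>\<open>h1 z y\<close> is the mean of f after one Metropolis update of coordinate
    i from the value y, with the other coordinates held at z.\<close>
  define h1 where "h1 z y = kernel_op (P i z g) (\<lambda>y. f (z(i := y))) y" for z y
  have h1: "(\<lambda>(z, y). h1 z y) \<in> bfun (?D \<Otimes>\<^sub>M S i)"
  proof -
    have "(\<lambda>w. (fst w, g, snd w)) \<in> ?D \<Otimes>\<^sub>M S i \<rightarrow>\<^sub>M ?D \<Otimes>\<^sub>M \<Gamma> i \<Otimes>\<^sub>M S i"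
      using g by simp
    from measurable_compose[OF this measurable_metropolis]
    have K: "(\<lambda>w. P i (fst w) g (snd w)) \<in> ?D \<Otimes>\<^sub>M S i \<rightarrow>\<^sub>M prob_algebra (S i)" by simp
    obtain B where B: "(\<lambda>(z, y). f (z(i := y))) \<in> borel_measurable (?D \<Otimes>\<^sub>M S i)"
      "\<And>w. w \<in> space (?D \<Otimes>\<^sub>M S i) \<Longrightarrow> \<bar>(\<lambda>(z, y). f (z(i := y))) w\<bar> \<le> B"
      using h2 by (rule bfunE) blast
    have "(\<lambda>(w, y). f ((fst w)(i := y))) \<in> bfun ((?D \<Otimes>\<^sub>M S i) \<Otimes>\<^sub>M S i)"
    proof (rule bfunI[where B=B])
      have "(\<lambda>w. (fst (fst w), snd w)) \<in> (?D \<Otimes>\<^sub>M S i) \<Otimes>\<^sub>M S i \<rightarrow>\<^sub>M ?D \<Otimes>\<^sub>M S i" by simp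
      from measurable_compose[OF this B(1)]
      show "(\<lambda>(w, y). f ((fst w)(i := y))) \<in> borel_measurable ((?D \<Otimes>\<^sub>M S i) \<Otimes>\<^sub>M S i)"
        by (simp add: case_prod_unfold)
      show "\<bar>(\<lambda>(w, y). f ((fst w)(i := y))) w\<bar> \<le> B" if "w \<in> space ((?D \<Otimes>\<^sub>M S i) \<Otimes>\<^sub>M S i)" for w
        using B(2)[of "(fst (fst w), snd w)"] that by (auto simp: space_pair_measure)
    qed
    from kernel_op_bfun_param[OF K this] show ?thesis
      by (simp add: h1_def kernel_op_def case_prod_unfold)
  qed
  have upd: "(drop_coord i x)(i := y) = x(i := y)" for x :: "'d \<Rightarrow> 'a" and y
    by (auto simp: drop_coord_def)
  have "(\<integral>x. coord_op i g f x \<partial>\<pi>) = (\<integral>x. h1 (drop_coord i x) (x i) \<partial>\<pi>)"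
    by (simp add: coord_op_def h1_def kernel_op_def upd)
  \<comment> \<open>Coordinate i is averaged out given the others; the next equality uses invariance
    inside the fibre, and the last one undoes the averaging.\<close>
  also have "\<dots> = (\<integral>x. kernel_op (\<lambda>x. \<kappa> i (drop_coord i x)) (h1 (drop_coord i x)) x \<partial>\<pi>)"
    by (rule cond[OF h1])
  also have "\<dots> = (\<integral>x. kernel_op (\<lambda>x. \<kappa> i (drop_coord i x)) (\<lambda>y. f ((drop_coord i x)(i := y))) x \<partial>\<pi>)"
  proof (rule Bochner_Integration.integral_cong[OF refl])
    fix x assume "x \<in> space \<pi>"
    then have z: "drop_coord i x \<in> space ?D" by (rule measurable_space[OF D])
    show "kernel_op (\<lambda>x. \<kappa> i (drop_coord i x)) (h1 (drop_coord i x)) x =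
        kernel_op (\<lambda>x. \<kappa> i (drop_coord i x)) (\<lambda>y. f ((drop_coord i x)(i := y))) x"
      using uniformly_ergodic_invariant[OF measurable_metropolis_fixed[OF z g] sets_cond_kernel[OF z] erg[OF z]
          ufun_fun_upd[OF f z J]]
      by (simp add: kernel_op_def h1_def)
  qed
  also have "\<dots> = (\<integral>x. f ((drop_coord i x)(i := x i)) \<partial>\<pi>)"
    by (rule cond[OF h2, symmetric])
  finally show ?thesis by (simp add: upd)
qed

lemma mwg_op_invariant:
  assumes erg: "\<And>i z g. z \<in> space (drop_space S i) \<Longrightarrow> g \<in> space (\<Gamma> i) \<Longrightarrow> uniformly_ergodic (S i) (P i z g) (\<kappa> i z)"
    and a: "a \<in> prob_simplex" and g: "g \<in> space (PiM UNIV \<Gamma>)" and f: "f \<in> ufun (state_space S)"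
  shows "(\<integral>x. mwg_op (a, g) f x \<partial>\<pi>) = (\<integral>x. f x \<partial>\<pi>)"
proof -
  interpret \<pi>: prob_space \<pi> by (rule prob_target)
  have gi: "g i \<in> space (\<Gamma> i)" for i by (rule space_PiM_component[OF g])
  have i: "integrable \<pi> (coord_op i (g i) f)" for i
    by (rule integrable_bfun[OF markov_op_bfun[OF markov_op_coord_op[OF gi] ufun_imp_bfun[OF f]]
          \<pi>.finite_measure_axioms sets_target])
  have "(\<integral>x. mwg_op (a, g) f x \<partial>\<pi>) = (\<Sum>i\<in>UNIV. a $ i * (\<integral>x. coord_op i (g i) f x \<partial>\<pi>))"
    unfolding mwg_op_def using i by (simp add: Bochner_Integration.integral_sum)
  also have "\<dots> = (\<Sum>i\<in>UNIV. a $ i) * (\<integral>x. f x \<partial>\<pi>)"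
    by (simp add: coord_op_invariant[OF erg gi f] gi sum_distrib_right)
  finally show ?thesis using a by (simp add: prob_simplex_def)
qed

text \<open>The constants of uniform ergodicity may depend on z and g, so that assumption
  contributes only the invariance of \<open>\<kappa> i z\<close>. The common threshold comes from
  the minorization, whose s and m are shared by all parameters.\<close>

lemma coord_op_close_gibbs_op:
  assumes erg: "\<And>z g. z \<in> space (drop_space S i) \<Longrightarrow> g \<in> space (\<Gamma> i) \<Longrightarrow> uniformly_ergodic (S i) (P i z g) (\<kappa> i z)"
    and s: "0 < s"
    and minor: "\<And>z g. z \<in> space (drop_space S i) \<Longrightarrow> g \<in> space (\<Gamma> i) \<Longrightarrow>
      \<exists>\<nu>. prob_space \<nu> \<and> sets \<nu> = sets (S i) \<and>
        (\<forall>x\<in>space (S i). \<forall>A\<in>sets (S i). s * measure \<nu> A \<le> measure (kernel_pow (S i) (P i z g) m x) A)"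
    and \<eta>: "0 < \<eta>"
  shows "\<exists>k0. \<forall>k\<ge>k0. \<forall>g\<in>space (\<Gamma> i). \<forall>f\<in>ufun (state_space S). \<forall>x\<in>space (state_space S).
    \<bar>(coord_op i g ^^ k) f x - gibbs_op i f x\<bar> \<le> \<eta>"
proof -
  \<comment> \<open>\<open>1 - s\<close> need not be positive, whereas raising a contraction to
    powers requires a positive coefficient; the floor 1/2 ensures this, and s > 0 keeps the maximum
    below one.\<close>
  define \<delta> where "\<delta> = max (1 - s) (1 / 2)"
  have \<delta>: "0 < \<delta>" "\<delta> < 1" using s by (auto simp: \<delta>_def)
  have "(\<lambda>j. \<delta> ^ j) \<longlonglongrightarrow> 0" using \<delta> by (intro LIMSEQ_power_zero) simp
  from order_tendstoD(2)[OF this \<eta>] obtain j where j: "\<delta> ^ j < \<eta>"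
    by (auto simp: eventually_sequentially)
  show ?thesis
  proof (intro exI[of _ "m * j"] allI impI ballI)
    fix k g f x
    assume k: "m * j \<le> k" and g: "g \<in> space (\<Gamma> i)" and f: "f \<in> ufun (state_space S)"
      and x: "x \<in> space (state_space S)"
    define z where "z = drop_coord i x"
    have z: "z \<in> space (drop_space S i)" unfolding z_def by (rule drop_coord_space[OF x])
    have K: "P i z g \<in> S i \<rightarrow>\<^sub>M prob_algebra (S i)" by (rule measurable_metropolis_fixed[OF z g])
    note T = markov_op_kernel_op[OF K]
    have "osc_contraction (S i) (kernel_op (P i z g) ^^ m) (1 - s)"
      using minor[OF z g] osc_contraction_kernel_minorized[OF K] by blast
    then have "osc_contraction (S i) (kernel_op (P i z g) ^^ m) \<delta>"
      by (rule osc_contraction_weaken) (simp add: \<delta>_def)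
    from osc_contraction_funpow[OF markov_op_funpow[OF T] this \<delta>(1), of j]
    have "osc_contraction (S i) (kernel_op (P i z g) ^^ (m * j)) \<eta>"
      using j by (auto simp: funpow_mult mult.commute intro: osc_contraction_weaken)
    from osc_contraction_funpow_mono[OF this T k]
    have osc: "osc_contraction (S i) (kernel_op (P i z g) ^^ k) \<eta>" .
    have h: "(\<lambda>y. f (x(i := y))) \<in> ufun (S i)" by (rule ufun_fun_upd[OF f x]) simp
    have "\<bar>(kernel_op (P i z g) ^^ k) (\<lambda>y. f (x(i := y))) (x i) - (\<integral>y. f (x(i := y)) \<partial>\<kappa> i z)\<bar> \<le> \<eta>"
      by (rule osc_contraction_invariant[OF sets_cond_kernel[OF z] markov_op_funpow[OF T] _ osc h
            space_PiM_component[OF x]])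
        (rule integral_funpow_invariant[OF T uniformly_ergodic_invariant[OF K sets_cond_kernel[OF z] erg[OF z g]]])
    then show "\<bar>(coord_op i g ^^ k) f x - gibbs_op i f x\<bar> \<le> \<eta>"
      by (simp add: coord_op_funpow gibbs_op_def z_def)
  qed
qed

text \<open>N precedes all quantifiers over selection probabilities, proposal parameters, functions
  and states. This uniformity allows the random parameters of the adaptive chain to be inserted
  later.\<close>

lemma mwg_op_funpow_close:
  assumes \<epsilon>: "0 < \<epsilon>"
    and \<beta>: "\<beta> \<in> sel_probs \<epsilon>" and rsg: "uniformly_ergodic (state_space S) (rsg S \<kappa> \<beta>) \<pi>"
    and erg: "\<And>i z g. z \<in> space (drop_space S i) \<Longrightarrow> g \<in> space (\<Gamma> i) \<Longrightarrow> uniformly_ergodic (S i) (P i z g) (\<kappa> i z)"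
    and minor: "\<And>i. \<exists>s>0. \<exists>m. \<forall>z\<in>space (drop_space S i). \<forall>g\<in>space (\<Gamma> i).
      \<exists>\<nu>. prob_space \<nu> \<and> sets \<nu> = sets (S i) \<and>
        (\<forall>x\<in>space (S i). \<forall>A\<in>sets (S i). s * measure \<nu> A \<le> measure (kernel_pow (S i) (P i z g) m x) A)"
    and e: "0 < e"
  shows "\<exists>N. \<forall>a\<in>sel_probs \<epsilon>. \<forall>g\<in>space (PiM UNIV \<Gamma>). \<forall>f\<in>ufun (state_space S). \<forall>x\<in>space (state_space S).
    \<bar>(mwg_op (a, g) ^^ N) f x - (\<integral>x. f x \<partial>\<pi>)\<bar> \<le> e"
proof -
  let ?X = "state_space S"
  have simplex: "a \<in> prob_simplex" if "a \<in> sel_probs \<epsilon>" for a :: "real ^ 'd"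
    using that by (simp add: sel_probs_def)
  define B where "B = (\<lambda>f x. \<Sum>i\<in>UNIV. \<beta> $ i * gibbs_op i f x)"
  have \<beta>01: "\<And>i. 0 \<le> \<beta> $ i" "(\<Sum>i\<in>UNIV. \<beta> $ i) = 1"
    using simplex[OF \<beta>] by (auto simp: prob_simplex_def)
  have B: "markov_op ?X B" unfolding B_def by (intro markov_op_convex markov_op_gibbs_op \<beta>01)
  obtain n where n: "osc_contraction ?X (kernel_op (rsg S \<kappa> \<beta>) ^^ n) (1 / 4)"
    using uniformly_ergodic_osc_contraction[OF measurable_rsg prob_target sets_target rsg, of "1 / 4"] by auto
  \<comment> \<open>B and the kernel operator agree only on bounded measurable functions at points
    of the space, so their powers are compared by the closeness estimate with error zero.\<close>
  have "\<bar>(B ^^ n) f x - (kernel_op (rsg S \<kappa> \<beta>) ^^ n) f x\<bar> \<le> real n * 0"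
    if "f \<in> ufun ?X" "x \<in> space ?X" for f x
    by (rule markov_op_funpow_close[OF markov_op_kernel_op[OF measurable_rsg] B _ that])
      (simp add: B_def kernel_op_rsg[OF simplex[OF \<beta>] _ ufun_imp_bfun])
  from osc_contraction_close[OF n this] have oscB: "osc_contraction ?X (B ^^ n) (1 / 4)" by simp
  \<comment> \<open>Chosen so that n exchanged steps cost at most 1/8; the successor avoids division
    by zero when n = 0.\<close>
  define \<eta> where "\<eta> = 1 / (8 * real (Suc n))"
  have \<eta>: "0 < \<eta>" "real n * \<eta> \<le> 1 / 8" by (auto simp: \<eta>_def field_simps)
  have "\<exists>k0. \<forall>k\<ge>k0. \<forall>g\<in>space (\<Gamma> i). \<forall>f\<in>ufun ?X. \<forall>x\<in>space ?X.
      \<bar>(coord_op i g ^^ k) f x - gibbs_op i f x\<bar> \<le> \<eta>" for i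
  proof -
    obtain s m where "0 < s" and "\<forall>z\<in>space (drop_space S i). \<forall>g\<in>space (\<Gamma> i).
      \<exists>\<nu>. prob_space \<nu> \<and> sets \<nu> = sets (S i) \<and>
        (\<forall>x\<in>space (S i). \<forall>A\<in>sets (S i). s * measure \<nu> A \<le> measure (kernel_pow (S i) (P i z g) m x) A)"
      using minor[of i] by blast
    then show ?thesis
      by (intro coord_op_close_gibbs_op[OF erg, where s=s and m=m] \<eta>(1)) auto
  qed
  then obtain k0 where k0: "\<And>i k g f x. k0 i \<le> k \<Longrightarrow> g \<in> space (\<Gamma> i) \<Longrightarrow> f \<in> ufun ?X \<Longrightarrow> x \<in> space ?X \<Longrightarrow>
      \<bar>(coord_op i g ^^ k) f x - gibbs_op i f x\<bar> \<le> \<eta>"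
    by metis
  \<comment> \<open>The sum is a convenient common upper bound for the finitely many coordinate
    thresholds.\<close>
  define k where "k = (\<Sum>i\<in>UNIV. k0 i)"
  have k: "k0 i \<le> k" for i unfolding k_def by (rule member_le_sum) auto
  define \<delta> where "\<delta> = 1 - \<epsilon> ^ (n * k) / 2"
  have \<epsilon>1: "\<epsilon> \<le> 1" using \<beta> by (force simp: sel_probs_def)
  have "0 < \<epsilon> ^ (n * k)" "\<epsilon> ^ (n * k) \<le> 1" using \<epsilon> \<epsilon>1 by (auto simp: power_le_one)
  then have \<delta>: "0 < \<delta>" "\<delta> < 1" by (auto simp: \<delta>_def)
  have "(\<lambda>j. \<delta> ^ j) \<longlonglongrightarrow> 0" using \<delta> by (intro LIMSEQ_power_zero) simp
  from order_tendstoD(2)[OF this e] obtain j where j: "\<delta> ^ j < e"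
    by (auto simp: eventually_sequentially)
  show ?thesis
  \<comment> \<open>Each of the n Gibbs steps is imitated by k repetitions of one coordinate; j such
    blocks bring the coefficient below e.\<close>
  proof (intro exI[of _ "n * k * j"] ballI)
    fix a :: "real ^ 'd" and g f x
    assume a: "a \<in> sel_probs \<epsilon>" and g: "g \<in> space (PiM UNIV \<Gamma>)" and f: "f \<in> ufun ?X" and x: "x \<in> space ?X"
    let ?T = "mwg_op (a, g)"
    have gi: "g i \<in> space (\<Gamma> i)" for i by (rule space_PiM_component[OF g])
    have T: "markov_op ?X ?T" by (rule markov_op_mwg_op[OF simplex[OF a] g])
    have le: "\<epsilon> * coord_op i (g i) f x \<le> ?T f x" if f: "f \<in> ufun ?X" and x: "x \<in> space ?X" for i f x
    proof -
      have nn: "0 \<le> coord_op i (g i) f x" for i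
        using markov_op_ufun[OF markov_op_coord_op[OF gi] f] x by (simp add: ufun_def)
      \<comment> \<open>One summand of the mixture is kept: its weight is at least \<epsilon> and
        the other summands are nonnegative.\<close>
      have "\<epsilon> * coord_op i (g i) f x \<le> a $ i * coord_op i (g i) f x"
        using a nn by (intro mult_right_mono) (auto simp: sel_probs_def)
      also have "\<dots> \<le> ?T f x"
        using simplex[OF a] nn
        by (auto simp: mwg_op_def prob_simplex_def intro!: member_le_sum[of i UNIV "\<lambda>i. a $ i * coord_op i (g i) f x"])
      finally show ?thesis .
    qed
    have "osc_contraction ?X (?T ^^ (n * k)) \<delta>" unfolding \<delta>_def
      by (rule osc_contraction_random_scan[where P="\<lambda>i. coord_op i (g i)" and G=gibbs_op and c="\<lambda>i. \<beta> $ i",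
            OF T markov_op_coord_op[OF gi] markov_op_gibbs_op \<beta>01 \<epsilon> le k0[OF k gi] oscB[unfolded B_def] \<eta>(2)])
    from osc_contraction_funpow[OF markov_op_funpow[OF T] this \<delta>(1), of j]
    have "osc_contraction ?X (?T ^^ (n * k * j)) e"
      using j by (auto simp: funpow_mult mult.commute intro: osc_contraction_weaken)
    then show "\<bar>(?T ^^ (n * k * j)) f x - (\<integral>x. f x \<partial>\<pi>)\<bar> \<le> e"
      by (intro osc_contraction_invariant[OF prob_target sets_target markov_op_funpow[OF T] _ _ f x]
          integral_funpow_invariant[OF T] mwg_op_invariant[OF erg simplex[OF a] g])
  qed
qed

end

section \<open>The adaptive sampler\<close>

text \<open>Both sets are replaced by measurable covers of the same outer measure. This
  subadditivity is what makes convergence in probability additive for non-measurable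
  suprema.\<close>

lemma outer_measure_of_Un_le:
  assumes "A \<subseteq> space M" "B \<subseteq> space M"
  shows "outer_measure_of M (A \<union> B) \<le> outer_measure_of M A + outer_measure_of M B"
proof -
  obtain A' where A': "A' \<in> sets M" "A \<subseteq> A'" "outer_measure_of M A = emeasure M A'"
    using outer_measure_of_attain[OF assms(1)] by blast
  obtain B' where B': "B' \<in> sets M" "B \<subseteq> B'" "outer_measure_of M B = emeasure M B'"
    using outer_measure_of_attain[OF assms(2)] by blast
  have "outer_measure_of M (A \<union> B) \<le> outer_measure_of M (A' \<union> B')"
    using A' B' by (intro outer_measure_of_mono) auto
  also have "\<dots> \<le> emeasure M A' + emeasure M B'"
    using A' B' by (simp add: emeasure_subadditive)
  finally show ?thesis using A' B' by simp
qed

lemma tends_to_0_in_prob_add: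
  assumes "tends_to_0_in_prob M f" "tends_to_0_in_prob M g"
  shows "tends_to_0_in_prob M (\<lambda>n \<omega>. f n \<omega> + g n \<omega>)"
  unfolding tends_to_0_in_prob_def
proof (intro allI impI)
  fix e :: real assume "e > 0"
  then have e: "e / 2 > 0" by simp
  have "(\<lambda>n. outer_measure_of M {\<omega> \<in> space M. e / 2 < \<bar>f n \<omega>\<bar>}) \<longlonglongrightarrow> 0"
    using assms(1) e unfolding tends_to_0_in_prob_def by blast
  moreover have "(\<lambda>n. outer_measure_of M {\<omega> \<in> space M. e / 2 < \<bar>g n \<omega>\<bar>}) \<longlonglongrightarrow> 0"
    using assms(2) e unfolding tends_to_0_in_prob_def by blast
  ultimately have lim: "(\<lambda>n. outer_measure_of M {\<omega> \<in> space M. e / 2 < \<bar>f n \<omega>\<bar>} +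
      outer_measure_of M {\<omega> \<in> space M. e / 2 < \<bar>g n \<omega>\<bar>}) \<longlonglongrightarrow> 0"
    by (rule tendsto_add[where a=0 and b=0, simplified])
  have "outer_measure_of M {\<omega> \<in> space M. e < \<bar>f n \<omega> + g n \<omega>\<bar>} \<le>
      outer_measure_of M {\<omega> \<in> space M. e / 2 < \<bar>f n \<omega>\<bar>} + outer_measure_of M {\<omega> \<in> space M. e / 2 < \<bar>g n \<omega>\<bar>}" for n
  proof -
    have "{\<omega> \<in> space M. e < \<bar>f n \<omega> + g n \<omega>\<bar>} \<subseteq>
        {\<omega> \<in> space M. e / 2 < \<bar>f n \<omega>\<bar>} \<union> {\<omega> \<in> space M. e / 2 < \<bar>g n \<omega>\<bar>}"
    proof (rule subsetI, rule ccontr)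
      fix \<omega> assume "\<omega> \<in> {\<omega> \<in> space M. e < \<bar>f n \<omega> + g n \<omega>\<bar>}"
        and "\<omega> \<notin> {\<omega> \<in> space M. e / 2 < \<bar>f n \<omega>\<bar>} \<union> {\<omega> \<in> space M. e / 2 < \<bar>g n \<omega>\<bar>}"
      then have "e < \<bar>f n \<omega> + g n \<omega>\<bar>" "\<bar>f n \<omega>\<bar> \<le> e / 2" "\<bar>g n \<omega>\<bar> \<le> e / 2" by auto
      then show False by linarith
    qed
    then show ?thesis
      by (rule order_trans[OF outer_measure_of_mono outer_measure_of_Un_le]) auto
  qed
  then show "(\<lambda>n. outer_measure_of M {\<omega> \<in> space M. e < \<bar>f n \<omega> + g n \<omega>\<bar>}) \<longlonglongrightarrow> 0"
    by (intro tendsto_sandwich[OF _ _ tendsto_const lim]) auto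
qed

lemma tends_to_0_in_prob_cmult:
  assumes "tends_to_0_in_prob M f" "0 < c"
  shows "tends_to_0_in_prob M (\<lambda>n \<omega>. c * f n \<omega>)"
  unfolding tends_to_0_in_prob_def
proof (intro allI impI)
  fix e :: real assume "e > 0"
  then have "(\<lambda>n. outer_measure_of M {\<omega> \<in> space M. e / c < \<bar>f n \<omega>\<bar>}) \<longlonglongrightarrow> 0"
    using assms by (simp add: tends_to_0_in_prob_def)
  moreover have "e / c < \<bar>f n \<omega>\<bar> \<longleftrightarrow> e < \<bar>c * f n \<omega>\<bar>" for n \<omega>
    using assms(2) by (simp add: abs_mult field_simps)
  ultimately show "(\<lambda>n. outer_measure_of M {\<omega> \<in> space M. e < \<bar>c * f n \<omega>\<bar>}) \<longlonglongrightarrow> 0"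
    by simp
qed

lemma tends_to_0_in_prob_sum:
  assumes "finite I" "\<And>i. i \<in> I \<Longrightarrow> tends_to_0_in_prob M (f i)"
  shows "tends_to_0_in_prob M (\<lambda>n \<omega>. \<Sum>i\<in>I. f i n \<omega>)"
  using assms
proof (induction I)
  case empty
  have "outer_measure_of M {} = 0" by simp
  then show ?case by (simp add: tends_to_0_in_prob_def)
qed (simp add: tends_to_0_in_prob_add)

lemma tends_to_0_in_prob_shift:
  assumes "tends_to_0_in_prob M f"
  shows "tends_to_0_in_prob M (\<lambda>n. f (n + k))"
  unfolding tends_to_0_in_prob_def
proof (intro allI impI)
  fix e :: real assume "e > 0"
  with assms have "(\<lambda>n. outer_measure_of M {\<omega> \<in> space M. e < \<bar>f n \<omega>\<bar>}) \<longlonglongrightarrow> 0"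
    by (simp add: tends_to_0_in_prob_def)
  then show "(\<lambda>n. outer_measure_of M {\<omega> \<in> space M. e < \<bar>f (n + k) \<omega>\<bar>}) \<longlonglongrightarrow> 0"
    by (rule LIMSEQ_ignore_initial_segment)
qed

text \<open>W may be non-measurable, but the event |u| > e is measurable and contained in |W| > e,
  so its probability is at most \<delta>. On it |u| is at most 1, off it at most e.\<close>

lemma (in prob_space) abs_expectation_le_outer_measure:
  assumes u: "u \<in> borel_measurable M" and u1: "\<And>\<omega>. \<omega> \<in> space M \<Longrightarrow> \<bar>u \<omega>\<bar> \<le> 1"
    and W: "\<And>\<omega>. \<omega> \<in> space M \<Longrightarrow> \<bar>u \<omega>\<bar> \<le> W \<omega>"
    and out: "outer_measure_of M {\<omega> \<in> space M. e < \<bar>W \<omega>\<bar>} \<le> ennreal \<delta>" and e: "0 \<le> e" "0 \<le> \<delta>"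
  shows "\<bar>expectation u\<bar> \<le> e + \<delta>"
proof -
  define B where "B = {\<omega> \<in> space M. e < \<bar>u \<omega>\<bar>}"
  have B: "B \<in> sets M" unfolding B_def using u by measurable
  have "emeasure M B = outer_measure_of M B" using B by simp
  also have "\<dots> \<le> outer_measure_of M {\<omega> \<in> space M. e < \<bar>W \<omega>\<bar>}"
  proof (intro outer_measure_of_mono subsetI)
    fix \<omega> assume "\<omega> \<in> B"
    then show "\<omega> \<in> {\<omega> \<in> space M. e < \<bar>W \<omega>\<bar>}" using W[of \<omega>] by (simp add: B_def)
  qed
  finally have "emeasure M B \<le> ennreal \<delta>" using out by simp
  then have pB: "prob B \<le> \<delta>" using e by (simp add: emeasure_eq_measure)
  have iu: "integrable M u" using u u1 by (intro integrable_const_bound[where B=1] AE_I2) auto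
  have iB': "integrable M (indicator B :: _ \<Rightarrow> real)"
    by (rule integrable_real_indicator[OF B]) (simp add: emeasure_eq_measure)
  have iB: "integrable M (\<lambda>\<omega>. e + indicator B \<omega>)"
    by (rule Bochner_Integration.integrable_add[OF integrable_const iB'])
  have "\<bar>expectation u\<bar> \<le> expectation (\<lambda>\<omega>. \<bar>u \<omega>\<bar>)" by (rule integral_abs_bound)
  also have "\<dots> \<le> expectation (\<lambda>\<omega>. e + indicator B \<omega>)"
  proof (intro integral_mono integrable_abs iu iB)
    fix \<omega> assume "\<omega> \<in> space M"
    then show "\<bar>u \<omega>\<bar> \<le> e + indicator B \<omega>" using u1[of \<omega>] e by (simp add: B_def indicator_def)
  qed
  also have "\<dots> = expectation (\<lambda>_. e) + expectation (indicator B)"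
    by (rule Bochner_Integration.integral_add[OF integrable_const iB'])
  also have "\<dots> = e + prob B" by (simp add: prob_space sets.Int_space_eq2[OF B])
  finally show ?thesis using pB by linarith
qed

section \<open>Perturbation of the sampler and comparison with frozen parameters\<close>

context mwg_setting
begin

text \<open>A real supremum dominates its members only if the family is bounded, here by 1; for the
  second bound x witnesses that the family is nonempty.\<close>

lemma kernel_change_bound:
  assumes g: "g \<in> space (PiM UNIV \<Gamma>)" "g' \<in> space (PiM UNIV \<Gamma>)" and x: "x \<in> space (state_space S)"
  shows "tv_dist (P i (drop_coord i x) (g' i) (x i)) (P i (drop_coord i x) (g i) (x i)) \<le> kernel_change S P i g' g"
    and "kernel_change S P i g' g \<le> 1"
proof -
  have p: "prob_space (P i (drop_coord i y) (h i) (y i))"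
    if "h \<in> space (PiM UNIV \<Gamma>)" "y \<in> space (state_space S)" for h y
    using metropolis_in_prob_algebra[OF drop_coord_space[OF that(2)] space_PiM_component[OF that(1)]
        space_PiM_component[OF that(2)]]
    by (simp add: space_prob_algebra)
  have le1: "tv_dist (P i (drop_coord i y) (g' i) (y i)) (P i (drop_coord i y) (g i) (y i)) \<le> 1"
    if "y \<in> space (state_space S)" for y
    by (rule tv_dist_le_1[OF p[OF g(2) that] p[OF g(1) that]])
  show "tv_dist (P i (drop_coord i x) (g' i) (x i)) (P i (drop_coord i x) (g i) (x i)) \<le> kernel_change S P i g' g"
    unfolding kernel_change_def using le1 by (intro cSUP_upper[OF x] bdd_aboveI2[where M=1])
  show "kernel_change S P i g' g \<le> 1"
    unfolding kernel_change_def using x le1 by (intro cSUP_least) blast+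
qed

text \<open>Each summand is split as (a' - a) c' + a (c' - c). A coordinate of a' - a is at most its
  norm, which over all coordinates gives the factor \<open>CARD('d)\<close>; weights and values lie
  in [0,1].\<close>

lemma mwg_op_diff_le:
  assumes a: "a \<in> prob_simplex" "a' \<in> prob_simplex"
    and g: "g \<in> space (PiM UNIV \<Gamma>)" "g' \<in> space (PiM UNIV \<Gamma>)"
    and f: "f \<in> ufun (state_space S)" and x: "x \<in> space (state_space S)"
  shows "\<bar>mwg_op (a', g') f x - mwg_op (a, g) f x\<bar> \<le>
    real CARD('d) * norm (a' - a) + (\<Sum>i\<in>UNIV. kernel_change S P i g' g)"
proof -
  define c where "c h i = coord_op i (h i) f x" for h i
  have c01: "0 \<le> c h i \<and> c h i \<le> 1" if "h \<in> space (PiM UNIV \<Gamma>)" for h i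
    using markov_op_ufun[OF markov_op_coord_op[OF space_PiM_component[OF that]] f] x
    by (simp add: ufun_def c_def)
  have cd: "\<bar>c g' i - c g i\<bar> \<le> kernel_change S P i g' g" for i
  proof -
    have V: "prob_space (P i (drop_coord i x) (h i) (x i))" "sets (P i (drop_coord i x) (h i) (x i)) = sets (S i)"
      if "h \<in> space (PiM UNIV \<Gamma>)" for h
      using metropolis_in_prob_algebra[OF drop_coord_space[OF x] space_PiM_component[OF that] space_PiM_component[OF x]]
      by (simp_all add: space_prob_algebra)
    have "\<bar>c g' i - c g i\<bar> \<le> tv_dist (P i (drop_coord i x) (g' i) (x i)) (P i (drop_coord i x) (g i) (x i))"
      unfolding c_def coord_op_def
      by (rule integral_diff_le_tv_dist[OF V(1)[OF g(2)] V(1)[OF g(1)] V(2)[OF g(2)] V(2)[OF g(1)]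
            ufun_fun_upd[OF f x]]) simp
    also have "\<dots> \<le> kernel_change S P i g' g" by (rule kernel_change_bound(1)[OF g x])
    finally show ?thesis .
  qed
  have a01: "0 \<le> a $ i \<and> a $ i \<le> 1" for i
    using a(1) member_le_sum[of i UNIV "\<lambda>i. a $ i"] by (auto simp: prob_simplex_def)
  have "\<bar>a' $ i * c g' i - a $ i * c g i\<bar> \<le> norm (a' - a) + kernel_change S P i g' g" for i
  proof -
    have "a' $ i * c g' i - a $ i * c g i = (a' - a) $ i * c g' i + a $ i * (c g' i - c g i)"
      by (simp add: algebra_simps)
    moreover have "\<bar>(a' - a) $ i * c g' i\<bar> \<le> norm (a' - a) * 1"
      unfolding abs_mult using c01[OF g(2), of i] component_le_norm_cart[of "a' - a" i]
      by (intro mult_mono) auto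
    moreover have "\<bar>a $ i * (c g' i - c g i)\<bar> \<le> 1 * kernel_change S P i g' g"
      unfolding abs_mult using a01[of i] cd[of i] by (intro mult_mono) auto
    ultimately show ?thesis by linarith
  qed
  then have "(\<Sum>i\<in>UNIV. \<bar>a' $ i * c g' i - a $ i * c g i\<bar>) \<le>
      (\<Sum>i\<in>UNIV. norm (a' - a) + kernel_change S P i g' g)"
    by (intro sum_mono)
  moreover have "mwg_op (a', g') f x - mwg_op (a, g) f x = (\<Sum>i\<in>UNIV. a' $ i * c g' i - a $ i * c g i)"
    by (simp add: mwg_op_def c_def sum_subtractf)
  ultimately show ?thesis
    by (simp add: sum.distrib) (rule order_trans[OF sum_abs])
qed

lemma
  assumes ad: "adap_rs_adap_mwg S \<Gamma> P \<epsilon> R L \<gamma>0 x0 \<alpha>0 \<Omega> X \<alpha> \<gamma>"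
  shows adap_prob_space: "prob_space \<Omega>"
    and adap_state: "X n \<in> \<Omega> \<rightarrow>\<^sub>M state_space S"
    and adap_param: "(\<lambda>\<omega>. (\<alpha> n \<omega>, \<gamma> n \<omega>)) \<in> \<Omega> \<rightarrow>\<^sub>M param_space \<epsilon>"
    and adap_sel_probs: "\<omega> \<in> space \<Omega> \<Longrightarrow> \<alpha> n \<omega> \<in> sel_probs \<epsilon>"
    and adap_prop_param: "\<omega> \<in> space \<Omega> \<Longrightarrow> \<gamma> n \<omega> \<in> space (PiM UNIV \<Gamma>)"
proof -
  have a: "\<alpha> n \<in> \<Omega> \<rightarrow>\<^sub>M sel_space \<epsilon>" and g: "\<gamma> n \<in> \<Omega> \<rightarrow>\<^sub>M PiM UNIV \<Gamma>"
    using ad by (auto simp: adap_rs_adap_mwg_def)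
  show "prob_space \<Omega>" "X n \<in> \<Omega> \<rightarrow>\<^sub>M state_space S"
    using ad by (auto simp: adap_rs_adap_mwg_def)
  show "(\<lambda>\<omega>. (\<alpha> n \<omega>, \<gamma> n \<omega>)) \<in> \<Omega> \<rightarrow>\<^sub>M param_space \<epsilon>" by (rule measurable_Pair[OF a g])
  show "\<alpha> n \<omega> \<in> sel_probs \<epsilon>" if "\<omega> \<in> space \<Omega>"
    using measurable_space[OF a that] by (simp add: space_restrict_space)
  show "\<gamma> n \<omega> \<in> space (PiM UNIV \<Gamma>)" if "\<omega> \<in> space \<Omega>" by (rule measurable_space[OF g that])
qed

lemma adap_step:
  assumes ad: "adap_rs_adap_mwg S \<Gamma> P \<epsilon> R L \<gamma>0 x0 \<alpha>0 \<Omega> X \<alpha> \<gamma>"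
    and h: "(\<lambda>(\<theta>, x). h \<theta> x) \<in> bfun (param_space \<epsilon> \<Otimes>\<^sub>M state_space S)" and nm: "n \<le> m"
  shows "(\<integral>\<omega>. h (\<alpha> n \<omega>, \<gamma> n \<omega>) (X (Suc m) \<omega>) \<partial>\<Omega>) =
      (\<integral>\<omega>. mwg_op (\<alpha> (Suc m) \<omega>, \<gamma> (Suc m) \<omega>) (h (\<alpha> n \<omega>, \<gamma> n \<omega>)) (X m \<omega>) \<partial>\<Omega>)"
    and "(\<lambda>\<omega>. mwg_op (\<alpha> (Suc m) \<omega>, \<gamma> (Suc m) \<omega>) (h (\<alpha> n \<omega>, \<gamma> n \<omega>)) (X m \<omega>)) \<in> bfun \<Omega>"
proof -
  let ?step = "state_space S \<Otimes>\<^sub>M sel_space \<epsilon> \<Otimes>\<^sub>M PiM UNIV \<Gamma>"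
  let ?G = "traj_space S \<Gamma> \<epsilon> m \<Otimes>\<^sub>M sel_space \<epsilon> \<Otimes>\<^sub>M PiM UNIV \<Gamma>"
  define U where "U = (\<lambda>\<omega>. (traj X \<alpha> \<gamma> m \<omega>, \<alpha> (Suc m) \<omega>, \<gamma> (Suc m) \<omega>))"
  let ?F = "vimage_algebra (space \<Omega>) U ?G"
  define Z where "Z = (\<lambda>\<omega>. (\<alpha> n \<omega>, \<gamma> n \<omega>))"
  define K where "K = (\<lambda>\<omega>. mwg S P (\<alpha> (Suc m) \<omega>) (\<gamma> (Suc m) \<omega>) (X m \<omega>))"
  have meas: "X k \<in> \<Omega> \<rightarrow>\<^sub>M state_space S" "\<alpha> k \<in> \<Omega> \<rightarrow>\<^sub>M sel_space \<epsilon>" "\<gamma> k \<in> \<Omega> \<rightarrow>\<^sub>M PiM UNIV \<Gamma>" for k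
    using ad by (auto simp: adap_rs_adap_mwg_def)
  have cd: "is_cond_distr \<Omega> ?F (X (Suc m)) (state_space S) K"
    using ad by (auto simp: adap_rs_adap_mwg_def U_def K_def)
  have "traj X \<alpha> \<gamma> m \<in> \<Omega> \<rightarrow>\<^sub>M traj_space S \<Gamma> \<epsilon> m"
    unfolding traj_def traj_space_def by (intro measurable_restrict measurable_Pair meas)
  then have U: "U \<in> \<Omega> \<rightarrow>\<^sub>M ?G"
    unfolding U_def by (intro measurable_Pair meas)
  have F: "subalgebra \<Omega> ?F" by (rule subalgebra_vimage_algebra[OF U])
  have UF: "U \<in> ?F \<rightarrow>\<^sub>M ?G"
    using measurable_space[OF U] by (intro measurable_vimage_algebra1) auto
  have "(\<lambda>w. w n) \<in> traj_space S \<Gamma> \<epsilon> m \<rightarrow>\<^sub>M ?step"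
    unfolding traj_space_def using nm by (intro measurable_component_singleton) simp
  from measurable_compose[OF measurable_compose[OF measurable_fst this] measurable_snd]
  have "(\<lambda>w. snd (fst w n)) \<in> ?G \<rightarrow>\<^sub>M param_space \<epsilon>" .
  from measurable_compose[OF UF this]
  have Z: "Z \<in> ?F \<rightarrow>\<^sub>M param_space \<epsilon>" using nm by (simp add: U_def Z_def traj_def)
  have K_eq: "kernel_op K (h (Z \<omega>)) \<omega> = mwg_op (\<alpha> (Suc m) \<omega>, \<gamma> (Suc m) \<omega>) (h (\<alpha> n \<omega>, \<gamma> n \<omega>)) (X m \<omega>)"
    if w: "\<omega> \<in> space \<Omega>" for \<omega>
  proof -
    have "Z \<omega> \<in> space (param_space \<epsilon>)"
      using measurable_space[OF adap_param[OF ad] w] by (simp add: Z_def)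
    then have "h (Z \<omega>) \<in> bfun (state_space S)"
      using h measurable_Pair2[of "\<lambda>(\<theta>, x). h \<theta> x" "param_space \<epsilon>" "state_space S" borel "Z \<omega>"]
      by (fastforce simp: bfun_def space_pair_measure)
    moreover have "\<alpha> (Suc m) \<omega> \<in> prob_simplex" using adap_sel_probs[OF ad w] by (simp add: sel_probs_def)
    ultimately have "kernel_op (mwg S P (\<alpha> (Suc m) \<omega>) (\<gamma> (Suc m) \<omega>)) (h (Z \<omega>)) (X m \<omega>) =
        mwg_op (\<alpha> (Suc m) \<omega>, \<gamma> (Suc m) \<omega>) (h (Z \<omega>)) (X m \<omega>)"
      using adap_prop_param[OF ad w] measurable_space[OF meas(1) w] by (intro kernel_op_mwg)
    then show ?thesis by (simp add: kernel_op_def K_def Z_def)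
  qed
  show "(\<integral>\<omega>. h (\<alpha> n \<omega>, \<gamma> n \<omega>) (X (Suc m) \<omega>) \<partial>\<Omega>) =
      (\<integral>\<omega>. mwg_op (\<alpha> (Suc m) \<omega>, \<gamma> (Suc m) \<omega>) (h (\<alpha> n \<omega>, \<gamma> n \<omega>)) (X m \<omega>) \<partial>\<Omega>)"
    using integral_cond_distr[OF adap_prob_space[OF ad] cd F meas(1) Z h] K_eq
    by (simp add: Z_def cong: Bochner_Integration.integral_cong)
  have K: "K \<in> \<Omega> \<rightarrow>\<^sub>M prob_algebra (state_space S)"
    using cd measurable_from_subalg[OF F] by (auto simp: is_cond_distr_def)
  obtain B where B: "(\<lambda>(\<theta>, x). h \<theta> x) \<in> borel_measurable (param_space \<epsilon> \<Otimes>\<^sub>M state_space S)"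
    "\<And>w. w \<in> space (param_space \<epsilon> \<Otimes>\<^sub>M state_space S) \<Longrightarrow> \<bar>(\<lambda>(\<theta>, x). h \<theta> x) w\<bar> \<le> B"
    using h by (rule bfunE) blast
  have Zx: "(\<lambda>w. (Z (fst w), snd w)) \<in> \<Omega> \<Otimes>\<^sub>M state_space S \<rightarrow>\<^sub>M param_space \<epsilon> \<Otimes>\<^sub>M state_space S"
    by (intro measurable_Pair measurable_snd measurable_compose[OF measurable_fst]
        measurable_from_subalg[OF F Z])
  have "(\<lambda>w. (\<lambda>(\<theta>, x). h \<theta> x) (Z (fst w), snd w)) \<in> bfun (\<Omega> \<Otimes>\<^sub>M state_space S)"
    by (rule bfunI[OF measurable_compose[OF Zx B(1)], where B=B]) (rule B(2)[OF measurable_space[OF Zx]])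
  then have "(\<lambda>(\<omega>, x). h (Z \<omega>) x) \<in> bfun (\<Omega> \<Otimes>\<^sub>M state_space S)"
    by (simp add: case_prod_unfold)
  from kernel_op_bfun_param[OF K this]
  show "(\<lambda>\<omega>. mwg_op (\<alpha> (Suc m) \<omega>, \<gamma> (Suc m) \<omega>) (h (\<alpha> n \<omega>, \<gamma> n \<omega>)) (X m \<omega>)) \<in> bfun \<Omega>"
    by (rule bfun_cong) (simp add: K_eq)
qed

lemma mwg_op_funpow_bfun_param:
  assumes "f \<in> ufun (state_space S)"
  shows "(\<lambda>(\<theta>, x). (mwg_op \<theta> ^^ k) f x) \<in> bfun (param_space \<epsilon> \<Otimes>\<^sub>M state_space S)"
proof (induction k)
  case 0
  then show ?case
    using assms by (auto simp: ufun_def space_pair_measure intro!: bfunI[where B=1])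
next
  case (Suc k)
  from mwg_op_bfun_param[OF this] show ?case by simp
qed

text \<open>With \<open>g j = T\<^bsub>\<theta>\<^sub>n\<^esub>\<^bsup>N-j\<^esup> f (X (n + j))\<close> the parameters frozen at time \<open>n\<close>, the expectation of
  \<open>g 0\<close> is close to the target, \<open>g N = f (X (n + N))\<close>, and one step of the sampler changes
  the expectation only by the change of the kernel since time \<open>n\<close>.\<close>

lemma adap_tv_dist_le:
  assumes ad: "adap_rs_adap_mwg S \<Gamma> P \<epsilon> R L \<gamma>0 x0 \<alpha>0 \<Omega> X \<alpha> \<gamma>"
    and W: "\<And>\<omega> j f x. \<omega> \<in> space \<Omega> \<Longrightarrow> j \<le> N \<Longrightarrow> f \<in> ufun (state_space S) \<Longrightarrow> x \<in> space (state_space S) \<Longrightarrow>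
      \<bar>mwg_op (\<alpha> (n + j) \<omega>, \<gamma> (n + j) \<omega>) f x - mwg_op (\<alpha> n \<omega>, \<gamma> n \<omega>) f x\<bar> \<le> W \<omega>"
    and out: "outer_measure_of \<Omega> {\<omega> \<in> space \<Omega>. e < \<bar>W \<omega>\<bar>} \<le> ennreal \<delta>" and e: "0 \<le> e" "0 \<le> \<delta>"
    and rate: "\<And>a g f x. a \<in> sel_probs \<epsilon> \<Longrightarrow> g \<in> space (PiM UNIV \<Gamma>) \<Longrightarrow> f \<in> ufun (state_space S) \<Longrightarrow>
      x \<in> space (state_space S) \<Longrightarrow> \<bar>(mwg_op (a, g) ^^ N) f x - (\<integral>x. f x \<partial>\<pi>)\<bar> \<le> r"
  shows "tv_dist (distr \<Omega> (state_space S) (X (n + N))) \<pi> \<le> r + real N * (e + \<delta>)"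
proof (rule tv_dist_le)
  let ?X = "state_space S"
  interpret prob_space \<Omega> by (rule adap_prob_space[OF ad])
  fix A assume "A \<in> sets (distr \<Omega> ?X (X (n + N)))"
  then have A: "A \<in> sets ?X" by simp
  define f :: "_ \<Rightarrow> real" where "f = indicator A"
  have f: "f \<in> ufun ?X" unfolding f_def by (rule ufun_indicator[OF A])
  define \<theta> where "\<theta> k \<omega> = (\<alpha> k \<omega>, \<gamma> k \<omega>)" for k \<omega>
  have \<theta>: "\<theta> k \<in> \<Omega> \<rightarrow>\<^sub>M param_space \<epsilon>" for k unfolding \<theta>_def by (rule adap_param[OF ad])
  have T: "markov_op ?X (mwg_op (\<theta> k \<omega>))" if "\<omega> \<in> space \<Omega>" for k \<omega>
    unfolding \<theta>_def using adap_sel_probs[OF ad that] adap_prop_param[OF ad that]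
    by (intro markov_op_mwg_op) (auto simp: sel_probs_def)
  define h where "h k \<theta> = (mwg_op \<theta> ^^ k) f" for k \<theta>
  have h: "(\<lambda>(\<theta>, x). h k \<theta> x) \<in> bfun (param_space \<epsilon> \<Otimes>\<^sub>M ?X)" for k
    unfolding h_def by (rule mwg_op_funpow_bfun_param[OF f])
  have hU: "h k (\<theta> n \<omega>) \<in> ufun ?X" if "\<omega> \<in> space \<Omega>" for k \<omega>
    unfolding h_def by (rule markov_op_ufun[OF markov_op_funpow[OF T[OF that]] f])
  have Xs: "X k \<omega> \<in> space ?X" if "\<omega> \<in> space \<Omega>" for k \<omega>
    by (rule measurable_space[OF adap_state[OF ad] that])
  define g where "g j \<omega> = h (N - j) (\<theta> n \<omega>) (X (n + j) \<omega>)" for j \<omega>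
  have gm: "g j \<in> borel_measurable \<Omega>" for j
  proof -
    have "(\<lambda>(\<theta>, x). h (N - j) \<theta> x) \<in> borel_measurable (param_space \<epsilon> \<Otimes>\<^sub>M ?X)"
      using h[of "N - j"] by (simp add: bfun_def)
    from measurable_compose[OF measurable_Pair[OF \<theta>[of n] adap_state[OF ad, of "n + j"]] this]
    show ?thesis by (simp add: g_def[abs_def])
  qed
  have g01: "0 \<le> g j \<omega> \<and> g j \<omega> \<le> 1" if "\<omega> \<in> space \<Omega>" for j \<omega>
    using hU[OF that] Xs[OF that] by (auto simp: g_def ufun_def)
  have gi: "integrable \<Omega> (g j)" for j
    using gm g01 by (intro integrable_const_bound[where B=1] AE_I2) auto
  have step: "\<bar>expectation (g (Suc j)) - expectation (g j)\<bar> \<le> e + \<delta>" if j: "j < N" for j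
  proof -
    \<comment> \<open>v and \<open>g j\<close> apply one operator to the same function at the same
      state \<open>X (n + j)\<close>: v with the current parameters, \<open>g j\<close> with those
      of time n. Their difference is thus pure adaptation error.\<close>
    define v where "v \<omega> = mwg_op (\<theta> (Suc (n + j)) \<omega>) (h (N - Suc j) (\<theta> n \<omega>)) (X (n + j) \<omega>)" for \<omega>
    have "expectation (g (Suc j)) = expectation v" and v: "v \<in> bfun \<Omega>"
      using adap_step[OF ad h, of n "n + j" "N - Suc j"]
      by (simp_all add: g_def[abs_def] v_def[abs_def] \<theta>_def)
    have g_eq: "g j \<omega> = mwg_op (\<theta> n \<omega>) (h (N - Suc j) (\<theta> n \<omega>)) (X (n + j) \<omega>)" for \<omega>
    proof -
      have "N - j = Suc (N - Suc j)" using j by simp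
      then show ?thesis by (simp add: g_def h_def)
    qed
    have vm: "v \<in> borel_measurable \<Omega>" using v by (simp add: bfun_def)
    have v01: "0 \<le> v \<omega> \<and> v \<omega> \<le> 1" if "\<omega> \<in> space \<Omega>" for \<omega>
      using markov_op_ufun[OF T[OF that] hU[OF that]] Xs[OF that] by (auto simp: v_def ufun_def)
    have "\<bar>expectation (\<lambda>\<omega>. v \<omega> - g j \<omega>)\<bar> \<le> e + \<delta>"
    proof (rule abs_expectation_le_outer_measure[OF _ _ _ out e])
      show "(\<lambda>\<omega>. v \<omega> - g j \<omega>) \<in> borel_measurable \<Omega>" using vm gm by simp
      fix \<omega> assume w: "\<omega> \<in> space \<Omega>"
      show "\<bar>v \<omega> - g j \<omega>\<bar> \<le> 1" using v01[OF w] g01[OF w, of j] by linarith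
      show "\<bar>v \<omega> - g j \<omega>\<bar> \<le> W \<omega>"
        using W[OF w _ hU[OF w] Xs[OF w], of "Suc j"] j by (simp add: v_def g_eq \<theta>_def)
    qed
    moreover have "integrable \<Omega> v" by (rule integrable_bfun[OF v finite_measure_axioms refl])
    ultimately show ?thesis using gi \<open>expectation (g (Suc j)) = expectation v\<close> by simp
  qed
  have tel: "\<bar>expectation (g j) - expectation (g 0)\<bar> \<le> real j * (e + \<delta>)" if "j \<le> N" for j
    using that
  proof (induction j)
    case (Suc j)
    then show ?case using step[of j] by (simp add: algebra_simps)
  qed simp
  have "\<bar>expectation (g 0) - (\<integral>x. f x \<partial>\<pi>)\<bar> \<le> r"
  proof -
    have b: "\<bar>g 0 \<omega> - (\<integral>x. f x \<partial>\<pi>)\<bar> \<le> r" if "\<omega> \<in> space \<Omega>" for \<omega>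
      unfolding g_def h_def \<theta>_def
      using rate[OF adap_sel_probs[OF ad that] adap_prop_param[OF ad that] f Xs[OF that]] by simp
    have "(\<integral>x. f x \<partial>\<pi>) - r \<le> expectation (g 0)"
      using b by (intro integral_ge_const gi AE_I2) (simp add: abs_le_iff algebra_simps)
    moreover have "expectation (g 0) \<le> (\<integral>x. f x \<partial>\<pi>) + r"
      using b by (intro integral_le_const gi AE_I2) (simp add: abs_le_iff algebra_simps)
    ultimately show ?thesis by linarith
  qed
  moreover have "measure (distr \<Omega> ?X (X (n + N))) A = expectation (g N)"
  proof -
    have "measure (distr \<Omega> ?X (X (n + N))) A = (\<integral>x. f x \<partial>distr \<Omega> ?X (X (n + N)))"
      using sets.Int_space_eq2[OF A] by (simp add: f_def)
    also have "\<dots> = expectation (\<lambda>\<omega>. f (X (n + N) \<omega>))"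
      using f by (intro integral_distr adap_state[OF ad]) (simp add: ufun_def)
    finally show ?thesis by (simp add: g_def[abs_def] h_def)
  qed
  moreover have "(\<integral>x. f x \<partial>\<pi>) = measure \<pi> A"
  proof -
    have "A \<in> sets \<pi>" using A by (simp only: sets_target)
    then show ?thesis unfolding f_def by (simp add: sets.Int_space_eq2)
  qed
  ultimately show "\<bar>measure (distr \<Omega> ?X (X (n + N))) A - measure \<pi> A\<bar> \<le> r + real N * (e + \<delta>)"
    using tel[of N] by linarith
qed

text \<open>The threshold n0 is fixed by the bounds A and C before the starting values and the
  process are chosen. With the changes of a single process as A and C this yields convergence; with
  suprema over starting values it yields uniform convergence.\<close>

lemma adap_uniform_convergence:
  fixes \<Omega> :: "'w measure"
  assumes rate: "\<forall>e>0. \<exists>N. \<forall>a\<in>sel_probs \<epsilon>. \<forall>g\<in>space (PiM UNIV \<Gamma>). \<forall>f\<in>ufun (state_space S).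
      \<forall>x\<in>space (state_space S). \<bar>(mwg_op (a, g) ^^ N) f x - (\<integral>x. f x \<partial>\<pi>)\<bar> \<le> e"
    and A: "tends_to_0_in_prob \<Omega> A" and C: "\<And>i. tends_to_0_in_prob \<Omega> (C i)" and e: "0 < e"
  shows "\<exists>n0. \<forall>n\<ge>n0. \<forall>x0 \<alpha>0 X \<alpha> \<gamma>.
    adap_rs_adap_mwg S \<Gamma> P \<epsilon> R L \<gamma>0 x0 \<alpha>0 \<Omega> X \<alpha> \<gamma> \<longrightarrow>
    (\<forall>n. \<forall>\<omega>\<in>space \<Omega>. norm (\<alpha> (Suc n) \<omega> - \<alpha> n \<omega>) \<le> A n \<omega>) \<longrightarrow>
    (\<forall>i n. \<forall>\<omega>\<in>space \<Omega>. kernel_change S P i (\<gamma> (Suc n) \<omega>) (\<gamma> n \<omega>) \<le> C i n \<omega>) \<longrightarrow>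
    tv_dist (distr \<Omega> (state_space S) (X n)) \<pi> \<le> e"
proof -
  have "0 < e / 2" using e by simp
  from rate this obtain N where N: "\<And>a g f x. a \<in> sel_probs \<epsilon> \<Longrightarrow> g \<in> space (PiM UNIV \<Gamma>) \<Longrightarrow>
      f \<in> ufun (state_space S) \<Longrightarrow> x \<in> space (state_space S) \<Longrightarrow>
      \<bar>(mwg_op (a, g) ^^ N) f x - (\<integral>x. f x \<partial>\<pi>)\<bar> \<le> e / 2"
    by blast
  \<comment> \<open>\<delta> serves both as deviation level and as probability level, so each of the
    N steps costs 2 \<delta>, and together they cost at most e / 2.\<close>
  define \<delta> where "\<delta> = e / (4 * real (Suc N))"
  have \<delta>: "0 < \<delta>" using e by (simp add: \<delta>_def)
  have "real N * (\<delta> + \<delta>) \<le> real (Suc N) * (\<delta> + \<delta>)" using \<delta> by (intro mult_right_mono) auto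
  moreover have "\<delta> * real (Suc N) = e / 4" by (simp add: \<delta>_def del: of_nat_Suc)
  ultimately have \<delta>_le: "e / 2 + real N * (\<delta> + \<delta>) \<le> e" by (simp add: algebra_simps)
  define D where "D n \<omega> = real CARD('d) * A n \<omega> + (\<Sum>i\<in>UNIV. C i n \<omega>)" for n \<omega>
  define W where "W n \<omega> = (\<Sum>l<N. \<bar>D (n + l) \<omega>\<bar>)" for n \<omega>
  have "tends_to_0_in_prob \<Omega> D" unfolding D_def[abs_def]
    by (intro tends_to_0_in_prob_add tends_to_0_in_prob_cmult tends_to_0_in_prob_sum A C) auto
  then have "tends_to_0_in_prob \<Omega> (\<lambda>n \<omega>. \<bar>D (n + l) \<omega>\<bar>)" for l
    using tends_to_0_in_prob_shift[of \<Omega> D l] by (simp add: tends_to_0_in_prob_def)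
  then have "tends_to_0_in_prob \<Omega> W" unfolding W_def[abs_def]
    by (intro tends_to_0_in_prob_sum) auto
  then have "(\<lambda>n. outer_measure_of \<Omega> {\<omega> \<in> space \<Omega>. \<delta> < \<bar>W n \<omega>\<bar>}) \<longlonglongrightarrow> 0"
    using \<delta> by (simp add: tends_to_0_in_prob_def)
  from order_tendstoD(2)[OF this, of "ennreal \<delta>"] \<delta>
  obtain n1 where n1: "\<And>n. n \<ge> n1 \<Longrightarrow> outer_measure_of \<Omega> {\<omega> \<in> space \<Omega>. \<delta> < \<bar>W n \<omega>\<bar>} \<le> ennreal \<delta>"
    by (auto simp: eventually_sequentially dest: less_imp_le)
  show ?thesis
  \<comment> \<open>For the law at time n the parameters are frozen at n - N, and this time must
    already be at least n1.\<close>
  proof (intro exI[of _ "n1 + N"] allI impI)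
    fix n x0 \<alpha>0 X \<alpha> \<gamma>
    assume n: "n1 + N \<le> n"
      and ad: "adap_rs_adap_mwg S \<Gamma> P \<epsilon> R L \<gamma>0 x0 \<alpha>0 \<Omega> X \<alpha> \<gamma>"
      and Ab: "\<forall>n. \<forall>\<omega>\<in>space \<Omega>. norm (\<alpha> (Suc n) \<omega> - \<alpha> n \<omega>) \<le> A n \<omega>"
      and Cb: "\<forall>i n. \<forall>\<omega>\<in>space \<Omega>. kernel_change S P i (\<gamma> (Suc n) \<omega>) (\<gamma> n \<omega>) \<le> C i n \<omega>"
    define m where "m = n - N"
    have m: "n = m + N" "n1 \<le> m" using n by (auto simp: m_def)
    have simplex: "\<alpha> k \<omega> \<in> prob_simplex" if "\<omega> \<in> space \<Omega>" for k \<omega>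
      using adap_sel_probs[OF ad that] by (simp add: sel_probs_def)
    have diff1: "\<bar>mwg_op (\<alpha> (Suc k) \<omega>, \<gamma> (Suc k) \<omega>) f x - mwg_op (\<alpha> k \<omega>, \<gamma> k \<omega>) f x\<bar> \<le> \<bar>D k \<omega>\<bar>"
      if w: "\<omega> \<in> space \<Omega>" and f: "f \<in> ufun (state_space S)" and x: "x \<in> space (state_space S)" for k \<omega> f x
    proof -
      have "\<bar>mwg_op (\<alpha> (Suc k) \<omega>, \<gamma> (Suc k) \<omega>) f x - mwg_op (\<alpha> k \<omega>, \<gamma> k \<omega>) f x\<bar> \<le>
          real CARD('d) * norm (\<alpha> (Suc k) \<omega> - \<alpha> k \<omega>) + (\<Sum>i\<in>UNIV. kernel_change S P i (\<gamma> (Suc k) \<omega>) (\<gamma> k \<omega>))"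
        by (rule mwg_op_diff_le[OF simplex[OF w] simplex[OF w] adap_prop_param[OF ad w] adap_prop_param[OF ad w] f x])
      also have "\<dots> \<le> D k \<omega>"
        unfolding D_def using Ab Cb w by (intro add_mono mult_left_mono sum_mono) auto
      finally show ?thesis by simp
    qed
    have "\<bar>mwg_op (\<alpha> (m + j) \<omega>, \<gamma> (m + j) \<omega>) f x - mwg_op (\<alpha> m \<omega>, \<gamma> m \<omega>) f x\<bar> \<le> (\<Sum>l<j. \<bar>D (m + l) \<omega>\<bar>)"
      if w: "\<omega> \<in> space \<Omega>" and f: "f \<in> ufun (state_space S)" and x: "x \<in> space (state_space S)" for j \<omega> f x
    proof (induction j)
      case (Suc j)
      then show ?case using diff1[OF w f x, of "m + j"] by simp
    qed simp
    moreover have "(\<Sum>l<j. \<bar>D (m + l) \<omega>\<bar>) \<le> W m \<omega>" if "j \<le> N" for j \<omega>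
      unfolding W_def using that by (intro sum_mono2) auto
    ultimately have W: "\<bar>mwg_op (\<alpha> (m + j) \<omega>, \<gamma> (m + j) \<omega>) f x - mwg_op (\<alpha> m \<omega>, \<gamma> m \<omega>) f x\<bar> \<le> W m \<omega>"
      if "\<omega> \<in> space \<Omega>" "j \<le> N" "f \<in> ufun (state_space S)" "x \<in> space (state_space S)" for j \<omega> f x
      using that by (meson order_trans)
    have "tv_dist (distr \<Omega> (state_space S) (X (m + N))) \<pi> \<le> e / 2 + real N * (\<delta> + \<delta>)"
      using \<delta> by (intro adap_tv_dist_le[OF ad W n1[OF m(2)] _ _ N]) auto
    then show "tv_dist (distr \<Omega> (state_space S) (X n)) \<pi> \<le> e"
      using \<delta>_le m(1) by simp
  qed
qed

end

text \<open>The Euclidean norm is at most the l1 norm, which is one on the simplex. The bound makes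
  the suprema over starting values finite.\<close>

lemma norm_sel_probs_diff_le:
  assumes "a \<in> sel_probs \<epsilon>" "b \<in> sel_probs \<epsilon>"
  shows "norm (a - b) \<le> 2"
proof -
  have *: "norm c \<le> 1" if "c \<in> sel_probs \<epsilon>" for c :: "real ^ 'd"
    using norm_le_l1_cart[of c] that by (simp add: sel_probs_def prob_simplex_def)
  show ?thesis using norm_triangle_ineq4[of a b] *[OF assms(1)] *[OF assms(2)] by linarith
qed

theorem theorem6p2:
  fixes S :: "'d::finite \<Rightarrow> 'a measure"
    and \<Gamma> :: "'d \<Rightarrow> 'g measure"
    and \<pi> :: "('d \<Rightarrow> 'a) measure"
    and \<kappa> :: "'d \<Rightarrow> ('d \<Rightarrow> 'a) \<Rightarrow> 'a measure"
    and p :: "'d \<Rightarrow> ('d \<Rightarrow> 'a) \<Rightarrow> 'a \<Rightarrow> real"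
    and Q :: "'d \<Rightarrow> ('d \<Rightarrow> 'a) \<Rightarrow> 'g \<Rightarrow> 'a \<Rightarrow> 'a measure"
    and q :: "'d \<Rightarrow> ('d \<Rightarrow> 'a) \<Rightarrow> 'g \<Rightarrow> 'a \<Rightarrow> 'a \<Rightarrow> real"
    and P :: "'d \<Rightarrow> ('d \<Rightarrow> 'a) \<Rightarrow> 'g \<Rightarrow> 'a \<Rightarrow> 'a measure"
    and \<epsilon> :: real
    and R :: "nat \<Rightarrow> (real ^ 'd) \<times> (nat \<Rightarrow> 'd \<Rightarrow> 'a) \<times> (nat \<Rightarrow> 'd \<Rightarrow> 'g) \<Rightarrow> real ^ 'd"
    and L :: "nat \<Rightarrow> (nat \<Rightarrow> ('d \<Rightarrow> 'a) \<times> (real ^ 'd) \<times> ('d \<Rightarrow> 'g)) \<Rightarrow> ('d \<Rightarrow> 'g) measure"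
    and \<gamma>0 :: "'d \<Rightarrow> 'g"
  assumes setting: "mwg_setting S \<Gamma> \<pi> \<kappa> p Q q"
    and P: "P = metropolis S p Q q"
    and eps: "0 < \<epsilon>" "\<epsilon> \<le> 1 / real CARD('d)"
    and rule: "adaptation_rule S \<Gamma> \<epsilon> R L"
    and gamma0: "\<gamma>0 \<in> space (PiM UNIV \<Gamma>)"
    and b: "\<exists>\<beta>\<in>sel_probs \<epsilon>. uniformly_ergodic (state_space S) (rsg S \<kappa> \<beta>) \<pi>"
    and c1: "\<forall>i. \<forall>z\<in>space (drop_space S i). \<forall>g\<in>space (\<Gamma> i).
               uniformly_ergodic (S i) (P i z g) (\<kappa> i z)"
    and c2: "\<forall>i. \<exists>s>0. \<exists>m. \<forall>z\<in>space (drop_space S i). \<forall>g\<in>space (\<Gamma> i).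
               \<exists>\<nu>. prob_space \<nu> \<and> sets \<nu> = sets (S i) \<and>
                 (\<forall>x\<in>space (S i). \<forall>A\<in>sets (S i).
                    s * measure \<nu> A \<le> measure (kernel_pow (S i) (P i z g) m x) A)"
  shows
    "(\<forall>x0\<in>space (state_space S). \<forall>\<alpha>0\<in>sel_probs \<epsilon>.
      \<forall>(\<Omega> :: 'w measure) X \<alpha> \<gamma>.
        adap_rs_adap_mwg S \<Gamma> P \<epsilon> R L \<gamma>0 x0 \<alpha>0 \<Omega> X \<alpha> \<gamma> \<longrightarrow>
        tends_to_0_in_prob \<Omega> (\<lambda>n \<omega>. norm (\<alpha> (Suc n) \<omega> - \<alpha> n \<omega>)) \<longrightarrow>
        (\<forall>i. tends_to_0_in_prob \<Omega> (\<lambda>n \<omega>. kernel_change S P i (\<gamma> (Suc n) \<omega>) (\<gamma> n \<omega>))) \<longrightarrow>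
        (\<lambda>n. tv_dist (distr \<Omega> (state_space S) (X n)) \<pi>) \<longlonglongrightarrow> 0)
     \<and>
     (\<forall>(\<Omega> :: 'w measure)
       (X :: ('d \<Rightarrow> 'a) \<Rightarrow> real ^ 'd \<Rightarrow> nat \<Rightarrow> 'w \<Rightarrow> 'd \<Rightarrow> 'a)
       (\<alpha> :: ('d \<Rightarrow> 'a) \<Rightarrow> real ^ 'd \<Rightarrow> nat \<Rightarrow> 'w \<Rightarrow> real ^ 'd)
       (\<gamma> :: ('d \<Rightarrow> 'a) \<Rightarrow> real ^ 'd \<Rightarrow> nat \<Rightarrow> 'w \<Rightarrow> 'd \<Rightarrow> 'g).
        (\<forall>x0\<in>space (state_space S). \<forall>\<alpha>0\<in>sel_probs \<epsilon>.
           adap_rs_adap_mwg S \<Gamma> P \<epsilon> R L \<gamma>0 x0 \<alpha>0 \<Omega> (X x0 \<alpha>0) (\<alpha> x0 \<alpha>0) (\<gamma> x0 \<alpha>0)) \<longrightarrow>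
        tends_to_0_in_prob \<Omega> (\<lambda>n \<omega>.
          SUP (x0, \<alpha>0)\<in>space (state_space S) \<times> sel_probs \<epsilon>.
            norm (\<alpha> x0 \<alpha>0 (Suc n) \<omega> - \<alpha> x0 \<alpha>0 n \<omega>)) \<longrightarrow>
        (\<forall>i. tends_to_0_in_prob \<Omega> (\<lambda>n \<omega>.
          SUP (x0, \<alpha>0)\<in>space (state_space S) \<times> sel_probs \<epsilon>.
            kernel_change S P i (\<gamma> x0 \<alpha>0 (Suc n) \<omega>) (\<gamma> x0 \<alpha>0 n \<omega>))) \<longrightarrow>
        (\<lambda>n. SUP (x0, \<alpha>0)\<in>space (state_space S) \<times> sel_probs \<epsilon>.
           tv_dist (distr \<Omega> (state_space S) (X x0 \<alpha>0 n)) \<pi>) \<longlonglongrightarrow> 0)"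
proof -
  interpret mwg_setting S \<Gamma> \<pi> \<kappa> p Q q by (rule setting)
  let ?X = "state_space S" and ?Y = "sel_probs \<epsilon> :: (real ^ 'd) set"
  obtain \<beta> where \<beta>: "\<beta> \<in> ?Y" and rsg: "uniformly_ergodic ?X (rsg S \<kappa> \<beta>) \<pi>"
    using b by blast
  have X_ne: "space ?X \<noteq> {}"
    using prob_space.not_empty[OF prob_target] sets_eq_imp_space_eq[OF sets_target] by simp
  have "\<exists>N. \<forall>a\<in>?Y. \<forall>g\<in>space (PiM UNIV \<Gamma>). \<forall>f\<in>ufun ?X. \<forall>x\<in>space ?X.
      \<bar>(mwg_op (a, g) ^^ N) f x - (\<integral>x. f x \<partial>\<pi>)\<bar> \<le> e" if "0 < e" for e
    by (rule mwg_op_funpow_close[OF eps(1) \<beta> rsg _ _ that]) (use c1 c2 in \<open>auto simp: P\<close>)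
  then have rate: "\<forall>e>0. \<exists>N. \<forall>a\<in>?Y. \<forall>g\<in>space (PiM UNIV \<Gamma>). \<forall>f\<in>ufun ?X. \<forall>x\<in>space ?X.
      \<bar>(mwg_op (a, g) ^^ N) f x - (\<integral>x. f x \<partial>\<pi>)\<bar> \<le> e" by blast
  note conv = adap_uniform_convergence[OF rate, folded P]
  note bound = kernel_change_bound(2)[folded P]
  have tv: "0 \<le> tv_dist (distr \<Omega> ?X (X n)) \<pi>" "tv_dist (distr \<Omega> ?X (X n)) \<pi> \<le> 1"
    if "adap_rs_adap_mwg S \<Gamma> P \<epsilon> R L \<gamma>0 x0 \<alpha>0 \<Omega> X \<alpha> \<gamma>" for x0 \<alpha>0 n and \<Omega> :: "'w measure" and X \<alpha> \<gamma>
  proof -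
    have "prob_space (distr \<Omega> ?X (X n))"
      using that by (intro prob_space.prob_space_distr) (auto simp: adap_rs_adap_mwg_def)
    then show "0 \<le> tv_dist (distr \<Omega> ?X (X n)) \<pi>" "tv_dist (distr \<Omega> ?X (X n)) \<pi> \<le> 1"
      using tv_dist_nonneg tv_dist_le_1 prob_target by blast+
  qed
  show ?thesis
  proof (intro conjI allI ballI impI)
    fix x0 \<alpha>0 and \<Omega> :: "'w measure" and X \<alpha> \<gamma>
    assume ad: "adap_rs_adap_mwg S \<Gamma> P \<epsilon> R L \<gamma>0 x0 \<alpha>0 \<Omega> X \<alpha> \<gamma>"
      and A: "tends_to_0_in_prob \<Omega> (\<lambda>n \<omega>. norm (\<alpha> (Suc n) \<omega> - \<alpha> n \<omega>))"
      and C: "\<forall>i. tends_to_0_in_prob \<Omega> (\<lambda>n \<omega>. kernel_change S P i (\<gamma> (Suc n) \<omega>) (\<gamma> n \<omega>))"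
    show "(\<lambda>n. tv_dist (distr \<Omega> ?X (X n)) \<pi>) \<longlonglongrightarrow> 0"
    proof (rule LIMSEQ_I)
      fix r :: real assume "0 < r"
      then have "0 < r / 2" by simp
      \<comment> \<open>For a single process its own one-step changes are the bounds, so the
        domination hypotheses hold with equality.\<close>
      from conv[where C="\<lambda>i n \<omega>. kernel_change S P i (\<gamma> (Suc n) \<omega>) (\<gamma> n \<omega>)", OF A C[rule_format] this] obtain n0
        where "\<forall>n\<ge>n0. tv_dist (distr \<Omega> ?X (X n)) \<pi> \<le> r / 2"
        using ad by (metis order_refl)
      then show "\<exists>n0. \<forall>n\<ge>n0. norm (tv_dist (distr \<Omega> ?X (X n)) \<pi> - 0) < r"
        using tv(1)[OF ad] \<open>0 < r\<close> by (intro exI[of _ n0]) force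
    qed
  next
    fix \<Omega> :: "'w measure"
      and X :: "('d \<Rightarrow> 'a) \<Rightarrow> real ^ 'd \<Rightarrow> nat \<Rightarrow> 'w \<Rightarrow> 'd \<Rightarrow> 'a"
      and \<alpha> :: "('d \<Rightarrow> 'a) \<Rightarrow> real ^ 'd \<Rightarrow> nat \<Rightarrow> 'w \<Rightarrow> real ^ 'd"
      and \<gamma> :: "('d \<Rightarrow> 'a) \<Rightarrow> real ^ 'd \<Rightarrow> nat \<Rightarrow> 'w \<Rightarrow> 'd \<Rightarrow> 'g"
    define I where "I = space ?X \<times> ?Y"
    define A where "A n \<omega> = (SUP (x0, \<alpha>0)\<in>I. norm (\<alpha> x0 \<alpha>0 (Suc n) \<omega> - \<alpha> x0 \<alpha>0 n \<omega>))" for n \<omega>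
    define C where "C i n \<omega> = (SUP (x0, \<alpha>0)\<in>I. kernel_change S P i (\<gamma> x0 \<alpha>0 (Suc n) \<omega>) (\<gamma> x0 \<alpha>0 n \<omega>))" for i n \<omega>
    assume ad': "\<forall>x0\<in>space ?X. \<forall>\<alpha>0\<in>?Y.
        adap_rs_adap_mwg S \<Gamma> P \<epsilon> R L \<gamma>0 x0 \<alpha>0 \<Omega> (X x0 \<alpha>0) (\<alpha> x0 \<alpha>0) (\<gamma> x0 \<alpha>0)"
      and A': "tends_to_0_in_prob \<Omega> (\<lambda>n \<omega>. SUP (x0, \<alpha>0)\<in>space ?X \<times> ?Y.
          norm (\<alpha> x0 \<alpha>0 (Suc n) \<omega> - \<alpha> x0 \<alpha>0 n \<omega>))"
      and C': "\<forall>i. tends_to_0_in_prob \<Omega> (\<lambda>n \<omega>. SUP (x0, \<alpha>0)\<in>space ?X \<times> ?Y.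
          kernel_change S P i (\<gamma> x0 \<alpha>0 (Suc n) \<omega>) (\<gamma> x0 \<alpha>0 n \<omega>))"
    have ad: "adap_rs_adap_mwg S \<Gamma> P \<epsilon> R L \<gamma>0 (fst w) (snd w) \<Omega>
        (X (fst w) (snd w)) (\<alpha> (fst w) (snd w)) (\<gamma> (fst w) (snd w))" if "w \<in> I" for w
      using ad' that by (auto simp: I_def)
    have A: "tends_to_0_in_prob \<Omega> A" using A' by (simp add: A_def[abs_def] I_def)
    have C: "tends_to_0_in_prob \<Omega> (C i)" for i using C' by (simp add: C_def[abs_def] I_def)
    \<comment> \<open>The supremum dominates the individual process because the family is bounded,
      by 2 here and by 1 for the kernel changes below.\<close>
    have Ab: "norm (\<alpha> (fst w) (snd w) (Suc n) \<omega> - \<alpha> (fst w) (snd w) n \<omega>) \<le> A n \<omega>"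
      if w: "w \<in> I" and \<omega>: "\<omega> \<in> space \<Omega>" for w n \<omega>
      unfolding A_def case_prod_unfold
      by (rule cSUP_upper[OF w], rule bdd_aboveI2[where M=2], rule norm_sel_probs_diff_le)
        (rule adap_sel_probs[OF ad[unfolded P] \<omega>]; assumption)+
    have Cb: "kernel_change S P i (\<gamma> (fst w) (snd w) (Suc n) \<omega>) (\<gamma> (fst w) (snd w) n \<omega>) \<le> C i n \<omega>"
      if w: "w \<in> I" and \<omega>: "\<omega> \<in> space \<Omega>" for w i n \<omega>
    proof -
      obtain y where y: "y \<in> space ?X" using X_ne by blast
      show ?thesis unfolding C_def case_prod_unfold
        by (rule cSUP_upper[OF w], rule bdd_aboveI2[where M=1], rule bound[OF _ _ y])
          (rule adap_prop_param[OF ad[unfolded P] \<omega>]; assumption)+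
    qed
    have I_ne: "I \<noteq> {}" using X_ne \<beta> by (auto simp: I_def)
    define t where "t n w = tv_dist (distr \<Omega> ?X (X (fst w) (snd w) n)) \<pi>" for n w
    have bdd: "bdd_above (t n ` I)" for n
      unfolding t_def using tv(2)[OF ad] by (intro bdd_aboveI2[where M=1])
    have "(\<lambda>n. SUP w\<in>I. t n w) \<longlonglongrightarrow> 0"
    proof (rule LIMSEQ_I)
      fix r :: real assume "0 < r"
      then have "0 < r / 2" by simp
      \<comment> \<open>n0 is obtained before any starting value is picked, so the bound r / 2 holds
        for the whole family at once and passes to its supremum.\<close>
      from conv[where C=C and R=R and L=L and ?\<gamma>0.0=\<gamma>0, OF A C this] obtain n0
        where n0: "\<forall>n\<ge>n0. \<forall>x0 \<alpha>0 X \<alpha> \<gamma>.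
          adap_rs_adap_mwg S \<Gamma> P \<epsilon> R L \<gamma>0 x0 \<alpha>0 \<Omega> X \<alpha> \<gamma> \<longrightarrow>
          (\<forall>n. \<forall>\<omega>\<in>space \<Omega>. norm (\<alpha> (Suc n) \<omega> - \<alpha> n \<omega>) \<le> A n \<omega>) \<longrightarrow>
          (\<forall>i n. \<forall>\<omega>\<in>space \<Omega>. kernel_change S P i (\<gamma> (Suc n) \<omega>) (\<gamma> n \<omega>) \<le> C i n \<omega>) \<longrightarrow>
          tv_dist (distr \<Omega> ?X (X n)) \<pi> \<le> r / 2"
        by blast
      have t_le: "t n w \<le> r / 2" if "n \<ge> n0" "w \<in> I" for n w
        unfolding t_def
        by (rule n0[rule_format, OF that(1) ad[OF that(2)]]) (auto intro: Ab[OF that(2)] Cb[OF that(2)])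
      have "norm ((SUP w\<in>I. t n w) - 0) < r" if n: "n \<ge> n0" for n
      proof -
        have "(SUP w\<in>I. t n w) \<le> r / 2" by (rule cSUP_least[OF I_ne t_le[OF n]])
        moreover obtain w where w: "w \<in> I" using I_ne by blast
        moreover have "0 \<le> t n w" unfolding t_def by (rule tv(1)[OF ad[OF w]])
        moreover have "t n w \<le> (SUP w\<in>I. t n w)" by (rule cSUP_upper[OF w bdd])
        ultimately show ?thesis using \<open>0 < r\<close> by simp
      qed
      then show "\<exists>n0. \<forall>n\<ge>n0. norm ((SUP w\<in>I. t n w) - 0) < r" by blast
    qed
    then show "(\<lambda>n. SUP (x0, \<alpha>0)\<in>space ?X \<times> ?Y. tv_dist (distr \<Omega> ?X (X x0 \<alpha>0 n)) \<pi>) \<longlonglongrightarrow> 0"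
      by (simp add: t_def I_def case_prod_unfold)
  qed
qed

end
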